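(* Let $\Omega$, $P$, $\lambda_j$, $\Phi_j$ be as in the context, let $\omega$ be an open and nonempty subset of $\Omega$ and let $\sigma\in(0,1)$. Suppose that one of the (equivalent) statements (i)–(iv) of the context holds, and that there are constants $c,\rho>0$ with $$\mathrm{Card}\{i:\lambda_i\le\Lambda\}\le c\Lambda^{1/\rho}\quad\text{for any }\Lambda>0.$$ Then for any $T>0$ there are $b,\eta>1$ and $C,K>0$ such that, with the times $t_m=T(1-b^{-m})$ and the operators $\mathcal{F}_m:L^2(\Omega)\to L^2(\omega)$, $m\ge0$, associated with $T,b,\eta$ as in the context, for any $z_0\in L^2(\Omega)$ the solution $z$ to $$\begin{cases}z'(t)+Pz(t)=0,&t\in(0,T)\setminus\bigcup_{m\ge0}\left\{\frac{t_m+t_{m+1}}2\right\},\\ z\left(\frac{t_m+t_{m+1}}2\right)=z\left(\left(\frac{t_m+t_{m+1}}2\right)_-\right)+1_\omega\mathcal{F}_m(z(t_m)),&\text{for any integer }m\ge0,\\ z(0)=z_0,\end{cases}$$ satisfies $$\|z(t)\|\le Ce^{-\frac1K\left(\frac T{T-t}\right)^{\frac\sigma{1-\sigma}}}\|z_0\|\quad\text{for any }0\le t<T.$$ Further, $\lim_{m\to\infty}\|\mathcal{F}_m(z(t_m))\|_\omega=0$.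
   Context: $\Omega$ is a bounded domain of $\mathbb{R}^d$, $d\ge1$, with boundary of class $C^2$, and $H=L^2(\Omega)$ (real Hilbert space) with norm $\|\cdot\|$ and inner product $\langle\cdot,\cdot\rangle$; $\|\cdot\|_\omega$ is the norm of $L^2(\omega)$; $1_\omega g$ is the extension of $g$ by $0$ to $\Omega$. $P:D(P)\subset H\to H$ is a linear self-adjoint operator that is an isomorphism from $D(P)$ (with the graph norm) onto $H$, with $P^{-1}$ compact in $H$ and $\langle P\vartheta,\vartheta\rangle>0$ for all nonzero $\vartheta\in D(P)$; eigenvalues $0<\lambda_1\le\lambda_2\le\dots\to\infty$, orthonormal eigenbasis $\{\Phi_j\}_{j\ge1}$. Below, $u$ is the solution $u(t)=e^{-tP}u(0)$ of $u'+Pu=0$. Impulsive solutions evolve by $e^{-tP}$ between impulse times and jump at the impulse times as indicated; $s_-$ denotes the left limit at $s$. The four statements (equivalent to each other) are: (i) there is $C_1>0$ such that for all $\Lambda>0$ and real $a_j$: $\sum_{\lambda_j\le\Lambda}|a_j|^2\le e^{C_1(1+\Lambda^\sigma)}\int_\omega|\sum_{\lambda_j\le\Lambda}a_j\Phi_j|^2$; (ii) there is $C_2>0$ such that for all $\theta\in(0,1)$, $t>0$, $u(0)\in L^2(\Omega)$: $\|u(t)\|\le e^{C_2(1+(\frac1{\theta t})^{\sigma/(1-\sigma)})}\|u(0)\|^\theta\|u(t)\|_\omega^{1-\theta}$; (iii) there is $C_3>0$ such that for all $\varepsilon>0$, $t>0$, $u(0)\in L^2(\Omega)$: $\|u(t)\|^2\le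 e^{C_3(1+(\frac1t)^{\sigma/(1-\sigma)})}e^{(\frac{C_3}t\ln(e+\frac1\varepsilon))^\sigma}\|u(t)\|_\omega^2+\varepsilon\|u(0)\|^2$; (iv) there is $C_4>0$ such that for all $t>0$, $u(0)\in L^2(\Omega)\setminus\{0\}$: $\|u(t)\|\le e^{C_4(1+(\frac1t)^{\sigma/(1-\sigma)})}e^{(\frac{C_4}t\ln(\|u(0)\|/\|u(t)\|))^\sigma}\|u(t)\|_\omega$. Construction of $\mathcal{F}_m$. Let $C_3$ be the constant of (iii), $\beta=\frac\sigma{1-\sigma}$. Given $T>0$, $b>1$, $\eta>1$, let $t_m=T(1-b^{-m})$, $\Lambda_m=\lambda_1+\left(\frac\eta T\frac b{b-1}\right)b^{(\beta+1)m}$ and $N_m=\mathrm{Card}\{i:\lambda_i\le\Lambda_m\}$. For each $m\ge0$ and each $j$ with $\lambda_j\le\Lambda_m$, let $f_j=f_{j}^{(m)}\in L^2(\omega)$ be an impulse control for the initial datum $\Phi_j$ (such a control exists under (iii)), i.e. the solution of $y_j'+Py_j=0$ on $(t_m,t_{m+1})\setminus\{\frac{t_m+t_{m+1}}2\}$, $y_j(t_m)=\Phi_j$, $y_j(\frac{t_m+t_{m+1}}2)=y_j((\frac{t_m+t_{m+1}}2)_-)+1_\omega f_j$, satisfies $$\|y_j(t_{m+1})\|^2\le\frac{e^{-\eta b^{\beta m}}}{N_m}\quad\text{and}\quad\|f_j\|_\omega^2\le e^{C_3\left(1+\left(\frac2{t_{m+1}-t_m}\right)^\beta\right)}e^{\left(\frac{2C_3}{t_{m+1}-t_m}\ln\left(e+e^{\eta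 b^{\beta m}}N_m\right)\right)^\sigma}.$$ Then $\mathcal{F}_m:L^2(\Omega)\to L^2(\omega)$ is the bounded linear operator $\mathcal{F}_m(\vartheta)=\sum_{\lambda_j\le\Lambda_m}\langle\vartheta,\Phi_j\rangle f_j$. *)

theory Defs
  imports "HOL-Analysis.Analysis"
begin

text \<open>
  The type \<open>'a l2\<close> is the space of real square-integrable functions on the whole space,
  modulo equality almost everywhere.  For a set \<open>A\<close>, the space \<open>L2_on A\<close> is identified with
  the closed subspace of the classes that vanish almost everywhere outside \<open>A\<close>; thus
  \<open>L2_on A\<close> is contained in \<open>L2_on B\<close> whenever \<open>A\<close> is contained in \<open>B\<close>, norms and inner
  products being preserved.
\<close>

definition sq_integrable :: "('a::euclidean_space \<Rightarrow> real) \<Rightarrow> bool" where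
  "sq_integrable f \<longleftrightarrow>
     f \<in> borel_measurable lebesgue \<and> integrable lebesgue (\<lambda>x. (f x)\<^sup>2)"

definition l2_eq :: "('a::euclidean_space \<Rightarrow> real) \<Rightarrow> ('a \<Rightarrow> real) \<Rightarrow> bool" where
  "l2_eq f g \<longleftrightarrow> sq_integrable f \<and> sq_integrable g \<and> (AE x in lebesgue. f x = g x)"

lemma sq_integrable_zero: "sq_integrable (\<lambda>x. 0)"
  by (simp add: sq_integrable_def)

lemma sq_integrable_mult:
  assumes "sq_integrable f" "sq_integrable g"
  shows "integrable lebesgue (\<lambda>x. f x * g x)"
proof (rule Bochner_Integration.integrable_bound)
  show "integrable lebesgue (\<lambda>x. (f x)\<^sup>2 + (g x)\<^sup>2)"
    using assms by (simp add: sq_integrable_def)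
  show "(\<lambda>x. f x * g x) \<in> borel_measurable lebesgue"
    using assms by (auto simp: sq_integrable_def)
  have "norm (a * b) \<le> norm (a\<^sup>2 + b\<^sup>2)" for a b :: real
  proof -
    have "2 * \<bar>a * b\<bar> \<le> a\<^sup>2 + b\<^sup>2"
      using sum_squares_bound[of "\<bar>a\<bar>" "\<bar>b\<bar>"] by (simp add: abs_mult)
    then show ?thesis by simp
  qed
  then show "AE x in lebesgue. norm (f x * g x) \<le> norm ((f x)\<^sup>2 + (g x)\<^sup>2)"
    by auto
qed

lemma sq_integrable_add:
  assumes "sq_integrable f" "sq_integrable g"
  shows "sq_integrable (\<lambda>x. f x + g x)"
  using assms sq_integrable_mult[OF assms]
  by (auto simp: sq_integrable_def power2_sum mult.assoc)

lemma sq_integrable_cmult: "sq_integrable f \<Longrightarrow> sq_integrable (\<lambda>x. c * f x)"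
  by (auto simp: sq_integrable_def power_mult_distrib)

lemma sq_integrable_restrict:
  assumes "sq_integrable f" "A \<in> sets lebesgue"
  shows "sq_integrable (\<lambda>x. indicator A x * f x)"
proof -
  have "integrable lebesgue (\<lambda>x. indicator A x *\<^sub>R (f x)\<^sup>2)"
    using assms by (intro integrable_mult_indicator) (auto simp: sq_integrable_def)
  moreover have "(indicator A x *\<^sub>R (f x)\<^sup>2) = (indicator A x * f x)\<^sup>2" for x
    by (simp add: indicator_def)
  moreover have "(\<lambda>x. indicator A x * f x) \<in> borel_measurable lebesgue"
    using assms by (intro borel_measurable_times borel_measurable_indicator)
      (auto simp: sq_integrable_def)
  ultimately show ?thesis
    by (simp add: sq_integrable_def)
qed

quotient_type (overloaded) 'a l2 = "'a::euclidean_space \<Rightarrow> real" / partial: l2_eq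
proof (rule part_equivpI)
  show "\<exists>f. l2_eq f f"
    using sq_integrable_zero by (auto simp: l2_eq_def)
  show "symp l2_eq"
    by (auto simp: symp_def l2_eq_def)
  show "transp l2_eq"
    by (auto simp: transp_def l2_eq_def elim: AE_mp)
qed

instantiation l2 :: (euclidean_space) real_vector
begin

lift_definition zero_l2 :: "'a l2" is "\<lambda>x. 0"
  by (simp add: l2_eq_def sq_integrable_zero)

lift_definition plus_l2 :: "'a l2 \<Rightarrow> 'a l2 \<Rightarrow> 'a l2" is "\<lambda>f g x. f x + g x"
  by (auto simp: l2_eq_def sq_integrable_add)

lift_definition scaleR_l2 :: "real \<Rightarrow> 'a l2 \<Rightarrow> 'a l2" is "\<lambda>c f x. c * f x"
  by (auto simp: l2_eq_def sq_integrable_cmult)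

lift_definition uminus_l2 :: "'a l2 \<Rightarrow> 'a l2" is "\<lambda>f x. - f x"
  by (auto simp: l2_eq_def sq_integrable_def)

definition minus_l2 :: "'a l2 \<Rightarrow> 'a l2 \<Rightarrow> 'a l2" where "minus_l2 f g = f + - g"

instance
proof
  fix a b c :: "'a l2" and r s :: real
  show "a + b + c = a + (b + c)"
    by transfer (auto simp: l2_eq_def add.assoc intro!: sq_integrable_add)
  show "a + b = b + a"
    by transfer (auto simp: l2_eq_def add.commute intro!: sq_integrable_add)
  show "0 + a = a"
    by transfer (auto simp: l2_eq_def)
  show "- a + a = 0"
    by transfer (auto simp: l2_eq_def sq_integrable_zero)
  show "a - b = a + - b"
    by (simp add: minus_l2_def)
  show "r *\<^sub>R (a + b) = r *\<^sub>R a + r *\<^sub>R b"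
    by transfer (auto simp: l2_eq_def distrib_left sq_integrable_add sq_integrable_cmult)
  show "(r + s) *\<^sub>R a = r *\<^sub>R a + s *\<^sub>R a"
    by transfer (auto simp: l2_eq_def distrib_right sq_integrable_add sq_integrable_cmult)
  show "r *\<^sub>R s *\<^sub>R a = (r * s) *\<^sub>R a"
    by transfer (auto simp: l2_eq_def mult.assoc sq_integrable_cmult)
  show "1 *\<^sub>R a = a"
    by transfer (auto simp: l2_eq_def)
qed

end

instantiation l2 :: (euclidean_space) real_inner
begin

lift_definition inner_l2 :: "'a l2 \<Rightarrow> 'a l2 \<Rightarrow> real" is
  "\<lambda>f g. \<integral>x. f x * g x \<partial>lebesgue"
  by (intro integral_cong_AE) (auto simp: l2_eq_def sq_integrable_def elim: AE_mp)

definition norm_l2 :: "'a l2 \<Rightarrow> real" where "norm_l2 f = sqrt (inner f f)"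
definition dist_l2 :: "'a l2 \<Rightarrow> 'a l2 \<Rightarrow> real" where "dist_l2 f g = norm (f - g)"
definition sgn_l2 :: "'a l2 \<Rightarrow> 'a l2" where "sgn_l2 f = f /\<^sub>R norm f"
definition uniformity_l2 :: "('a l2 \<times> 'a l2) filter" where
  "uniformity_l2 = (INF e\<in>{0<..}. principal {(f, g). dist f g < e})"
definition open_l2 :: "'a l2 set \<Rightarrow> bool" where
  "open_l2 U \<longleftrightarrow> (\<forall>f\<in>U. \<forall>\<^sub>F (f', g) in uniformity. f' = f \<longrightarrow> g \<in> U)"

instance
proof
  fix a b c :: "'a l2" and r :: real and U :: "'a l2 set"
  show "dist a b = norm (a - b)"
    by (simp add: dist_l2_def)
  show "sgn a = a /\<^sub>R norm a"
    by (simp add: sgn_l2_def)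
  show "(uniformity :: ('a l2 \<times> 'a l2) filter)
          = (INF e\<in>{0<..}. principal {(f, g). dist f g < e})"
    by (simp add: uniformity_l2_def)
  show "open U = (\<forall>f\<in>U. \<forall>\<^sub>F (f', g) in uniformity. f' = f \<longrightarrow> g \<in> U)"
    by (simp add: open_l2_def)
  show "inner a b = inner b a"
    by transfer (simp add: mult.commute)
  show "inner (a + b) c = inner a c + inner b c"
    by transfer (simp add: l2_eq_def distrib_right sq_integrable_mult)
  show "inner (r *\<^sub>R a) b = r * inner a b"
    by transfer (simp add: mult.assoc)
  show "0 \<le> inner a a"
    by transfer simp
  show "(inner a a = 0) = (a = 0)"
  proof transfer
    fix f :: "'a \<Rightarrow> real"
    assume f: "l2_eq f f"
    have "((\<integral>x. f x * f x \<partial>lebesgue) = 0) = (AE x in lebesgue. f x * f x = 0)"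
      using f by (intro integral_nonneg_eq_0_iff_AE) (auto simp: l2_eq_def sq_integrable_mult)
    then show "((\<integral>x. f x * f x \<partial>lebesgue) = 0) = l2_eq f (\<lambda>x. 0)"
      using f by (simp add: l2_eq_def sq_integrable_zero)
  qed
  show "norm a = sqrt (inner a a)"
    by (simp add: norm_l2_def)
qed

end

lift_definition vanishes_outside :: "'a::euclidean_space set \<Rightarrow> 'a l2 \<Rightarrow> bool" is
  "\<lambda>A f. AE x in lebesgue. x \<notin> A \<longrightarrow> f x = 0"
  by (auto simp: l2_eq_def elim: AE_mp)

definition L2_on :: "'a::euclidean_space set \<Rightarrow> 'a l2 set" where
  "L2_on A = {f. vanishes_outside A f}"

text \<open>
  Multiplication by the indicator function of \<open>A\<close>; on \<open>L2_on A\<close> it is the extension by zero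
  (see \<open>ext_zero_L2_on\<close>).  The zero function is a dummy value for non-measurable \<open>A\<close>.
\<close>

lift_definition ext_zero :: "'a::euclidean_space set \<Rightarrow> 'a l2 \<Rightarrow> 'a l2" is
  "\<lambda>A f x. if A \<in> sets lebesgue then indicator A x * f x else 0"
proof -
  fix A :: "'a set" and f g :: "'a \<Rightarrow> real"
  assume "l2_eq f g"
  then show "l2_eq (\<lambda>x. if A \<in> sets lebesgue then indicator A x * f x else 0)
                   (\<lambda>x. if A \<in> sets lebesgue then indicator A x * g x else 0)"
    by (cases "A \<in> sets lebesgue")
      (auto simp: l2_eq_def sq_integrable_restrict sq_integrable_zero elim: AE_mp)
qed

lift_definition norm_on :: "'a::euclidean_space set \<Rightarrow> 'a l2 \<Rightarrow> real" is
  "\<lambda>A f. sqrt (LINT x:A|lebesgue. (f x)\<^sup>2)"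
proof -
  fix A :: "'a set" and f g :: "'a \<Rightarrow> real"
  define F where "F = (\<lambda>x. indicator A x *\<^sub>R (f x)\<^sup>2)"
  define G where "G = (\<lambda>x. indicator A x *\<^sub>R (g x)\<^sup>2)"
  assume "l2_eq f g"
  then have FG: "AE x in lebesgue. F x = G x" and GF: "AE x in lebesgue. G x = F x"
    by (auto simp: l2_eq_def F_def G_def elim: AE_mp)
  have "integral\<^sup>L lebesgue F = integral\<^sup>L lebesgue G"
  proof (cases "F \<in> borel_measurable lebesgue")
    case True
    then have "G \<in> borel_measurable lebesgue"
      using FG by (rule borel_measurable_AE)
    with True FG show ?thesis
      by (intro integral_cong_AE)
  next
    case False
    then have "G \<notin> borel_measurable lebesgue"
      using GF borel_measurable_AE by blast
    with False have "\<not> integrable lebesgue F" "\<not> integrable lebesgue G"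
      by (auto dest: borel_measurable_integrable)
    then show ?thesis
      by (simp add: not_integrable_integral_eq)
  qed
  then show "sqrt (LINT x:A|lebesgue. (f x)\<^sup>2) = sqrt (LINT x:A|lebesgue. (g x)\<^sup>2)"
    by (simp add: set_lebesgue_integral_def F_def G_def)
qed

lemma ext_zero_L2_on:
  assumes "A \<in> sets lebesgue" "f \<in> L2_on A"
  shows "ext_zero A f = f"
  using assms unfolding L2_on_def mem_Collect_eq
proof (transfer)
  fix A :: "'a set" and f :: "'a \<Rightarrow> real"
  assume f: "l2_eq f f" and A: "A \<in> sets lebesgue"
    and v: "AE x in lebesgue. x \<notin> A \<longrightarrow> f x = 0"
  have "AE x in lebesgue. indicator A x * f x = f x"
    using v by (rule AE_mp) (auto simp: indicator_def)
  then show "l2_eq (\<lambda>x. if A \<in> sets lebesgue then indicator A x * f x else 0) f"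
    using f A by (simp add: l2_eq_def sq_integrable_restrict)
qed

lemma norm_on_eq: "A \<in> sets lebesgue \<Longrightarrow> norm_on A f = norm (ext_zero A f)"
  unfolding norm_eq_sqrt_inner
  by transfer (auto simp: set_lebesgue_integral_def power2_eq_square indicator_def
      intro!: Bochner_Integration.integral_cong)

definition C2_function :: "('a::euclidean_space \<Rightarrow> real) \<Rightarrow> bool" where
  "C2_function g \<longleftrightarrow>
     (\<exists>(g' :: 'a \<Rightarrow> 'a \<Rightarrow>\<^sub>L real) (g'' :: 'a \<Rightarrow> 'a \<Rightarrow>\<^sub>L 'a \<Rightarrow>\<^sub>L real).
        continuous_on UNIV g'' \<and>
        (\<forall>x. (g has_derivative blinfun_apply (g' x)) (at x) \<and>
             (g' has_derivative blinfun_apply (g'' x)) (at x)))"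

text \<open>
  Near each boundary point the domain is, after a rotation of the axes, the strict epigraph of
  a \<open>C\<^sup>2\<close> function; here \<open>\<nu>\<close> is the direction of the last axis and \<open>\<gamma>\<close> is only evaluated on
  the hyperplane orthogonal to \<open>\<nu>\<close>.
\<close>

definition C2_boundary :: "'a::euclidean_space set \<Rightarrow> bool" where
  "C2_boundary \<Omega> \<longleftrightarrow>
     (\<forall>p\<in>frontier \<Omega>. \<exists>r>0. \<exists>\<nu> \<gamma>. norm \<nu> = 1 \<and> C2_function \<gamma> \<and>
        \<Omega> \<inter> ball p r = {x \<in> ball p r. \<gamma> (x - inner x \<nu> *\<^sub>R \<nu>) < inner x \<nu>})"

definition bounded_C2_domain :: "'a::euclidean_space set \<Rightarrow> bool" where
  "bounded_C2_domain \<Omega> \<longleftrightarrow>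
     open \<Omega> \<and> connected \<Omega> \<and> \<Omega> \<noteq> {} \<and> bounded \<Omega> \<and> C2_boundary \<Omega>"

text \<open>
  An unbounded operator in the Hilbert space \<open>H\<close> (a closed subspace of the ambient type) is a
  function \<open>P\<close> together with its domain \<open>D\<close>; the values of \<open>P\<close> outside \<open>D\<close> are irrelevant.
  The last clause of \<open>self_adjoint_on\<close> says that the graph of the adjoint of \<open>P\<close> in \<open>H\<close> equals
  the graph of \<open>P\<close>.
\<close>

definition linear_operator_on :: "'h::real_inner set \<Rightarrow> 'h set \<Rightarrow> ('h \<Rightarrow> 'h) \<Rightarrow> bool" where
  "linear_operator_on H D P \<longleftrightarrow>
     subspace D \<and> D \<subseteq> H \<and> P ` D \<subseteq> H \<and>
     (\<forall>f\<in>D. \<forall>g\<in>D. P (f + g) = P f + P g) \<and> (\<forall>r. \<forall>f\<in>D. P (r *\<^sub>R f) = r *\<^sub>R P f)"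

definition self_adjoint_on :: "'h::real_inner set \<Rightarrow> 'h set \<Rightarrow> ('h \<Rightarrow> 'h) \<Rightarrow> bool" where
  "self_adjoint_on H D P \<longleftrightarrow>
     linear_operator_on H D P \<and> H \<subseteq> closure D \<and>
     (\<forall>g\<in>H. \<forall>h\<in>H. (\<forall>f\<in>D. inner (P f) g = inner f h) \<longleftrightarrow> g \<in> D \<and> P g = h)"

definition graph_norm :: "('h::real_inner \<Rightarrow> 'h) \<Rightarrow> 'h \<Rightarrow> real" where
  "graph_norm P f = sqrt ((norm f)\<^sup>2 + (norm (P f))\<^sup>2)"

definition graph_isomorphism :: "'h::real_inner set \<Rightarrow> 'h set \<Rightarrow> ('h \<Rightarrow> 'h) \<Rightarrow> bool" where
  "graph_isomorphism H D P \<longleftrightarrow>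
     bij_betw P D H \<and>
     (\<exists>c. \<forall>f\<in>D. norm (P f) \<le> c * graph_norm P f) \<and>
     (\<exists>c. \<forall>f\<in>D. graph_norm P f \<le> c * norm (P f))"

definition compact_operator_on :: "'h::real_inner set \<Rightarrow> ('h \<Rightarrow> 'h) \<Rightarrow> bool" where
  "compact_operator_on H K \<longleftrightarrow> (\<forall>B. B \<subseteq> H \<and> bounded B \<longrightarrow> compact (closure (K ` B)))"

text \<open>The sequences are indexed from \<open>0\<close>: \<open>lam j\<close> and \<open>\<Phi> j\<close> stand for \<open>\<lambda>\<^bsub>j+1\<^esub>\<close> and \<open>\<Phi>\<^bsub>j+1\<^esub>\<close>.\<close>

definition orthonormal_eigenbasis ::
    "'h::real_inner set \<Rightarrow> 'h set \<Rightarrow> ('h \<Rightarrow> 'h) \<Rightarrow> (nat \<Rightarrow> real) \<Rightarrow> (nat \<Rightarrow> 'h) \<Rightarrow> bool" where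
  "orthonormal_eigenbasis H D P lam \<Phi> \<longleftrightarrow>
     0 < lam 0 \<and> mono lam \<and> filterlim lam at_top sequentially \<and>
     (\<forall>j. \<Phi> j \<in> D \<and> P (\<Phi> j) = lam j *\<^sub>R \<Phi> j) \<and>
     (\<forall>i j. inner (\<Phi> i) (\<Phi> j) = (if i = j then 1 else 0)) \<and>
     closure (span (range \<Phi>)) = H"

definition eigen_count :: "(nat \<Rightarrow> real) \<Rightarrow> real \<Rightarrow> nat" where
  "eigen_count lam \<Lambda> = card {i. lam i \<le> \<Lambda>}"

text \<open>The trajectories \<open>u(t) = e\<^bsup>-tP\<^esup>u(0)\<close>, characterised as the solutions of \<open>u' + Pu = 0\<close>.\<close>

definition evolution :: "'h::real_inner set \<Rightarrow> ('h \<Rightarrow> 'h) \<Rightarrow> (real \<Rightarrow> 'h) \<Rightarrow> bool" where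
  "evolution D P u \<longleftrightarrow>
     continuous_on {0..} u \<and>
     (\<forall>t>0. u t \<in> D \<and> (u has_vector_derivative - P (u t)) (at t))"

text \<open>
  Solutions on the interval \<open>I\<close> with impulses at the times \<open>s m\<close> (\<open>m \<in> M\<close>), where the jump is
  \<open>J m\<close>.  They are continuous on \<open>I\<close> off the impulse times (one-sidedly at the end points that
  belong to \<open>I\<close>), right-continuous at impulse times, and have left limits there.
\<close>

definition impulsive_solution ::
    "'h::real_inner set \<Rightarrow> ('h \<Rightarrow> 'h) \<Rightarrow> real set \<Rightarrow> nat set \<Rightarrow> (nat \<Rightarrow> real) \<Rightarrow> (nat \<Rightarrow> 'h) \<Rightarrow>
     (real \<Rightarrow> 'h) \<Rightarrow> bool" where
  "impulsive_solution D P I M s J z \<longleftrightarrow>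
     (\<forall>t \<in> interior I - s ` M. z t \<in> D \<and> (z has_vector_derivative - P (z t)) (at t)) \<and>
     (\<forall>t \<in> I - s ` M. continuous (at t within I) z) \<and>
     (\<forall>m\<in>M. (z \<longlongrightarrow> z (s m)) (at_right (s m)) \<and>
             (\<exists>l. (z \<longlongrightarrow> l) (at_left (s m)) \<and> z (s m) = l + J m))"

definition spectral_inequality ::
    "'a::euclidean_space set \<Rightarrow> (nat \<Rightarrow> real) \<Rightarrow> (nat \<Rightarrow> 'a l2) \<Rightarrow> real \<Rightarrow> real \<Rightarrow> bool" where
  "spectral_inequality \<omega> lam \<Phi> \<sigma> C1 \<longleftrightarrow>
     (\<forall>\<Lambda>>0. \<forall>a :: nat \<Rightarrow> real.
        (\<Sum>j | lam j \<le> \<Lambda>. \<bar>a j\<bar>\<^sup>2)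
          \<le> exp (C1 * (1 + \<Lambda> powr \<sigma>)) * (norm_on \<omega> (\<Sum>j | lam j \<le> \<Lambda>. a j *\<^sub>R \<Phi> j))\<^sup>2)"

definition interpolation_inequality ::
    "'a::euclidean_space set \<Rightarrow> 'a set \<Rightarrow> 'a l2 set \<Rightarrow> ('a l2 \<Rightarrow> 'a l2) \<Rightarrow> real \<Rightarrow> real \<Rightarrow> bool" where
  "interpolation_inequality \<Omega> \<omega> D P \<sigma> C2 \<longleftrightarrow>
     (\<forall>\<theta>\<in>{0<..<1}. \<forall>t>0. \<forall>u. evolution D P u \<and> u 0 \<in> L2_on \<Omega> \<longrightarrow>
        norm (u t)
          \<le> exp (C2 * (1 + (1 / (\<theta> * t)) powr (\<sigma> / (1 - \<sigma>))))
             * norm (u 0) powr \<theta> * norm_on \<omega> (u t) powr (1 - \<theta>))"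

definition approximate_observability ::
    "'a::euclidean_space set \<Rightarrow> 'a set \<Rightarrow> 'a l2 set \<Rightarrow> ('a l2 \<Rightarrow> 'a l2) \<Rightarrow> real \<Rightarrow> real \<Rightarrow> bool" where
  "approximate_observability \<Omega> \<omega> D P \<sigma> C3 \<longleftrightarrow>
     (\<forall>\<epsilon>>0. \<forall>t>0. \<forall>u. evolution D P u \<and> u 0 \<in> L2_on \<Omega> \<longrightarrow>
        (norm (u t))\<^sup>2
          \<le> exp (C3 * (1 + (1 / t) powr (\<sigma> / (1 - \<sigma>))))
              * exp ((C3 / t * ln (exp 1 + 1 / \<epsilon>)) powr \<sigma>) * (norm_on \<omega> (u t))\<^sup>2
            + \<epsilon> * (norm (u 0))\<^sup>2)"

definition frequency_observability ::
    "'a::euclidean_space set \<Rightarrow> 'a set \<Rightarrow> 'a l2 set \<Rightarrow> ('a l2 \<Rightarrow> 'a l2) \<Rightarrow> real \<Rightarrow> real \<Rightarrow> bool" where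
  "frequency_observability \<Omega> \<omega> D P \<sigma> C4 \<longleftrightarrow>
     (\<forall>t>0. \<forall>u. evolution D P u \<and> u 0 \<in> L2_on \<Omega> - {0} \<longrightarrow>
        norm (u t)
          \<le> exp (C4 * (1 + (1 / t) powr (\<sigma> / (1 - \<sigma>))))
              * exp ((C4 / t * ln (norm (u 0) / norm (u t))) powr \<sigma>) * norm_on \<omega> (u t))"

definition grid_time :: "real \<Rightarrow> real \<Rightarrow> nat \<Rightarrow> real" where
  "grid_time T b m = T * (1 - inverse (b ^ m))"

definition impulse_time :: "real \<Rightarrow> real \<Rightarrow> nat \<Rightarrow> real" where
  "impulse_time T b m = (grid_time T b m + grid_time T b (Suc m)) / 2"

definition cutoff :: "(nat \<Rightarrow> real) \<Rightarrow> real \<Rightarrow> real \<Rightarrow> real \<Rightarrow> real \<Rightarrow> nat \<Rightarrow> real" where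
  "cutoff lam \<sigma> T b \<eta> m =
     lam 0 + (\<eta> / T * (b / (b - 1))) * b powr ((\<sigma> / (1 - \<sigma>) + 1) * real m)"

text \<open>
  \<open>f\<close> is an admissible impulse control on the \<open>m\<close>-th interval for the initial datum \<open>\<Phi> j\<close>.
  The steered trajectory \<open>y\<close> is uniquely determined on the interval.
\<close>

definition impulse_control ::
    "'a::euclidean_space set \<Rightarrow> 'a l2 set \<Rightarrow> ('a l2 \<Rightarrow> 'a l2) \<Rightarrow> (nat \<Rightarrow> real) \<Rightarrow> (nat \<Rightarrow> 'a l2) \<Rightarrow>
     real \<Rightarrow> real \<Rightarrow> real \<Rightarrow> real \<Rightarrow> real \<Rightarrow> nat \<Rightarrow> nat \<Rightarrow> 'a l2 \<Rightarrow> bool" where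
  "impulse_control \<omega> D P lam \<Phi> \<sigma> C3 T b \<eta> m j f \<longleftrightarrow>
     (let \<beta> = \<sigma> / (1 - \<sigma>);
          t0 = grid_time T b m;
          t1 = grid_time T b (Suc m);
          N = real (eigen_count lam (cutoff lam \<sigma> T b \<eta> m))
      in f \<in> L2_on \<omega> \<and>
         (\<exists>y. impulsive_solution D P {t0..t1} {m} (impulse_time T b) (\<lambda>_. ext_zero \<omega> f) y \<and>
              y t0 = \<Phi> j \<and>
              (norm (y t1))\<^sup>2 \<le> exp (- \<eta> * b powr (\<beta> * real m)) / N) \<and>
         (norm_on \<omega> f)\<^sup>2
           \<le> exp (C3 * (1 + (2 / (t1 - t0)) powr \<beta>))
               * exp ((2 * C3 / (t1 - t0) * ln (exp 1 + exp (\<eta> * b powr (\<beta> * real m)) * N))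
                        powr \<sigma>))"

definition impulse_control_family ::
    "'a::euclidean_space set \<Rightarrow> 'a l2 set \<Rightarrow> ('a l2 \<Rightarrow> 'a l2) \<Rightarrow> (nat \<Rightarrow> real) \<Rightarrow> (nat \<Rightarrow> 'a l2) \<Rightarrow>
     real \<Rightarrow> real \<Rightarrow> real \<Rightarrow> real \<Rightarrow> real \<Rightarrow> (nat \<Rightarrow> nat \<Rightarrow> 'a l2) \<Rightarrow> bool" where
  "impulse_control_family \<omega> D P lam \<Phi> \<sigma> C3 T b \<eta> f \<longleftrightarrow>
     (\<forall>m j. lam j \<le> cutoff lam \<sigma> T b \<eta> m \<longrightarrow>
            impulse_control \<omega> D P lam \<Phi> \<sigma> C3 T b \<eta> m j (f m j))"

definition feedback ::
    "(nat \<Rightarrow> real) \<Rightarrow> (nat \<Rightarrow> 'a::euclidean_space l2) \<Rightarrow> real \<Rightarrow> real \<Rightarrow> real \<Rightarrow> real \<Rightarrow>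
     (nat \<Rightarrow> nat \<Rightarrow> 'a l2) \<Rightarrow> nat \<Rightarrow> 'a l2 \<Rightarrow> 'a l2" where
  "feedback lam \<Phi> \<sigma> T b \<eta> f m \<theta> =
     (\<Sum>j | lam j \<le> cutoff lam \<sigma> T b \<eta> m. inner \<theta> (\<Phi> j) *\<^sub>R f m j)"

end

theory Submission
  imports Defs
begin

text \<open>
  All trajectories are read off from their coefficients in the eigenbasis. Statements (i), (ii) and
  (iv) give (iii) by choosing \<open>\<Lambda>\<close>, respectively \<open>\<theta>\<close>, as a function of \<open>t\<close> and \<open>ln (e + 1/\<epsilon>)\<close>.
  Statement (iii) gives the impulse controls by duality.

  On the \<open>m\<close>-th interval the modes below the cutoff are steered almost to zero and the modes above
  it decay by \<open>exp (- \<eta> b\<^bsup>\<beta>m\<^esup>)\<close>, so \<open>\<parallel>z(t\<^bsub>m+1\<^esub>)\<parallel> \<le> exp (- \<eta> b\<^bsup>\<beta>m\<^esup>/4) \<parallel>z(t\<^sub>m)\<parallel>\<close>.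
  The damping rate is linear in \<open>\<eta>\<close> while the logarithm of the control cost is \<open>O(\<eta>\<^sup>\<sigma> b\<^bsup>\<beta>m\<^esup>)\<close>;
  hence \<open>b = 2\<close> and any sufficiently large \<open>\<eta>\<close> work.
\<close>

section \<open>Expansion in the eigenbasis\<close>

text \<open>The scales match because (\<beta> + 1) \<sigma> = \<beta>. The \<open>m\<close>-th
  interval has length of order b^(-m), so a cutoff of order \<eta> b^((\<beta>+1)m) is what produces
  the exponent \<eta> b^(\<beta>m) of the damping. In the control cost the inverse length multiplies
  \<eta> b^(\<beta>m) inside a power \<sigma>, and this is again of order b^(\<beta>m) in
  \<open>m\<close>. The eigenvalue count enters that power through its logarithm and the total cost
  as a factor; polynomial growth makes its logarithm O(m + ln \<eta>), which is of lower order. The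
  control of step \<open>m\<close> acts on a state that has only gained from the earlier steps, so
  its cost has to be paid out of the damping at b^(\<beta>(m-1)). The obstacle is that
  \<open>'a l2\<close> is used as an inner product space only, without completeness: neither Riesz
  representation nor minimisation over \<open>H\<close> is at hand. Infinite expansions therefore
  come from compactness of the inverse of \<open>P\<close>, and the duality argument is carried out
  on the span of finitely many eigenvectors, where the following lemma solves the variational
  equation.\<close>

lemma finite_dim_lax_milgram:
  fixes a :: "'h::real_vector \<Rightarrow> 'h \<Rightarrow> real"
  assumes "finite B" "bilinear a" and pos: "\<And>x. x \<noteq> 0 \<Longrightarrow> a x x > 0" and "linear g"
  shows "\<exists>u\<in>span B. \<forall>v\<in>span B. a u v = g v"
  using assms(1,4)
proof (induction B arbitrary: g rule: finite_induct)
  case empty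
  then show ?case
    by (auto intro!: bexI[of _ 0] simp: linear_0 bilinear_lzero[OF \<open>bilinear a\<close>])
next
  case (insert b B)
  have lin1: "linear (a x)" for x
    using \<open>bilinear a\<close> by (simp add: bilinear_def)
  have lin2: "linear (\<lambda>x. a x y)" for y
    using \<open>bilinear a\<close> by (simp add: bilinear_def)
  obtain u where u: "u \<in> span B" "\<And>v. v \<in> span B \<Longrightarrow> a u v = g v"
    using insert.IH[OF insert.prems] by blast
  \<comment> \<open>The induction runs over all \<open>g\<close>, so it also applies to the
    functional \<open>a b\<close>. Subtracting its representative gives \<open>w\<close> with
    \<open>a w v = 0\<close> on \<open>span B\<close>; adding a multiple of \<open>w\<close> to
    \<open>u\<close> therefore changes only the value at \<open>w\<close>, which \<open>r\<close>
    adjusts. If \<open>w = 0\<close>, division by zero makes \<open>r = 0\<close>, and both sides of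
    \<open>rw\<close> vanish.\<close>
  obtain b' where b': "b' \<in> span B" "\<And>v. v \<in> span B \<Longrightarrow> a b' v = a b v"
    using insert.IH[OF lin1[of b]] by blast
  define w where "w = b - b'"
  define r where "r = (g w - a u w) / a w w"
  have w0: "a w v = 0" if "v \<in> span B" for v
    using b'(2)[OF that] by (simp add: w_def linear_diff[OF lin2])
  have rw: "r * a w w = g w - a u w"
    using pos[of w] by (cases "w = 0")
      (auto simp: r_def linear_0[OF lin1] linear_0[OF insert.prems])
  have mono: "x \<in> span (insert b B)" if "x \<in> span B" for x
    using that span_mono[of B "insert b B"] by blast
  have "u + r *\<^sub>R w \<in> span (insert b B)"
    unfolding w_def by (intro span_add span_scale span_diff mono u(1) b'(1) span_base) simp
  moreover have "a (u + r *\<^sub>R w) v = g v" if v: "v \<in> span (insert b B)" for v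
  proof -
    obtain k where k: "v - k *\<^sub>R b \<in> span B"
      using v by (auto simp: span_breakdown_eq)
    define v' where "v' = v - k *\<^sub>R w"
    have v': "v' \<in> span B"
      using span_add[OF k span_scale[OF b'(1), of k]] by (simp add: v'_def w_def algebra_simps)
    have v_eq: "v = v' + k *\<^sub>R w"
      by (simp add: v'_def)
    have "a (u + r *\<^sub>R w) v = a u v' + r * a w v' + k * (a u w + r * a w w)"
      by (simp add: v_eq linear_add[OF lin1] linear_add[OF lin2] linear_scale[OF lin1]
          linear_scale[OF lin2] algebra_simps)
    also have "\<dots> = g v' + k * g w"
      using rw by (simp only: w0[OF v'] u(2)[OF v']) simp
    also have "\<dots> = g v"
      by (simp add: v_eq linear_add[OF insert.prems] linear_scale[OF insert.prems])
    finally show ?thesis .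
  qed
  ultimately show ?case by blast
qed

text \<open>Collects what can be said about trajectories that are given. Their existence is the
  business of \<open>compact_eigen_system\<close>.\<close>

locale eigen_system =
  fixes H D :: "'h::real_inner set" and P :: "'h \<Rightarrow> 'h" and lam :: "nat \<Rightarrow> real" and \<Phi> :: "nat \<Rightarrow> 'h"
  assumes self_adjoint: "self_adjoint_on H D P"
    and eigenbasis: "orthonormal_eigenbasis H D P lam \<Phi>"
begin

lemma lam_pos: "0 < lam j"
  using eigenbasis monoD[of lam 0 j] by (force simp: orthonormal_eigenbasis_def)

lemma lam_mono: "i \<le> j \<Longrightarrow> lam i \<le> lam j"
  using eigenbasis by (auto simp: orthonormal_eigenbasis_def mono_def)

lemma filterlim_lam: "filterlim lam at_top sequentially"
  using eigenbasis by (simp add: orthonormal_eigenbasis_def)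

lemma finite_low: "finite {j. lam j \<le> \<Lambda>}"
proof -
  have "eventually (\<lambda>n. lam n > \<Lambda>) sequentially"
    using filterlim_lam by (simp add: filterlim_at_top_dense)
  then obtain N where "\<And>n. n \<ge> N \<Longrightarrow> lam n > \<Lambda>"
    by (auto simp: eventually_sequentially)
  then have "{j. lam j \<le> \<Lambda>} \<subseteq> {..<N}"
    by (force simp: not_le)
  then show ?thesis
    by (rule finite_subset) simp
qed

lemma inner_Phi: "inner (\<Phi> i) (\<Phi> j) = (if i = j then 1 else 0)"
  using eigenbasis by (simp add: orthonormal_eigenbasis_def)

lemma norm_Phi [simp]: "norm (\<Phi> j) = 1"
  by (simp add: norm_eq_sqrt_inner inner_Phi)

lemma Phi_D: "\<Phi> j \<in> D" and P_Phi: "P (\<Phi> j) = lam j *\<^sub>R \<Phi> j"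
  using eigenbasis by (simp_all add: orthonormal_eigenbasis_def)

lemma linear_operator: "linear_operator_on H D P"
  using self_adjoint by (simp add: self_adjoint_on_def)

lemma D_sub_H: "x \<in> D \<Longrightarrow> x \<in> H" and P_in_H: "x \<in> D \<Longrightarrow> P x \<in> H"
  using linear_operator by (auto simp: linear_operator_on_def)

lemma Phi_H: "\<Phi> j \<in> H"
  by (simp add: D_sub_H Phi_D)

lemma H_eq: "H = closure (span (range \<Phi>))"
  using eigenbasis by (simp add: orthonormal_eigenbasis_def)

lemma closed_H: "closed H"
  by (simp add: H_eq)

lemma subspace_H: "subspace H"
  unfolding H_eq
proof (rule subspaceI)
  let ?V = "span (range \<Phi>)"
  show "0 \<in> closure ?V"
    using closure_subset span_zero by blast
  show "x + y \<in> closure ?V" if xy: "x \<in> closure ?V" "y \<in> closure ?V" for x y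
  proof -
    obtain f where f: "\<And>n. f n \<in> ?V" "f \<longlonglongrightarrow> x"
      using xy(1) unfolding closure_sequential by blast
    obtain g where g: "\<And>n. g n \<in> ?V" "g \<longlonglongrightarrow> y"
      using xy(2) unfolding closure_sequential by blast
    from f g show ?thesis
      unfolding closure_sequential by (intro exI[of _ "\<lambda>n. f n + g n"] conjI allI span_add tendsto_add)
  qed
  show "c *\<^sub>R x \<in> closure ?V" if x: "x \<in> closure ?V" for c x
  proof -
    obtain f where "\<And>n. f n \<in> ?V" "f \<longlonglongrightarrow> x"
      using x unfolding closure_sequential by blast
    then show ?thesis
      unfolding closure_sequential
      by (intro exI[of _ "\<lambda>n. c *\<^sub>R f n"]) (auto intro: span_scale tendsto_scaleR)
  qed
qed

lemmas H_add = subspace_add[OF subspace_H]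
lemmas H_diff = subspace_diff[OF subspace_H]
lemmas H_scale = subspace_scale[OF subspace_H]
lemmas H_sum = subspace_sum[OF subspace_H]

lemma inner_P_Phi:
  assumes "x \<in> D"
  shows "inner (P x) (\<Phi> j) = lam j * inner x (\<Phi> j)"
proof -
  have "\<forall>f\<in>D. inner (P f) (\<Phi> j) = inner f (lam j *\<^sub>R \<Phi> j)"
    using self_adjoint Phi_D[of j] P_Phi[of j] Phi_H[of j] H_scale[OF Phi_H[of j], of "lam j"]
    unfolding self_adjoint_on_def by blast
  then show ?thesis
    using assms by simp
qed

lemma inner_sum_Phi:
  assumes "finite A"
  shows "inner (\<Sum>j\<in>A. a j *\<^sub>R \<Phi> j) (\<Phi> k) = (if k \<in> A then a k else 0)"
proof -
  have "inner (\<Sum>j\<in>A. a j *\<^sub>R \<Phi> j) (\<Phi> k) = (\<Sum>j\<in>A. if j = k then a j else 0)"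
    by (simp add: inner_sum_left inner_Phi if_distrib cong: if_cong)
  then show ?thesis
    using assms by simp
qed

lemma norm_sum_Phi:
  assumes "finite A"
  shows "(norm (\<Sum>j\<in>A. a j *\<^sub>R \<Phi> j))\<^sup>2 = (\<Sum>j\<in>A. (a j)\<^sup>2)"
proof -
  have "(norm (\<Sum>j\<in>A. a j *\<^sub>R \<Phi> j))\<^sup>2
      = (\<Sum>k\<in>A. a k * inner (\<Sum>j\<in>A. a j *\<^sub>R \<Phi> j) (\<Phi> k))"
    by (subst power2_norm_eq_inner, subst inner_sum_right) simp
  also have "\<dots> = (\<Sum>k\<in>A. (a k)\<^sup>2)"
    by (intro sum.cong) (auto simp: inner_sum_Phi[OF assms] power2_eq_square)
  finally show ?thesis .
qed

definition proj :: "nat \<Rightarrow> 'h \<Rightarrow> 'h" where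
  "proj n x = (\<Sum>j<n. inner x (\<Phi> j) *\<^sub>R \<Phi> j)"

lemma inner_proj: "inner (proj n x) (\<Phi> k) = (if k < n then inner x (\<Phi> k) else 0)"
  by (simp add: proj_def inner_sum_Phi)

lemma proj_in_H: "proj n x \<in> H"
  unfolding proj_def by (intro H_sum H_scale Phi_H)

lemma bessel:
  assumes "finite A"
  shows "(\<Sum>j\<in>A. (inner x (\<Phi> j))\<^sup>2) \<le> (norm x)\<^sup>2"
proof -
  define p where "p = (\<Sum>j\<in>A. inner x (\<Phi> j) *\<^sub>R \<Phi> j)"
  have np: "(norm p)\<^sup>2 = (\<Sum>j\<in>A. (inner x (\<Phi> j))\<^sup>2)"
    unfolding p_def by (rule norm_sum_Phi[OF assms])
  have "inner x p = (norm p)\<^sup>2"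
    unfolding np by (simp add: p_def inner_sum_right power2_eq_square)
  then have "(norm (x - p))\<^sup>2 = (norm x)\<^sup>2 - (norm p)\<^sup>2"
    by (simp add: power2_norm_eq_inner inner_diff inner_commute)
  then show ?thesis
    using zero_le_power2[of "norm (x - p)"] unfolding np by linarith
qed

lemma norm_proj_le: "norm (proj n x) \<le> norm x"
  using norm_sum_Phi[of "{..<n}" "\<lambda>j. inner x (\<Phi> j)"] bessel[of "{..<n}" x]
  by (auto simp: proj_def intro: power2_le_imp_le)

lemma linear_proj: "linear (proj n)"
  unfolding proj_def by (intro linearI) (simp_all add: inner_add_left algebra_simps
      sum.distrib scaleR_sum_right)

lemma proj_span:
  assumes "y \<in> span (range \<Phi>)"
  shows "eventually (\<lambda>n. proj n y = y) sequentially"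
  using assms
proof (induction rule: span_induct_alt)
  case base
  then show ?case by (simp add: proj_def)
next
  case (step c x y)
  then obtain i where i: "x = \<Phi> i" by blast
  have "eventually (\<lambda>n. n > i) sequentially"
    by (rule eventually_gt_at_top)
  with step(2) show ?case
  proof eventually_elim
    case (elim n)
    have "proj n x = x"
      using elim(2) by (simp add: proj_def i inner_Phi if_distrib[of "\<lambda>r. r *\<^sub>R _"] cong: if_cong)
    then show ?case
      using elim(1) by (simp add: linear_add[OF linear_proj] linear_scale[OF linear_proj])
  qed
qed

text \<open>The projections are contractions and eventually fix every finite combination of
  eigenvectors; such combinations are dense in \<open>H\<close>.\<close>

lemma proj_tendsto:
  assumes "x \<in> H"
  shows "(\<lambda>n. proj n x) \<longlonglongrightarrow> x"
proof (rule tendstoI)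
  fix e :: real assume "e > 0"
  then obtain y where y: "y \<in> span (range \<Phi>)" "dist y x < e / 2"
    using assms closure_approachable[of x "span (range \<Phi>)"] H_eq by (metis half_gt_zero)
  from proj_span[OF y(1)] show "eventually (\<lambda>n. dist (proj n x) x < e) sequentially"
  proof eventually_elim
    case (elim n)
    have "proj n x - x = proj n (x - y) + (y - x)"
      by (simp add: linear_diff[OF linear_proj] elim)
    then have "norm (proj n x - x) \<le> norm (x - y) + norm (y - x)"
      by (metis norm_triangle_le add_right_mono norm_proj_le norm_triangle_ineq order_trans)
    then show ?case
      using y(2) by (simp add: dist_norm norm_minus_commute)
  qed
qed

lemma parseval:
  assumes "x \<in> H"
  shows "(\<lambda>n. \<Sum>j<n. (inner x (\<Phi> j))\<^sup>2) \<longlonglongrightarrow> (norm x)\<^sup>2"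
proof -
  have "(\<lambda>n. (norm (proj n x))\<^sup>2) \<longlonglongrightarrow> (norm x)\<^sup>2"
    by (intro tendsto_intros proj_tendsto assms)
  then show ?thesis
    by (simp add: proj_def norm_sum_Phi)
qed

text \<open>Reduces norm estimates to a comparison mode by mode. Parseval is applied to
  \<open>x\<close> and only Bessel to \<open>y\<close>, so \<open>y\<close> may lie outside
  \<open>H\<close>.\<close>

lemma norm_le_coeffs:
  assumes "x \<in> H" "0 \<le> M" and le: "\<And>j. \<bar>inner x (\<Phi> j)\<bar> \<le> M * \<bar>inner y (\<Phi> j)\<bar>"
  shows "norm x \<le> M * norm y"
proof -
  have "(\<Sum>j<n. (inner x (\<Phi> j))\<^sup>2) \<le> (M * norm y)\<^sup>2" for n
  proof -
    have "(\<Sum>j<n. (inner x (\<Phi> j))\<^sup>2) \<le> (\<Sum>j<n. M\<^sup>2 * (inner y (\<Phi> j))\<^sup>2)"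
    proof (rule sum_mono)
      fix j
      have "(inner x (\<Phi> j))\<^sup>2 \<le> (M * \<bar>inner y (\<Phi> j)\<bar>)\<^sup>2"
        using power_mono[OF le[of j], of 2] by simp
      then show "(inner x (\<Phi> j))\<^sup>2 \<le> M\<^sup>2 * (inner y (\<Phi> j))\<^sup>2"
        by (simp add: power_mult_distrib)
    qed
    also have "\<dots> \<le> M\<^sup>2 * (norm y)\<^sup>2"
      by (simp flip: sum_distrib_left add: bessel mult_left_mono)
    finally show ?thesis
      by (simp add: power_mult_distrib)
  qed
  then have "(norm x)\<^sup>2 \<le> (M * norm y)\<^sup>2"
    by (intro LIMSEQ_le_const2[OF parseval[OF assms(1)]]) auto
  then show ?thesis
    using assms(2) by (intro power2_le_imp_le[of "norm x"]) auto
qed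

lemma eq_coeffs:
  assumes "x \<in> H" "y \<in> H" "\<And>j. inner x (\<Phi> j) = inner y (\<Phi> j)"
  shows "x = y"
  using norm_le_coeffs[OF H_diff[OF assms(1,2)], of 0 0] assms(3) by (simp add: inner_diff_left)

lemma inner_eq_coeffs:
  assumes "y \<in> H"
  shows "(\<lambda>n. \<Sum>j<n. inner x (\<Phi> j) * inner y (\<Phi> j)) \<longlonglongrightarrow> inner x y"
proof -
  have "(\<lambda>n. inner x (proj n y)) \<longlonglongrightarrow> inner x y"
    by (intro tendsto_intros proj_tendsto assms)
  then show ?thesis
    by (simp add: proj_def inner_sum_right mult.commute)
qed

text \<open>Expanding \<open>inner (P f) v\<close> and \<open>inner f w\<close> in the eigenbasis
  shows that they agree for all \<open>f\<close> in \<open>D\<close>, so the pair lies in the graph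
  of the adjoint, which is the graph of \<open>P\<close>. Membership in \<open>D\<close> can thus be
  read off from coefficients.\<close>

lemma P_eqI:
  assumes "v \<in> H" "w \<in> H" "\<And>j. inner w (\<Phi> j) = lam j * inner v (\<Phi> j)"
  shows "v \<in> D" "P v = w"
proof -
  have "inner (P f) v = inner f w" if "f \<in> D" for f
  proof (rule LIMSEQ_unique[OF inner_eq_coeffs[OF assms(1)]])
    show "(\<lambda>n. \<Sum>j<n. inner (P f) (\<Phi> j) * inner v (\<Phi> j)) \<longlonglongrightarrow> inner f w"
      using inner_eq_coeffs[OF assms(2), of f] that
      by (simp add: inner_P_Phi assms(3) mult_ac)
  qed
  then show "v \<in> D" "P v = w"
    using self_adjoint assms(1,2) unfolding self_adjoint_on_def by blast+
qed

text \<open>Integrating factor: the coefficient times \<open>exp (lam j * (t - a))\<close> has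
  derivative zero. The end values are one-sided limits instead of values of \<open>u\<close>, so
  that the lemma applies up to an impulse, where the left limit and the value differ.\<close>

lemma trajectory_coeff:
  assumes "a < b" and u: "\<And>t. a < t \<Longrightarrow> t < b \<Longrightarrow> u t \<in> D \<and> (u has_vector_derivative - P (u t)) (at t)"
    and ua: "(u \<longlongrightarrow> ua) (at_right a)" and ub: "(u \<longlongrightarrow> ub) (at_left b)"
  shows "inner ub (\<Phi> j) = exp (- lam j * (b - a)) * inner ua (\<Phi> j)"
proof -
  define g where "g t = exp (lam j * (t - a)) * inner (u t) (\<Phi> j)" for t
  have der: "(g has_real_derivative 0) (at t)" if t: "a < t" "t < b" for t
  proof -
    have "((\<lambda>t. inner (u t) (\<Phi> j)) has_real_derivative - lam j * inner (u t) (\<Phi> j)) (at t)"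
      using bounded_linear.has_vector_derivative[OF bounded_linear_inner_left, of u "- P (u t)" "at t" "\<Phi> j"]
        u[OF t] by (simp add: has_real_derivative_iff_has_vector_derivative inner_P_Phi)
    then show ?thesis
      unfolding g_def by (auto intro!: derivative_eq_intros)
  qed
  obtain c where c: "\<And>t. a < t \<Longrightarrow> t < b \<Longrightarrow> g t = c"
  proof -
    have "\<exists>c. \<forall>t\<in>{a<..<b}. g t = c"
      by (rule has_field_derivative_zero_constant)
        (auto intro!: DERIV_subset[OF der])
    then show ?thesis using that by auto
  qed
  have "(g \<longlongrightarrow> exp (lam j * (a - a)) * inner ua (\<Phi> j)) (at_right a)"
    unfolding g_def by (intro tendsto_intros ua)
  moreover have "(g \<longlongrightarrow> c) (at_right a)"
    by (rule Lim_transform_eventually[OF tendsto_const])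
      (use \<open>a < b\<close> c in \<open>auto simp: eventually_at_right_field\<close>)
  ultimately have 1: "inner ua (\<Phi> j) = c"
    by (simp add: tendsto_unique[OF trivial_limit_at_right_real])
  have "(g \<longlongrightarrow> exp (lam j * (b - a)) * inner ub (\<Phi> j)) (at_left b)"
    unfolding g_def by (intro tendsto_intros ub)
  moreover have "(g \<longlongrightarrow> c) (at_left b)"
    by (rule Lim_transform_eventually[OF tendsto_const])
      (use \<open>a < b\<close> c in \<open>auto simp: eventually_at_left_field\<close>)
  ultimately have "exp (lam j * (b - a)) * inner ub (\<Phi> j) = c"
    by (simp add: tendsto_unique[OF trivial_limit_at_left_real])
  then show ?thesis
    using 1 by (simp add: exp_minus divide_simps mult.commute)
qed

lemma limit_in_H:
  fixes a b :: real
  assumes "a < b" "\<And>t. a < t \<Longrightarrow> t < b \<Longrightarrow> u t \<in> D"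
  shows "(u \<longlongrightarrow> l) (at_right a) \<Longrightarrow> l \<in> H" "(u \<longlongrightarrow> l) (at_left b) \<Longrightarrow> l \<in> H"
proof -
  have "eventually (\<lambda>t. u t \<in> H) (at_right a)" "eventually (\<lambda>t. u t \<in> H) (at_left b)"
    by (auto intro!: eventually_at_rightI[OF _ assms(1)] eventually_at_leftI[OF _ assms(1)]
        D_sub_H assms(2))
  note H = Lim_in_closed_set[OF closed_H this(1)] Lim_in_closed_set[OF closed_H this(2)]
  show "(u \<longlongrightarrow> l) (at_right a) \<Longrightarrow> l \<in> H"
    by (rule H(1)[OF trivial_limit_at_right_real])
  show "(u \<longlongrightarrow> l) (at_left b) \<Longrightarrow> l \<in> H"
    by (rule H(2)[OF trivial_limit_at_left_real])
qed

lemma trajectory_norm_le: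
  assumes "a < b" and u: "\<And>t. a < t \<Longrightarrow> t < b \<Longrightarrow> u t \<in> D \<and> (u has_vector_derivative - P (u t)) (at t)"
    and ua: "(u \<longlongrightarrow> ua) (at_right a)" and ub: "(u \<longlongrightarrow> ub) (at_left b)"
  shows "norm ub \<le> norm ua"
proof -
  have "ub \<in> H"
    using limit_in_H(2)[OF \<open>a < b\<close> _ ub] u by blast
  moreover have "\<bar>inner ub (\<Phi> j)\<bar> \<le> 1 * \<bar>inner ua (\<Phi> j)\<bar>" for j
    using lam_pos[of j] \<open>a < b\<close>
    by (auto simp: trajectory_coeff[OF assms] abs_mult intro!: mult_left_le_one_le)
  ultimately show ?thesis
    using norm_le_coeffs[of ub 1 ua] by simp
qed

end

section \<open>The semigroup\<close>

text \<open>With \<open>y = lam j * t\<close> or a fixed multiple of it, this bound and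
  \<open>mult_exp_bound\<close> control powers of \<open>lam j\<close> against the exponential decay
  uniformly in \<open>j\<close>, at a price depending only on \<open>t\<close>.\<close>

lemma square_exp_bound:
  fixes y :: real
  assumes "0 \<le> y"
  shows "y\<^sup>2 * exp (- y) \<le> 2"
  using exp_lower_Taylor_quadratic[OF assms] assms by (simp add: exp_minus field_simps)

lemma mult_exp_bound:
  fixes y :: real
  shows "y * exp (- y) \<le> 1"
proof -
  have "y \<le> exp y"
    using exp_ge_add_one_self[of y] by linarith
  then show ?thesis
    by (simp add: exp_minus field_simps)
qed

lemma exp_second_order:
  fixes y :: real
  shows "\<bar>exp y - 1 - y\<bar> \<le> y\<^sup>2 / 2 * exp \<bar>y\<bar>"
proof -
  obtain t where t: "\<bar>t\<bar> \<le> \<bar>y\<bar>" "exp y = (\<Sum>m<2. y ^ m / fact m) + exp t / fact 2 * y\<^sup>2"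
    using Maclaurin_exp_le[of y 2] by blast
  have "exp t \<le> exp \<bar>y\<bar>"
    using t(1) by simp
  then have "y\<^sup>2 / 2 * exp t \<le> y\<^sup>2 / 2 * exp \<bar>y\<bar>"
    by (intro mult_left_mono) auto
  then show ?thesis
    using t(2) by (simp add: numeral_2_eq_2 mult.commute)
qed

lemma (in eigen_system) inner_evolution:
  assumes u: "evolution D P u" and "0 \<le> t"
  shows "inner (u t) (\<Phi> j) = exp (- lam j * t) * inner (u 0) (\<Phi> j)"
proof (cases "t = 0")
  case False
  then have t: "0 < t" using assms by simp
  have "(u \<longlongrightarrow> u 0) (at_right 0)"
    using u by (auto simp: evolution_def continuous_on_def simp flip: at_within_Ici_at_right)
  moreover have "(u \<longlongrightarrow> u t) (at_left t)"
    using u t has_vector_derivative_continuous[of u _ t UNIV] unfolding evolution_def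
    by (metis continuous_within filterlim_at_split)
  ultimately show ?thesis
    using trajectory_coeff[OF t, of u "u 0" "u t" j] u by (auto simp: evolution_def)
qed simp

locale compact_eigen_system = eigen_system H D P lam \<Phi>
  for H D :: "'h::real_inner set" and P lam \<Phi> +
  assumes bij_P: "bij_betw P D H"
    and compact_inverse: "compact_operator_on H (inv_into D P)"
begin

text \<open>Compactness of the inverse replaces completeness of \<open>H\<close>: the partial sums of the series
  defining \<open>v\<close> are images under the inverse of \<open>P\<close> of a bounded sequence.\<close>

lemma multiplier_exists:
  assumes x: "x \<in> H" and bound: "\<And>j. \<bar>\<phi> j * lam j\<bar> \<le> M"
  shows "\<exists>v\<in>H. \<forall>j. inner v (\<Phi> j) = \<phi> j * inner x (\<Phi> j)"
proof -
  define v where "v n = (\<Sum>j<n. (\<phi> j * inner x (\<Phi> j)) *\<^sub>R \<Phi> j)" for n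
  define w where "w n = (\<Sum>j<n. (lam j * (\<phi> j * inner x (\<Phi> j))) *\<^sub>R \<Phi> j)" for n
  have vH: "v n \<in> H" and wH: "w n \<in> H" for n
    unfolding v_def w_def by (intro H_sum H_scale Phi_H)+
  have "0 \<le> M"
    using bound[of 0] abs_ge_zero order_trans by blast
  have "norm (w n) \<le> M * norm x" for n
  proof (rule norm_le_coeffs[OF wH \<open>0 \<le> M\<close>])
    fix j
    show "\<bar>inner (w n) (\<Phi> j)\<bar> \<le> M * \<bar>inner x (\<Phi> j)\<bar>"
      using mult_right_mono[OF bound[of j], of "\<bar>inner x (\<Phi> j)\<bar>"] \<open>0 \<le> M\<close>
      by (simp add: w_def inner_sum_Phi abs_mult mult_ac)
  qed
  then have "bounded (range w)"
    by (auto simp: bounded_iff)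
  then have "compact (closure (inv_into D P ` range w))"
    using compact_inverse wH unfolding compact_operator_on_def by blast
  moreover have "inv_into D P (w n) = v n" for n
  proof -
    have "v n \<in> D \<and> P (v n) = w n"
      using P_eqI[OF vH wH, of n n] by (auto simp: v_def w_def inner_sum_Phi)
    then show ?thesis
      using bij_P inv_into_f_f unfolding bij_betw_def by metis
  qed
  ultimately have "compact (closure (range v))"
    by (simp add: image_image)
  then obtain l r where lr: "strict_mono r" "(v \<circ> r) \<longlonglongrightarrow> l"
    unfolding compact_def using closure_subset[of "range v"] by (metis range_subsetD)
  have "l \<in> H"
    using Lim_in_closed_set[OF closed_H _ _ lr(2)] vH by simp
  moreover have "inner l (\<Phi> j) = \<phi> j * inner x (\<Phi> j)" for j
  proof (rule LIMSEQ_unique)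
    show "(\<lambda>n. inner ((v \<circ> r) n) (\<Phi> j)) \<longlonglongrightarrow> inner l (\<Phi> j)"
      by (intro tendsto_intros lr)
    \<comment> \<open>A convergent subsequence is enough: along it the coefficient of a fixed mode
      \<open>j\<close> is constant as soon as \<open>r n\<close> exceeds \<open>j\<close>.\<close>
    have "eventually (\<lambda>n. n > j) sequentially"
      by (rule eventually_gt_at_top)
    then have "eventually (\<lambda>n. \<phi> j * inner x (\<Phi> j) = inner ((v \<circ> r) n) (\<Phi> j)) sequentially"
    proof eventually_elim
      case (elim n)
      have "j < r n"
        using seq_suble[OF lr(1), of n] elim by simp
      then show ?case
        by (simp add: v_def inner_sum_Phi)
    qed
    then show "(\<lambda>n. inner ((v \<circ> r) n) (\<Phi> j)) \<longlonglongrightarrow> \<phi> j * inner x (\<Phi> j)"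
      by (rule Lim_transform_eventually[OF tendsto_const])
  qed
  ultimately show ?thesis by blast
qed

text \<open>The value is selected by its coefficients, which determine it by
  \<open>eq_coeffs\<close>. Time 0 is a separate case because \<open>multiplier_exists\<close> needs
  \<open>exp (- lam j * t) * lam j\<close> bounded in \<open>j\<close>, which fails there.\<close>

definition semigroup :: "real \<Rightarrow> 'h \<Rightarrow> 'h" where
  "semigroup t x = (if t \<le> 0 then x
     else SOME v. v \<in> H \<and> (\<forall>j. inner v (\<Phi> j) = exp (- lam j * t) * inner x (\<Phi> j)))"

lemma semigroup_0 [simp]: "semigroup 0 x = x"
  by (simp add: semigroup_def)

lemma
  assumes "x \<in> H" "0 \<le> t"
  shows semigroup_in_H: "semigroup t x \<in> H"
    and inner_semigroup: "inner (semigroup t x) (\<Phi> j) = exp (- lam j * t) * inner x (\<Phi> j)"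
proof -
  have "semigroup t x \<in> H \<and> (\<forall>j. inner (semigroup t x) (\<Phi> j) = exp (- lam j * t) * inner x (\<Phi> j))"
  proof (cases "t = 0")
    case False
    then have t: "t > 0" using assms by simp
    have "\<bar>exp (- lam j * t) * lam j\<bar> \<le> 1 / t" for j
      using mult_exp_bound[of "lam j * t"] lam_pos[of j] t
      by (simp add: field_simps)
    from multiplier_exists[OF assms(1) this]
    have "\<exists>v. v \<in> H \<and> (\<forall>j. inner v (\<Phi> j) = exp (- lam j * t) * inner x (\<Phi> j))"
      by blast
    from someI_ex[OF this] show ?thesis
      using t by (simp add: semigroup_def)
  qed (use assms in simp)
  then show "semigroup t x \<in> H"
    "inner (semigroup t x) (\<Phi> j) = exp (- lam j * t) * inner x (\<Phi> j)" by auto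
qed

text \<open>Smoothing: even \<open>(lam j)\<^sup>2 * exp (- lam j * t)\<close> is bounded in
  \<open>j\<close>, so \<open>multiplier_exists\<close> supplies the candidate for the image under
  \<open>P\<close>, and \<open>P_eqI\<close> identifies it.\<close>

lemma
  assumes "x \<in> H" "0 < t"
  shows semigroup_in_D: "semigroup t x \<in> D"
    and inner_P_semigroup:
      "inner (P (semigroup t x)) (\<Phi> j) = lam j * exp (- lam j * t) * inner x (\<Phi> j)"
proof -
  have "\<bar>(lam j * exp (- lam j * t)) * lam j\<bar> \<le> 2 / t\<^sup>2" for j
    using square_exp_bound[of "lam j * t"] lam_pos[of j] assms(2)
    by (simp add: field_simps power2_eq_square)
  from multiplier_exists[OF assms(1) this]
  obtain w where "w \<in> H" "\<And>j. inner w (\<Phi> j) = lam j * exp (- lam j * t) * inner x (\<Phi> j)"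
    by blast
  then show "semigroup t x \<in> D"
    using assms by (intro P_eqI(1)[OF _ \<open>w \<in> H\<close>]) (auto simp: inner_semigroup semigroup_in_H)
  then show "inner (P (semigroup t x)) (\<Phi> j) = lam j * exp (- lam j * t) * inner x (\<Phi> j)"
    using assms by (simp add: inner_P_Phi inner_semigroup)
qed

text \<open>The Taylor remainder is bounded by a multiple of the square of the increment, uniformly
  in the modes. Increments below \<open>t / 2\<close> leave at least the factor
  \<open>exp (- (l * t / 2))\<close>, and this absorbs the \<open>l\<^sup>2\<close> of the second
  derivative.\<close>

lemma semigroup_derivative:
  assumes x: "x \<in> H" and t: "0 < t"
  shows "((\<lambda>t. semigroup t x) has_vector_derivative - P (semigroup t x)) (at t)"
proof -
  define K where "K = 4 / t\<^sup>2 * norm x"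
  define R where "R h = semigroup (t + h) x - semigroup t x - h *\<^sub>R - P (semigroup t x)" for h
  have R: "norm (R h) \<le> K * h\<^sup>2" if h: "\<bar>h\<bar> < t / 2" for h
  proof -
    have th: "0 < t + h" using h by (auto simp: abs_if split: if_splits)
    have "norm (R h) \<le> 4 / t\<^sup>2 * h\<^sup>2 * norm x"
    proof (rule norm_le_coeffs)
      show "R h \<in> H"
        unfolding R_def using x t th
        by (intro H_diff H_scale subspace_neg[OF subspace_H] P_in_H semigroup_in_D semigroup_in_H) auto
      fix j
      define l where "l = lam j"
      have l: "0 < l" by (simp add: l_def lam_pos)
      have "\<bar>exp (- l * (t + h)) - exp (- l * t) + h * (l * exp (- l * t))\<bar>
          = exp (- l * t) * \<bar>exp (- l * h) - 1 - (- l * h)\<bar>"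
      proof -
        have "exp (- l * (t + h)) - exp (- l * t) + h * (l * exp (- l * t))
          = exp (- l * t) * (exp (- l * h) - 1 - (- l * h))"
          by (simp add: algebra_simps flip: exp_add)
        then show ?thesis by (simp add: abs_mult)
      qed
      also have "\<dots> \<le> exp (- l * t) * ((- l * h)\<^sup>2 / 2 * exp \<bar>- l * h\<bar>)"
        by (intro mult_left_mono exp_second_order) auto
      also have "\<dots> = h\<^sup>2 / 2 * l\<^sup>2 * exp (- l * t + l * \<bar>h\<bar>)"
        using l by (simp add: abs_mult power_mult_distrib mult_ac flip: exp_add)
      also have "\<dots> \<le> h\<^sup>2 / 2 * l\<^sup>2 * exp (- (l * t / 2))"
      proof -
        have "l * \<bar>h\<bar> \<le> l * (t / 2)"
          using h l by (intro mult_left_mono) auto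
        then have "- l * t + l * \<bar>h\<bar> \<le> - (l * t / 2)"
          by simp
        then show ?thesis
          by (intro mult_left_mono) auto
      qed
      also have "\<dots> = 2 * h\<^sup>2 / t\<^sup>2 * ((l * t / 2)\<^sup>2 * exp (- (l * t / 2)))"
        using t by (simp add: field_simps power2_eq_square)
      also have "\<dots> \<le> 2 * h\<^sup>2 / t\<^sup>2 * 2"
        using l t by (intro mult_left_mono square_exp_bound) auto
      finally have *: "\<bar>exp (- l * (t + h)) - exp (- l * t) + h * (l * exp (- l * t))\<bar>
          \<le> 4 / t\<^sup>2 * h\<^sup>2"
        by simp
      have "inner (R h) (\<Phi> j)
          = (exp (- l * (t + h)) - exp (- l * t) + h * (l * exp (- l * t))) * inner x (\<Phi> j)"
        using x t th unfolding R_def l_def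
        by (simp add: inner_diff_left inner_semigroup inner_P_semigroup algebra_simps)
      then show "\<bar>inner (R h) (\<Phi> j)\<bar> \<le> 4 / t\<^sup>2 * h\<^sup>2 * \<bar>inner x (\<Phi> j)\<bar>"
        using mult_right_mono[OF *] by (simp add: abs_mult)
    qed simp
    then show ?thesis by (simp add: K_def mult_ac)
  qed
  have "((\<lambda>h. norm (R h) / norm h) \<longlongrightarrow> 0) (at 0)"
  proof (rule Lim_null_comparison)
    show "((\<lambda>h. K * \<bar>h\<bar>) \<longlongrightarrow> 0) (at (0::real))"
      by (auto intro!: tendsto_eq_intros)
    have "eventually (\<lambda>h. dist h 0 < t / 2 \<and> h \<noteq> 0) (at (0::real))"
      using t unfolding eventually_at by (intro exI[of _ "t / 2"]) auto
    then show "eventually (\<lambda>h. norm (norm (R h) / norm h) \<le> K * \<bar>h\<bar>) (at (0::real))"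
    proof eventually_elim
      case (elim h)
      then show ?case
        using R[of h] by (simp add: divide_le_eq power2_eq_square abs_mult_self_eq mult.assoc)
    qed
  qed
  then show ?thesis
    unfolding has_vector_derivative_def has_derivative_at R_def
    by (rule conjI[OF bounded_linear_scaleR_left])
qed

text \<open>A rate of convergence valid for all of \<open>H\<close> is not to be expected, so
  \<open>x\<close> is replaced by a projection onto finitely many modes, where the rate is
  \<open>lam n * t\<close>; contractivity controls the error made.\<close>

lemma semigroup_at_0:
  assumes x: "x \<in> H"
  shows "((\<lambda>t. semigroup t x) \<longlongrightarrow> x) (at_right 0)"
proof (rule tendstoI)
  fix e :: real assume e: "0 < e"
  obtain n where n: "norm (x - proj n x) < e / 3"
    using tendstoD[OF proj_tendsto[OF x], of "e / 3"] e
    by (auto simp: eventually_sequentially dist_norm norm_minus_commute)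
  define p where "p = proj n x"
  have p: "p \<in> H" by (simp add: p_def proj_in_H)
  have "((\<lambda>t. lam n * t * norm p) \<longlongrightarrow> lam n * 0 * norm p) (at_right 0)"
    by (intro tendsto_intros)
  then have "eventually (\<lambda>t. lam n * t * norm p < e / 3) (at_right 0)"
    using e by (intro order_tendstoD) auto
  moreover have "eventually (\<lambda>t::real. t > 0) (at_right 0)"
    by (simp add: eventually_at_right_less)
  ultimately show "eventually (\<lambda>t. dist (semigroup t x) x < e) (at_right 0)"
  proof eventually_elim
    case (elim t)
    have "norm (semigroup t x - semigroup t p) \<le> 1 * norm (x - p)"
    proof (rule norm_le_coeffs)
      show "semigroup t x - semigroup t p \<in> H"
        using x p elim by (intro H_diff semigroup_in_H) auto
      fix j
      have "inner (semigroup t x - semigroup t p) (\<Phi> j) = exp (- lam j * t) * inner (x - p) (\<Phi> j)"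
        using x p elim by (simp add: inner_diff_left inner_semigroup right_diff_distrib)
      then show "\<bar>inner (semigroup t x - semigroup t p) (\<Phi> j)\<bar> \<le> 1 * \<bar>inner (x - p) (\<Phi> j)\<bar>"
        using lam_pos[of j] elim by (auto simp: abs_mult intro!: mult_left_le_one_le)
    qed simp
    moreover have "norm (semigroup t p - p) \<le> lam n * t * norm p"
    proof (rule norm_le_coeffs)
      show "semigroup t p - p \<in> H"
        using p elim by (intro H_diff semigroup_in_H) auto
      show "0 \<le> lam n * t"
        using lam_pos[of n] elim by simp
      fix j
      show "\<bar>inner (semigroup t p - p) (\<Phi> j)\<bar> \<le> lam n * t * \<bar>inner p (\<Phi> j)\<bar>"
      proof (cases "j < n")
        case True
        have "inner (semigroup t p - p) (\<Phi> j) = - (1 - exp (- lam j * t)) * inner p (\<Phi> j)"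
          using p elim by (simp add: inner_diff_left inner_semigroup algebra_simps)
        moreover have "0 \<le> 1 - exp (- lam j * t)" "1 - exp (- lam j * t) \<le> lam n * t"
        proof -
          have "lam j * t \<le> lam n * t"
            using elim True by (intro mult_right_mono lam_mono) auto
          then show "1 - exp (- lam j * t) \<le> lam n * t"
            using exp_ge_add_one_self[of "- lam j * t"] by simp
          show "0 \<le> 1 - exp (- lam j * t)"
            using lam_pos[of j] elim by simp
        qed
        ultimately show ?thesis
          by (simp add: abs_mult mult_right_mono)
      next
        case False
        then have "inner p (\<Phi> j) = 0"
          by (simp add: p_def inner_proj)
        then show ?thesis
          using p elim by (simp add: inner_diff_left inner_semigroup)
      qed
    qed
    moreover have "norm (semigroup t x - x)
        \<le> norm (semigroup t x - semigroup t p) + norm (semigroup t p - p) + norm (p - x)"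
      using norm_triangle_ineq[of "semigroup t x - semigroup t p" "semigroup t p - x"]
        norm_triangle_ineq[of "semigroup t p - p" "p - x"] by simp
    moreover have "norm (p - x) < e / 3" "norm (x - p) < e / 3"
      using n by (simp_all add: p_def norm_minus_commute)
    ultimately show ?case
      using elim by (simp add: dist_norm)
  qed
qed

lemma continuous_on_semigroup:
  assumes "x \<in> H"
  shows "continuous_on {0..} (\<lambda>t. semigroup t x)"
  unfolding continuous_on_eq_continuous_within
proof
  fix t :: real assume t: "t \<in> {0..}"
  show "continuous (at t within {0..}) (\<lambda>t. semigroup t x)"
  proof (cases "t = 0")
    case True
    then show ?thesis
      using semigroup_at_0[OF assms] by (simp add: continuous_within at_within_Ici_at_right)
  next
    case False
    then show ?thesis
      using t has_vector_derivative_continuous[OF semigroup_derivative[OF assms, of t]]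
      by (auto intro: continuous_at_imp_continuous_within)
  qed
qed

lemma evolution_semigroup:
  assumes "x \<in> H"
  shows "evolution D P (\<lambda>t. semigroup t x)"
  using assms by (simp add: evolution_def continuous_on_semigroup semigroup_in_D semigroup_derivative)

end

section \<open>Impulsive solutions on one interval\<close>

text \<open>Cauchy-Schwarz. The factor \<open>card A\<close> explains why the final error allowed
  for a single control is divided by the eigenvalue count, and why that count multiplies the control
  cost.\<close>

lemma norm_sum_scaleR_le:
  fixes v :: "'i \<Rightarrow> 'h::real_normed_vector"
  assumes "\<And>j. j \<in> A \<Longrightarrow> (norm (v j))\<^sup>2 \<le> B" "0 \<le> B"
  shows "(norm (\<Sum>j\<in>A. a j *\<^sub>R v j))\<^sup>2 \<le> (\<Sum>j\<in>A. (a j)\<^sup>2) * (real (card A) * B)"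
proof -
  have "norm (\<Sum>j\<in>A. a j *\<^sub>R v j) \<le> (\<Sum>j\<in>A. \<bar>a j\<bar> * sqrt B)"
    using assms by (intro sum_norm_le) (auto intro!: mult_left_mono real_le_rsqrt)
  then have "(norm (\<Sum>j\<in>A. a j *\<^sub>R v j))\<^sup>2 \<le> ((\<Sum>j\<in>A. \<bar>a j\<bar>) * sqrt B)\<^sup>2"
    by (intro power_mono) (auto simp: sum_distrib_right)
  also have "\<dots> = (\<Sum>j\<in>A. \<bar>a j\<bar>)\<^sup>2 * B"
    using assms(2) by (simp add: power_mult_distrib)
  also have "\<dots> \<le> (real (card A) * (\<Sum>j\<in>A. \<bar>a j\<bar>\<^sup>2)) * B"
    using sum_squared_le_sum_of_squares[of "\<lambda>j. \<bar>a j\<bar>" A] assms(2)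
    by (intro mult_right_mono) (auto simp: mult.commute)
  finally show ?thesis
    by (simp add: mult_ac)
qed

lemma impulsive_solution_subinterval:
  assumes z: "impulsive_solution D P I M s J z" and "{t0..t1} \<subseteq> I" "m \<in> M"
    and s: "\<And>k. k \<in> M \<Longrightarrow> s k \<in> {t0..t1} \<Longrightarrow> k = m"
  shows "impulsive_solution D P {t0..t1} {m} s J z"
  unfolding impulsive_solution_def
proof (intro conjI ballI)
  fix t assume "t \<in> interior {t0..t1} - s ` {m}"
  then have "t \<in> interior I - s ` M"
    using interior_mono[OF \<open>{t0..t1} \<subseteq> I\<close>] s interior_subset[of "{t0..t1}"] by blast
  then show "z t \<in> D" "(z has_vector_derivative - P (z t)) (at t)"
    using z unfolding impulsive_solution_def by blast+
next
  fix t assume "t \<in> {t0..t1} - s ` {m}"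
  then have "t \<in> I - s ` M"
    using \<open>{t0..t1} \<subseteq> I\<close> s by blast
  then show "continuous (at t within {t0..t1}) z"
    using z \<open>{t0..t1} \<subseteq> I\<close> unfolding impulsive_solution_def
    by (blast intro: continuous_within_subset)
qed (use z \<open>m \<in> M\<close> in \<open>auto simp: impulsive_solution_def\<close>)

context eigen_system
begin

text \<open>Puts one interval into the form of one-sided limits needed by
  \<open>trajectory_coeff\<close> and \<open>trajectory_norm_le\<close> on either side of the
  impulse.\<close>

lemma impulsive_stepE:
  assumes z: "impulsive_solution D P {t0..t1} {m} s J z" and s: "t0 < s m" "s m < t1"
  obtains l where "(z \<longlongrightarrow> l) (at_left (s m))" "z (s m) = l + J m"
    "(z \<longlongrightarrow> z (s m)) (at_right (s m))" "(z \<longlongrightarrow> z t0) (at_right t0)" "(z \<longlongrightarrow> z t1) (at_left t1)"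
    "\<And>t. t0 < t \<Longrightarrow> t < t1 \<Longrightarrow> t \<noteq> s m \<Longrightarrow>
        z t \<in> D \<and> (z has_vector_derivative - P (z t)) (at t) \<and> (z \<longlongrightarrow> z t) (at_left t)"
proof -
  have "continuous (at t0 within {t0..t1}) z" "continuous (at t1 within {t0..t1}) z"
    using z s by (auto simp: impulsive_solution_def)
  then have 1: "(z \<longlongrightarrow> z t0) (at_right t0)" "(z \<longlongrightarrow> z t1) (at_left t1)"
    using s by (simp_all add: continuous_within at_within_Icc_at_right at_within_Icc_at_left)
  have 2: "z t \<in> D \<and> (z has_vector_derivative - P (z t)) (at t) \<and> (z \<longlongrightarrow> z t) (at_left t)"
    if "t0 < t" "t < t1" "t \<noteq> s m" for t
  proof -
    have *: "z t \<in> D" "(z has_vector_derivative - P (z t)) (at t)"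
      using z that unfolding impulsive_solution_def by (auto simp: interior_atLeastAtMost_real)
    then have "(z \<longlongrightarrow> z t) (at t)"
      using has_vector_derivative_continuous continuous_within by blast
    then show ?thesis
      using * filterlim_at_split by blast
  qed
  obtain l where l: "(z \<longlongrightarrow> l) (at_left (s m))" "z (s m) = l + J m"
      "(z \<longlongrightarrow> z (s m)) (at_right (s m))"
    using z unfolding impulsive_solution_def by auto
  show ?thesis
    by (rule that[OF l 1 2])
qed

lemma impulsive_step_norm_le:
  assumes z: "impulsive_solution D P {t0..t1} {m} s J z" and s: "t0 < s m" "s m < t1"
    and t: "t0 \<le> t" "t \<le> t1"
  shows "norm (z t) \<le> norm (z t0) + norm (J m)"
proof -
  obtain l where l: "(z \<longlongrightarrow> l) (at_left (s m))" "z (s m) = l + J m"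
    and lim: "(z \<longlongrightarrow> z (s m)) (at_right (s m))" "(z \<longlongrightarrow> z t0) (at_right t0)" "(z \<longlongrightarrow> z t1) (at_left t1)"
    and der: "\<And>t. t0 < t \<Longrightarrow> t < t1 \<Longrightarrow> t \<noteq> s m \<Longrightarrow>
        z t \<in> D \<and> (z has_vector_derivative - P (z t)) (at t) \<and> (z \<longlongrightarrow> z t) (at_left t)"
    by (rule impulsive_stepE[OF z s]) (rule that; assumption)
  have "norm l \<le> norm (z t0)"
    using s by (intro trajectory_norm_le[OF s(1) _ lim(2) l(1)]) (use der in auto)
  then have sm: "norm (z (s m)) \<le> norm (z t0) + norm (J m)"
    using norm_triangle_ineq[of l "J m"] by (simp add: l(2))
  consider "t = t0" | "t0 < t" "t < s m" | "t = s m" | "s m < t"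
    using t by linarith
  then show ?thesis
  proof cases
    case 2
    have "norm (z t) \<le> norm (z t0)"
      using der 2 s by (intro trajectory_norm_le[OF 2(1) _ lim(2)]) auto
    then show ?thesis by (simp add: add_increasing2)
  next
    case 4
    have "(z \<longlongrightarrow> z t) (at_left t)"
      using der[of t] 4 s t lim(3) by (cases "t = t1") auto
    then have "norm (z t) \<le> norm (z (s m))"
      using der 4 s t by (intro trajectory_norm_le[OF 4 _ lim(1)]) auto
    then show ?thesis using sm by simp
  qed (use sm in auto)
qed

lemma impulsive_step_end:
  assumes z: "impulsive_solution D P {t0..t1} {m} s J z" and s: "t0 < s m" "s m < t1"
  shows "z t1 \<in> H"
    and "inner (z t1) (\<Phi> j) = exp (- lam j * (t1 - t0)) * inner (z t0) (\<Phi> j)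
           + exp (- lam j * (t1 - s m)) * inner (J m) (\<Phi> j)"
proof -
  obtain l where l: "(z \<longlongrightarrow> l) (at_left (s m))" "z (s m) = l + J m"
    and lim: "(z \<longlongrightarrow> z (s m)) (at_right (s m))" "(z \<longlongrightarrow> z t0) (at_right t0)" "(z \<longlongrightarrow> z t1) (at_left t1)"
    and der: "\<And>t. t0 < t \<Longrightarrow> t < t1 \<Longrightarrow> t \<noteq> s m \<Longrightarrow>
        z t \<in> D \<and> (z has_vector_derivative - P (z t)) (at t) \<and> (z \<longlongrightarrow> z t) (at_left t)"
    by (rule impulsive_stepE[OF z s]) (rule that; assumption)
  show "z t1 \<in> H"
    using der s by (intro limit_in_H(2)[OF s(2) _ lim(3)]) auto
  have 1: "inner l (\<Phi> j) = exp (- lam j * (s m - t0)) * inner (z t0) (\<Phi> j)"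
    using der s by (intro trajectory_coeff[OF s(1) _ lim(2) l(1)]) auto
  have 2: "inner (z t1) (\<Phi> j) = exp (- lam j * (t1 - s m)) * inner (z (s m)) (\<Phi> j)"
    using der s by (intro trajectory_coeff[OF s(2) _ lim(1) lim(3)]) auto
  show "inner (z t1) (\<Phi> j) = exp (- lam j * (t1 - t0)) * inner (z t0) (\<Phi> j)
           + exp (- lam j * (t1 - s m)) * inner (J m) (\<Phi> j)"
    unfolding 2 l(2) inner_add_left 1 by (simp add: algebra_simps flip: exp_add)
qed

text \<open>Superposition: the combination of the steered trajectories has the low modes of
  \<open>z t0\<close> as initial datum and the same jump as \<open>z\<close>. The difference at
  \<open>t1\<close> is therefore the free evolution of the high modes, which decays at rate
  \<open>\<Lambda>\<close>, while the combination itself is small because each steered trajectory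
  is.\<close>

lemma feedback_step:
  assumes z: "impulsive_solution D P {t0..t1} {m} s J z" and s: "t0 < s m" "s m < t1"
    and y: "\<And>j. lam j \<le> \<Lambda> \<Longrightarrow> impulsive_solution D P {t0..t1} {m} s (\<lambda>_. g j) (y j)"
    and y0: "\<And>j. lam j \<le> \<Lambda> \<Longrightarrow> y j t0 = \<Phi> j"
    and y1: "\<And>j. lam j \<le> \<Lambda> \<Longrightarrow> (norm (y j t1))\<^sup>2 \<le> \<delta> / real (card {j. lam j \<le> \<Lambda>})"
    and J: "J m = (\<Sum>j | lam j \<le> \<Lambda>. inner (z t0) (\<Phi> j) *\<^sub>R g j)" and "0 \<le> \<delta>"
  shows "norm (z t1) \<le> (sqrt \<delta> + exp (- \<Lambda> * (t1 - t0))) * norm (z t0)"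
proof -
  define A where "A = {j. lam j \<le> \<Lambda>}"
  define a where "a j = inner (z t0) (\<Phi> j)" for j
  define w where "w = (\<Sum>j\<in>A. a j *\<^sub>R y j t1)"
  have finA: "finite A"
    by (simp add: A_def finite_low)
  note zend = impulsive_step_end[OF z s] and yend = impulsive_step_end[OF y s]
  have wH: "w \<in> H"
    unfolding w_def by (intro H_sum H_scale yend(1)) (simp add: A_def)
  have "norm (z t1 - w) \<le> exp (- \<Lambda> * (t1 - t0)) * norm (z t0)"
  proof (rule norm_le_coeffs)
    fix k
    let ?e = "exp (- lam k * (t1 - t0))" and ?d = "exp (- lam k * (t1 - s m))"
    have "inner w (\<Phi> k) = (\<Sum>j\<in>A. a j * (?e * inner (\<Phi> j) (\<Phi> k) + ?d * inner (g j) (\<Phi> k)))"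
      unfolding w_def inner_sum_left
      by (intro sum.cong) (simp_all add: A_def yend(2) y0)
    also have "\<dots> = ?e * inner (\<Sum>j\<in>A. a j *\<^sub>R \<Phi> j) (\<Phi> k) + ?d * inner (J m) (\<Phi> k)"
    proof -
      have "J m = (\<Sum>j\<in>A. a j *\<^sub>R g j)"
        by (simp add: J A_def a_def)
      then show ?thesis
        by (simp only: inner_sum_left inner_scaleR_left sum_distrib_left distrib_left sum.distrib
            mult.left_commute)
    qed
    finally have "inner (z t1 - w) (\<Phi> k) = ?e * (a k - (if k \<in> A then a k else 0))"
      by (simp add: inner_diff_left zend(2) inner_sum_Phi[OF finA] right_diff_distrib flip: a_def)
    moreover have "?e \<le> exp (- \<Lambda> * (t1 - t0))" if "k \<notin> A"
      using that s by (auto simp: A_def intro!: mult_right_mono)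
    ultimately show "\<bar>inner (z t1 - w) (\<Phi> k)\<bar> \<le> exp (- \<Lambda> * (t1 - t0)) * \<bar>inner (z t0) (\<Phi> k)\<bar>"
      by (auto simp: abs_mult mult_right_mono simp flip: a_def)
  qed (use zend(1) wH in \<open>auto intro: H_diff\<close>)
  moreover have "norm w \<le> sqrt \<delta> * norm (z t0)"
  proof -
    have y1': "(norm (y j t1))\<^sup>2 \<le> \<delta> / real (card A)" if "j \<in> A" for j
      using y1[of j] that by (simp add: A_def)
    have "(norm w)\<^sup>2 \<le> (\<Sum>j\<in>A. (a j)\<^sup>2) * (real (card A) * (\<delta> / real (card A)))"
      unfolding w_def by (rule norm_sum_scaleR_le[OF y1']) (simp_all add: \<open>0 \<le> \<delta>\<close>)
    also have "\<dots> \<le> (norm (z t0))\<^sup>2 * \<delta>"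
    proof (rule mult_mono)
      show "(\<Sum>j\<in>A. (a j)\<^sup>2) \<le> (norm (z t0))\<^sup>2"
        unfolding a_def by (rule bessel[OF finA])
      \<comment> \<open>Only an inequality, since for empty \<open>A\<close> the left-hand side is
        0.\<close>
      show "real (card A) * (\<delta> / real (card A)) \<le> \<delta>"
        using \<open>0 \<le> \<delta>\<close> by simp
    qed (use \<open>0 \<le> \<delta>\<close> in simp_all)
    also have "\<dots> = (sqrt \<delta> * norm (z t0))\<^sup>2"
      using \<open>0 \<le> \<delta>\<close> by (simp add: power_mult_distrib)
    finally show ?thesis
      by (rule power2_le_imp_le) (simp add: \<open>0 \<le> \<delta>\<close>)
  qed
  moreover have "norm (z t1) \<le> norm w + norm (z t1 - w)"
    using norm_triangle_ineq[of w "z t1 - w"] by simp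
  ultimately show ?thesis
    by (simp add: distrib_right)
qed

end

section \<open>Existence of steered trajectories and of impulse controls\<close>

context compact_eigen_system
begin

lemma semigroup_shift_derivative:
  assumes "x \<in> H" "a < t"
  shows "((\<lambda>t. semigroup (t - a) x) has_vector_derivative - P (semigroup (t - a) x)) (at t)"
proof -
  have "((\<lambda>t. t - a) has_vector_derivative 1) (at t)"
    by (auto intro!: derivative_eq_intros)
  from vector_diff_chain_at[OF this semigroup_derivative[OF assms(1)]] assms(2)
  show ?thesis by (simp add: o_def)
qed

lemma semigroup_shift_continuous:
  assumes "x \<in> H" "a \<le> t"
  shows "continuous (at t within {a..}) (\<lambda>t. semigroup (t - a) x)"
proof -
  have "continuous_on {a..} (\<lambda>t. semigroup (t - a) x)"
    by (rule continuous_on_compose2[OF continuous_on_semigroup[OF assms(1)]])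
      (auto intro!: continuous_intros)
  then show ?thesis
    using assms(2) by (simp add: continuous_on_eq_continuous_within)
qed

lemma impulsive_step_exists:
  assumes x: "x \<in> H" and g: "g \<in> H" and s: "t0 < s m" "s m < t1"
  shows "\<exists>y. impulsive_solution D P {t0..t1} {m} s (\<lambda>_. g) y \<and> y t0 = x \<and>
             y t1 = semigroup (t1 - s m) (semigroup (s m - t0) x + g)"
proof -
  define x1 where "x1 = semigroup (s m - t0) x + g"
  have x1: "x1 \<in> H"
    unfolding x1_def using x g s by (intro H_add semigroup_in_H) auto
  \<comment> \<open>The strict inequality assigns the impulse time to the second branch, which makes
    \<open>y\<close> right-continuous there.\<close>
  define y where "y t = (if t < s m then semigroup (t - t0) x else semigroup (t - s m) x1)" for t
  have y_D: "y t \<in> D" and y_der: "(y has_vector_derivative - P (y t)) (at t)"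
    if t: "t0 < t" "t \<noteq> s m" for t
  proof -
    show "y t \<in> D"
      using t x x1 by (auto simp: y_def intro: semigroup_in_D)
    show "(y has_vector_derivative - P (y t)) (at t)"
    proof (cases "t < s m")
      case True
      then have "y t = semigroup (t - t0) x"
        by (simp add: y_def)
      then have "((\<lambda>t. semigroup (t - t0) x) has_vector_derivative - P (y t)) (at t)"
        using semigroup_shift_derivative[OF x t(1)] by simp
      then show ?thesis
        by (rule has_vector_derivative_transform_within_open[OF _ open_lessThan[of "s m"]])
          (use True in \<open>simp_all add: y_def\<close>)
    next
      case False
      then have "s m < t"
        using t by simp
      have "y t = semigroup (t - s m) x1"
        using False by (simp add: y_def)
      then have "((\<lambda>t. semigroup (t - s m) x1) has_vector_derivative - P (y t)) (at t)"
        using semigroup_shift_derivative[OF x1 \<open>s m < t\<close>] by simp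
      then show ?thesis
        by (rule has_vector_derivative_transform_within_open[OF _ open_greaterThan[of "s m"]])
          (use \<open>s m < t\<close> in \<open>simp_all add: y_def\<close>)
    qed
  qed
  have cont: "continuous (at t within {t0..t1}) y" if t: "t \<in> {t0..t1} - s ` {m}" for t
  proof (cases "t = t0")
    case True
    show ?thesis
    proof (rule continuous_transform_within)
      show "continuous (at t within {t0..t1}) (\<lambda>t. semigroup (t - t0) x)"
        using t by (intro continuous_within_subset[OF semigroup_shift_continuous[OF x]]) auto
      show "0 < s m - t" using True s by simp
    qed (use t in \<open>auto simp: y_def dist_real_def\<close>)
  next
    case False
    then have "t0 < t" "t \<noteq> s m"
      using t by auto
    then show ?thesis
      by (rule continuous_at_imp_continuous_within[OF has_vector_derivative_continuous[OF y_der]])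
  qed
  have right: "(y \<longlongrightarrow> y (s m)) (at_right (s m))"
  proof (rule Lim_transform_eventually)
    show "((\<lambda>t. semigroup (t - s m) x1) \<longlongrightarrow> y (s m)) (at_right (s m))"
      using semigroup_shift_continuous[OF x1, of "s m" "s m"]
      by (simp add: continuous_within at_within_Ici_at_right y_def)
    show "eventually (\<lambda>t. semigroup (t - s m) x1 = y t) (at_right (s m))"
      by (auto simp: y_def eventually_at_filter)
  qed
  have left: "(y \<longlongrightarrow> semigroup (s m - t0) x) (at_left (s m))"
  proof (rule Lim_transform_eventually)
    show "((\<lambda>t. semigroup (t - t0) x) \<longlongrightarrow> semigroup (s m - t0) x) (at_left (s m))"
      using has_vector_derivative_continuous[OF semigroup_shift_derivative[OF x s(1)]]
      by (simp add: continuous_within filterlim_at_split)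
    show "eventually (\<lambda>t. semigroup (t - t0) x = y t) (at_left (s m))"
      by (auto simp: y_def eventually_at_filter)
  qed
  have "y (s m) = semigroup (s m - t0) x + g"
    by (simp add: y_def x1_def)
  with left right have "\<forall>k\<in>{m}. (y \<longlongrightarrow> y (s k)) (at_right (s k)) \<and>
      (\<exists>l. (y \<longlongrightarrow> l) (at_left (s k)) \<and> y (s k) = l + g)"
    by blast
  moreover have "\<forall>t\<in>interior {t0..t1} - s ` {m}. y t \<in> D \<and> (y has_vector_derivative - P (y t)) (at t)"
    using y_D y_der by (simp add: interior_atLeastAtMost_real)
  ultimately have "impulsive_solution D P {t0..t1} {m} s (\<lambda>_. g) y"
    unfolding impulsive_solution_def using cont by blast
  then show ?thesis
    using s by (intro exI[of _ y]) (simp add: y_def x1_def)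
qed

text \<open>Galerkin approximation of the minimiser of
  \<open>\<kappa>/2 \<parallel>E S x\<parallel>\<^sup>2 + \<epsilon>/2 \<parallel>x\<parallel>\<^sup>2 + \<langle>S \<Phi>\<^sub>i, S x\<rangle>\<close> with \<open>S\<close> the semigroup at time \<open>\<tau>\<close>; the
  projection error is absorbed because \<open>\<parallel>S \<Phi>\<^sub>i\<parallel> < 1\<close>.\<close>

lemma approximate_control:
  assumes E: "linear E" "\<And>x y. inner (E x) y = inner x (E y)" "\<And>x. E (E x) = E x"
      "\<And>x. x \<in> H \<Longrightarrow> E x \<in> H"
    and pos: "0 < \<tau>" "0 < \<kappa>" "0 < \<epsilon>"
    and obs: "\<And>x. x \<in> H \<Longrightarrow>
      (norm (semigroup \<tau> x))\<^sup>2 \<le> \<kappa> * (norm (E (semigroup \<tau> x)))\<^sup>2 + \<epsilon> * (norm x)\<^sup>2"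
  shows "\<exists>g\<in>H. (norm (E g))\<^sup>2 \<le> \<kappa> \<and> (norm (semigroup \<tau> (semigroup \<tau> (\<Phi> i) + E g)))\<^sup>2 \<le> \<epsilon>"
proof -
  define q where "q = exp (- lam i * \<tau>)"
  have q: "0 < q" "q < 1"
    using lam_pos[of i] pos by (auto simp: q_def)
  have "filterlim (\<lambda>n. lam n * \<tau>) at_top sequentially"
    using filterlim_lam pos by (simp add: filterlim_at_top_mult_tendsto_pos[OF tendsto_const])
  then have "((\<lambda>n. exp (- (lam n * \<tau>))) \<longlongrightarrow> 0) sequentially"
    by (intro filterlim_compose[OF exp_at_bot]) (simp add: filterlim_uminus_at_bot)
  then have "((\<lambda>n. exp (- (lam n * \<tau>)) * (sqrt \<kappa> * q)) \<longlongrightarrow> 0) sequentially"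
    by (rule tendsto_mult_left_zero)
  from order_tendstoD(2)[OF this, of "sqrt \<epsilon> * (1 - q)"]
  have "eventually (\<lambda>n. exp (- (lam n * \<tau>)) * (sqrt \<kappa> * q) < sqrt \<epsilon> * (1 - q)) sequentially"
    using q pos by simp
  moreover have "eventually (\<lambda>n. n > i) sequentially"
    by (rule eventually_gt_at_top)
  ultimately have "eventually (\<lambda>n. exp (- (lam n * \<tau>)) * (sqrt \<kappa> * q) < sqrt \<epsilon> * (1 - q) \<and> i < n) sequentially"
    by (rule eventually_conj)
  \<comment> \<open>The truncation error will be at most the left-hand side, and the Galerkin
    solution contributes at most \<open>sqrt \<epsilon> * q\<close> to the final state; the two
    together stay below \<open>sqrt \<epsilon>\<close>. The condition \<open>i < n\<close> puts
    \<open>\<Phi> i\<close> into the Galerkin space.\<close>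
  then obtain n where n: "exp (- lam n * \<tau>) * (sqrt \<kappa> * q) < sqrt \<epsilon> * (1 - q)" "i < n"
    by (auto simp: eventually_sequentially)
  define B where "B = \<Phi> ` {..<n}"
  \<comment> \<open>The truncated semigroup is linear on the whole type, as \<open>bilinear\<close>
    demands of the form \<open>a\<close>; on \<open>span B\<close> it coincides with the semigroup
    by \<open>S_eq\<close>. The term with \<open>\<epsilon>\<close> makes \<open>a\<close> definite
    on the whole type.\<close>
  define S where "S x = (\<Sum>j<n. (exp (- lam j * \<tau>) * inner x (\<Phi> j)) *\<^sub>R \<Phi> j)" for x
  have inner_S: "inner (S x) (\<Phi> k) = (if k < n then exp (- lam k * \<tau>) * inner x (\<Phi> k) else 0)" for x k
    by (simp add: S_def inner_sum_Phi)
  have SH: "S x \<in> H" for x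
    unfolding S_def by (intro H_sum H_scale Phi_H)
  have linS: "linear S"
    unfolding S_def
    by (intro linearI) (simp_all add: inner_add_left algebra_simps sum.distrib scaleR_sum_right)
  have linES: "linear (\<lambda>x. E (S x))"
    using linear_compose[OF linS E(1)] by (simp add: o_def)
  have SPhi: "S (\<Phi> k) = exp (- lam k * \<tau>) *\<^sub>R \<Phi> k" if "k < n" for k
    using that SH by (intro eq_coeffs H_scale Phi_H) (auto simp: inner_S inner_Phi)
  have spanB: "x \<in> H \<and> (\<forall>k\<ge>n. inner x (\<Phi> k) = 0)" if "x \<in> span B" for x
  proof -
    have "span B \<subseteq> {x \<in> H. \<forall>k\<ge>n. inner x (\<Phi> k) = 0}"
      by (rule span_minimal)
        (auto simp: B_def inner_Phi Phi_H inner_add_left intro!: subspaceI H_add H_scale subspace_0[OF subspace_H])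
    then show ?thesis using that by blast
  qed
  have S_eq: "S x = semigroup \<tau> x" if "x \<in> span B" for x
    using spanB[OF that] pos
    by (intro eq_coeffs SH) (auto simp: inner_S inner_semigroup semigroup_in_H not_less)
  define a where "a x y = \<kappa> * inner (E (S x)) (E (S y)) + \<epsilon> * inner x y" for x y
  have a_lin: "linear (a x)" "linear (\<lambda>x. a x y)" for x y
    unfolding a_def
    by (intro linearI; simp add: linear_add[OF linES] linear_scale[OF linES] inner_add_left
        inner_add_right algebra_simps)+
  \<comment> \<open>The Euler-Lagrange equation on the Galerkin space. For the control
    \<open>E g\<close> with \<open>g = \<kappa> *\<^sub>R S u\<close> it says that the first
    \<open>n\<close> coefficients of the final state are those of
    \<open>- \<epsilon> *\<^sub>R u\<close>.\<close>
  have "\<exists>u\<in>span B. \<forall>v\<in>span B. a u v = - inner (S (\<Phi> i)) (S v)"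
  proof (rule finite_dim_lax_milgram)
    show "bilinear a"
      using a_lin by (simp add: bilinear_def)
    show "0 < a x x" if "x \<noteq> 0" for x
      using that pos by (auto simp: a_def intro!: add_nonneg_pos)
    show "linear (\<lambda>v. - inner (S (\<Phi> i)) (S v))"
      by (intro linearI) (simp_all add: linear_add[OF linS] linear_scale[OF linS] inner_add_right)
  qed (simp add: B_def)
  then obtain u where u: "u \<in> span B" "\<And>v. v \<in> span B \<Longrightarrow> a u v = - inner (S (\<Phi> i)) (S v)"
    by blast
  define X where "X = a u u"
  define g where "g = \<kappa> *\<^sub>R S u"
  have Eg: "E g = \<kappa> *\<^sub>R E (S u)"
    by (simp add: g_def linear_scale[OF E(1)])
  have X: "X = \<kappa> * (norm (E (S u)))\<^sup>2 + \<epsilon> * (norm u)\<^sup>2"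
    by (simp add: X_def a_def power2_norm_eq_inner)
  have "X \<le> q\<^sup>2"
  proof -
    have "X \<le> norm (S (\<Phi> i)) * norm (S u)"
      using norm_cauchy_schwarz[of "- S (\<Phi> i)" "S u"] unfolding X_def u(2)[OF u(1)] by simp
    also have "norm (S (\<Phi> i)) = q"
      by (simp add: SPhi[OF n(2)] q_def)
    \<comment> \<open>The observability inequality for \<open>u\<close> is precisely the bound of
      \<open>(norm (S u))\<^sup>2\<close> by \<open>X\<close>. Together with testing the equation at
      \<open>u\<close> itself this gives \<open>X \<le> q * sqrt X\<close>.\<close>
    also have "norm (S u) \<le> sqrt X"
      using obs[of u] spanB[OF u(1)] unfolding X S_eq[OF u(1)] by (intro real_le_rsqrt) auto
    finally have "X \<le> q * sqrt X"
      using q by simp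
    moreover have "0 \<le> X"
      using pos by (simp add: X)
    ultimately have "sqrt X * sqrt X \<le> q * sqrt X" by simp
    then have "sqrt X \<le> q"
    proof (cases "X = 0")
      case False
      with \<open>0 \<le> X\<close> have "0 < sqrt X" by simp
      with \<open>sqrt X * sqrt X \<le> q * sqrt X\<close> show ?thesis
        by (rule mult_right_le_imp_le)
    qed (use q in simp)
    then have "(sqrt X)\<^sup>2 \<le> q\<^sup>2"
      using \<open>0 \<le> X\<close> by (intro power_mono) auto
    then show ?thesis
      using \<open>0 \<le> X\<close> by simp
  qed
  have Eg_le: "norm (E g) \<le> sqrt \<kappa> * q"
  proof -
    have "(norm (E g))\<^sup>2 = \<kappa> * (\<kappa> * (norm (E (S u)))\<^sup>2)"
      by (simp add: Eg power2_eq_square)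
    also have "\<dots> \<le> \<kappa> * q\<^sup>2"
    proof -
      have "0 \<le> \<epsilon> * (norm u)\<^sup>2" using pos by simp
      then have "\<kappa> * (norm (E (S u)))\<^sup>2 \<le> q\<^sup>2"
        using \<open>X \<le> q\<^sup>2\<close> X by linarith
      then show ?thesis
        using pos by (intro mult_left_mono) auto
    qed
    finally have "(norm (E g))\<^sup>2 \<le> (sqrt \<kappa> * q)\<^sup>2"
      using pos by (simp add: power_mult_distrib)
    then show ?thesis
      by (rule power2_le_imp_le) (use pos q in auto)
  qed
  have u_le: "\<epsilon> * norm u \<le> sqrt \<epsilon> * q"
  proof -
    have "0 \<le> \<kappa> * (norm (E (S u)))\<^sup>2" using pos by simp
    then have "\<epsilon> * (norm u)\<^sup>2 \<le> q\<^sup>2"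
      using \<open>X \<le> q\<^sup>2\<close> X by linarith
    then have "\<epsilon> * (\<epsilon> * (norm u)\<^sup>2) \<le> \<epsilon> * q\<^sup>2"
      using pos by (intro mult_left_mono) auto
    moreover have "(\<epsilon> * norm u)\<^sup>2 = \<epsilon> * (\<epsilon> * (norm u)\<^sup>2)"
      by (simp only: power2_eq_square mult_ac)
    moreover have "(sqrt \<epsilon> * q)\<^sup>2 = \<epsilon> * q\<^sup>2"
      using pos by (simp add: power_mult_distrib)
    ultimately have "(\<epsilon> * norm u)\<^sup>2 \<le> (sqrt \<epsilon> * q)\<^sup>2"
      by simp
    then show ?thesis
      by (rule power2_le_imp_le) (use pos q in auto)
  qed
  have gH: "g \<in> H"
    unfolding g_def by (intro H_scale SH)
  define y where "y = semigroup \<tau> (semigroup \<tau> (\<Phi> i) + E g)"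
  have SiH: "semigroup \<tau> (\<Phi> i) \<in> H"
    using pos by (intro semigroup_in_H Phi_H) auto
  have yH: "y \<in> H"
    unfolding y_def using pos E(4)[OF gH] SiH by (intro semigroup_in_H H_add) (auto intro: Phi_H)
  have coeff_y: "inner y (\<Phi> k) = exp (- lam k * \<tau>) * (inner (S (\<Phi> i)) (\<Phi> k) + inner (E g) (\<Phi> k))" for k
    unfolding y_def using pos E(4)[OF gH] SiH n(2)
    by (simp add: inner_semigroup H_add inner_add_left SPhi Phi_H)
       (auto simp: inner_Phi)
  \<comment> \<open>Modes below \<open>n\<close> cancel by the Euler-Lagrange equation. In the
    others both \<open>u\<close> and \<open>S (\<Phi> i)\<close> have coefficient 0, so only the
    damped control remains.\<close>
  have "norm (y + \<epsilon> *\<^sub>R u) \<le> exp (- lam n * \<tau>) * norm (E g)"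
  proof (rule norm_le_coeffs)
    show "y + \<epsilon> *\<^sub>R u \<in> H"
      using yH spanB[OF u(1)] by (intro H_add H_scale) auto
    fix k
    show "\<bar>inner (y + \<epsilon> *\<^sub>R u) (\<Phi> k)\<bar> \<le> exp (- lam n * \<tau>) * \<bar>inner (E g) (\<Phi> k)\<bar>"
    proof (cases "k < n")
      case True
      then have "\<Phi> k \<in> span B"
        by (auto simp: B_def intro: span_base)
      from u(2)[OF this] have "\<kappa> * inner (E (S u)) (E (S (\<Phi> k))) + \<epsilon> * inner u (\<Phi> k)
          = - inner (S (\<Phi> i)) (S (\<Phi> k))"
        by (simp add: a_def)
      moreover have "inner (E (S u)) (E (S (\<Phi> k))) = inner (E (S u)) (S (\<Phi> k))"
        by (metis E(2,3))
      ultimately have "inner (y + \<epsilon> *\<^sub>R u) (\<Phi> k) = 0"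
        by (simp add: inner_add_left coeff_y Eg SPhi[OF True] algebra_simps)
      then show ?thesis by simp
    next
      case False
      have "exp (- lam k * \<tau>) \<le> exp (- lam n * \<tau>)"
        using pos lam_mono[of n k] False by simp
      then show ?thesis
        using False spanB[OF u(1)]
        by (simp add: inner_add_left coeff_y inner_S abs_mult mult_right_mono)
    qed
  qed simp
  also have "\<dots> \<le> exp (- lam n * \<tau>) * (sqrt \<kappa> * q)"
    by (intro mult_left_mono Eg_le) simp
  finally have "norm (y + \<epsilon> *\<^sub>R u) \<le> sqrt \<epsilon> * (1 - q)"
    using n(1) by simp
  moreover have "norm y \<le> norm (y + \<epsilon> *\<^sub>R u) + \<epsilon> * norm u"
    using norm_triangle_ineq4[of "y + \<epsilon> *\<^sub>R u" "\<epsilon> *\<^sub>R u"] pos by simp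
  ultimately have "norm y \<le> sqrt \<epsilon>"
    using u_le by (simp add: algebra_simps)
  then have "(norm y)\<^sup>2 \<le> (sqrt \<epsilon>)\<^sup>2"
    by (intro power_mono) auto
  moreover have "(norm (E g))\<^sup>2 \<le> \<kappa>"
  proof -
    have "sqrt \<kappa> * q \<le> sqrt \<kappa>"
      using pos q by simp
    then have "(norm (E g))\<^sup>2 \<le> (sqrt \<kappa>)\<^sup>2"
      using Eg_le by (intro power_mono) auto
    then show ?thesis using pos by simp
  qed
  ultimately show ?thesis
    using gH pos by (auto simp: y_def)
qed

end

section \<open>Approximate observability\<close>

lemma linear_ext_zero: "linear (ext_zero A)"
proof -
  have "ext_zero A (f + g) = ext_zero A f + ext_zero A g" for A :: "'a::euclidean_space set" and f g
  proof transfer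
    fix A :: "'a set" and f g :: "'a \<Rightarrow> real"
    assume "l2_eq f f" "l2_eq g g"
    then show "l2_eq (\<lambda>x. if A \<in> sets lebesgue then indicator A x * (f x + g x) else 0)
        (\<lambda>x. (if A \<in> sets lebesgue then indicator A x * f x else 0) +
             (if A \<in> sets lebesgue then indicator A x * g x else 0))"
      by (cases "A \<in> sets lebesgue")
        (simp_all add: l2_eq_def sq_integrable_zero sq_integrable_restrict sq_integrable_add distrib_left)
  qed
  moreover have "ext_zero A (r *\<^sub>R f) = r *\<^sub>R ext_zero A f" for A :: "'a set" and r f
  proof transfer
    fix A :: "'a set" and r :: real and f :: "'a \<Rightarrow> real"
    assume "l2_eq f f"
    then show "l2_eq (\<lambda>x. if A \<in> sets lebesgue then indicator A x * (r * f x) else 0)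
        (\<lambda>x. r * (if A \<in> sets lebesgue then indicator A x * f x else 0))"
      using sq_integrable_cmult[OF sq_integrable_restrict, of f A r]
      by (cases "A \<in> sets lebesgue")
        (simp_all add: l2_eq_def sq_integrable_zero mult.left_commute)
  qed
  ultimately show ?thesis
    by (intro linearI) auto
qed

lemma inner_ext_zero: "inner (ext_zero A f) g = inner f (ext_zero A g)"
proof transfer
  fix A :: "'a set" and f g :: "'a \<Rightarrow> real"
  show "(\<integral>x. (if A \<in> sets lebesgue then indicator A x * f x else 0) * g x \<partial>lebesgue)
      = (\<integral>x. f x * (if A \<in> sets lebesgue then indicator A x * g x else 0) \<partial>lebesgue)"
    by (rule Bochner_Integration.integral_cong) (simp_all add: indicator_def)
qed

lemma ext_zero_idem: "ext_zero A (ext_zero A f) = ext_zero A f"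
proof transfer
  fix A :: "'a set" and f :: "'a \<Rightarrow> real"
  assume f: "l2_eq f f"
  have "indicator A x * (indicator A x * f x) = indicator A x * f x" for x
    by (simp add: indicator_def)
  then show "l2_eq (\<lambda>x. if A \<in> sets lebesgue
        then indicator A x * (if A \<in> sets lebesgue then indicator A x * f x else 0) else 0)
      (\<lambda>x. if A \<in> sets lebesgue then indicator A x * f x else 0)"
    using f by (cases "A \<in> sets lebesgue")
      (simp_all add: l2_eq_def sq_integrable_zero sq_integrable_restrict)
qed

lemma ext_zero_in_L2_on:
  assumes "A \<subseteq> B"
  shows "ext_zero A f \<in> L2_on B"
  unfolding L2_on_def mem_Collect_eq using assms
  by transfer (auto simp: indicator_def)

lemma norm_ext_zero_le: "norm (ext_zero A f) \<le> norm f"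
proof (cases "ext_zero A f = 0")
  case False
  have "(norm (ext_zero A f))\<^sup>2 = inner (ext_zero A f) f"
    by (metis power2_norm_eq_inner inner_ext_zero ext_zero_idem inner_commute)
  also have "\<dots> \<le> norm (ext_zero A f) * norm f"
    by (rule norm_cauchy_schwarz)
  finally show ?thesis
    using False by (simp add: power2_eq_square)
qed simp

text \<open>The fractions \<open>x / (x + y)\<close> and \<open>y / (x + y)\<close> lie between 0
  and 1, where a power with exponent at most 1 does not decrease a number, and they add up to
  1.\<close>

lemma powr_add_le:
  fixes x y s :: real
  assumes "0 \<le> x" "0 \<le> y" "0 < s" "s \<le> 1"
  shows "(x + y) powr s \<le> x powr s + y powr s"
proof (cases "x + y = 0")
  case False
  then have z: "0 < x + y" using assms by linarith
  have *: "(x + y) powr s * (w / (x + y)) \<le> w powr s" if "0 \<le> w" "w \<le> x + y" for w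
  proof -
    have "w / (x + y) \<le> (w / (x + y)) powr s"
    proof (cases "w = 0")
      case False
      then have "(w / (x + y)) powr 1 \<le> (w / (x + y)) powr s"
        using that z assms by (intro powr_mono') (auto simp: divide_le_eq)
      then show ?thesis
        using that z by simp
    qed simp
    then have "(x + y) powr s * (w / (x + y)) \<le> (x + y) powr s * (w / (x + y)) powr s"
      by (intro mult_left_mono) auto
    also have "\<dots> = w powr s"
      using that z by (simp flip: powr_mult)
    finally show ?thesis .
  qed
  have "(x + y) powr s = (x + y) powr s * (x / (x + y)) + (x + y) powr s * (y / (x + y))"
    using z by (simp flip: distrib_left add_divide_distrib)
  then show ?thesis
    using *[of x] *[of y] assms by linarith
qed (use assms in auto)

text \<open>In (iii) the constant stands inside the power \<sigma>; this moves outer factors to that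
  place.\<close>

lemma mult_powr_absorb:
  fixes a x s :: real
  assumes "0 < a" "0 \<le> x" "0 < s"
  shows "a * x powr s = (a powr (1 / s) * x) powr s"
  using assms by (simp add: powr_mult powr_powr)

lemma ln_ratio_bound:
  fixes v N \<epsilon> :: real
  assumes "0 < v" "v \<le> N" "\<epsilon> * N\<^sup>2 < v\<^sup>2" "0 < \<epsilon>"
  shows "0 \<le> ln (N / v)" "2 * ln (N / v) \<le> ln (exp 1 + 1 / \<epsilon>)"
proof -
  have "1 \<le> N / v" using assms by simp
  then show "0 \<le> ln (N / v)" by simp
  have "(N / v)\<^sup>2 \<le> 1 / \<epsilon>"
    using assms by (simp add: power_divide field_simps)
  also have "\<dots> \<le> exp 1 + 1 / \<epsilon>" by simp
  finally have "ln ((N / v)\<^sup>2) \<le> ln (exp 1 + 1 / \<epsilon>)"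
    using \<open>1 \<le> N / v\<close> assms(4) by (intro ln_mono) auto
  then show "2 * ln (N / v) \<le> ln (exp 1 + 1 / \<epsilon>)"
    using \<open>1 \<le> N / v\<close> by (simp add: ln_realpow)
qed

lemma one_le_ln_exp_add:
  fixes \<epsilon> :: real
  assumes "0 < \<epsilon>"
  shows "1 \<le> ln (exp 1 + 1 / \<epsilon>)"
proof -
  have "ln (exp 1) \<le> ln (exp 1 + 1 / \<epsilon>)"
    using assms by (intro ln_mono) auto
  then show ?thesis by simp
qed

section \<open>Each of (i), (ii) and (iv) gives (iii)\<close>

context eigen_system
begin

lemma evolution_in_H:
  assumes "evolution D P u" "0 < t"
  shows "u t \<in> H"
  using assms D_sub_H by (simp add: evolution_def)

lemma evolution_norm_le:
  assumes "evolution D P u" "0 < t"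
  shows "norm (u t) \<le> norm (u 0)"
proof -
  have "norm (u t) \<le> 1 * norm (u 0)"
  proof (rule norm_le_coeffs)
    show "\<bar>inner (u t) (\<Phi> j)\<bar> \<le> 1 * \<bar>inner (u 0) (\<Phi> j)\<bar>" for j
      using lam_pos[of j] assms
      by (auto simp: inner_evolution[of u t] abs_mult intro!: mult_left_le_one_le)
  qed (use evolution_in_H[OF assms] in simp_all)
  then show ?thesis by simp
qed

end

text \<open>When \<open>\<epsilon> \<parallel>u(0)\<parallel>\<^sup>2 < \<parallel>u(t)\<parallel>\<^sup>2\<close>, the frequency \<open>ln (\<parallel>u(0)\<parallel> / \<parallel>u(t)\<parallel>)\<close> is controlled by
  \<open>ln (e + 1/\<epsilon>)\<close>, see \<open>ln_ratio_bound\<close>.\<close>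

lemma approximate_observabilityI:
  assumes "eigen_system (L2_on \<Omega>) D P lam \<Phi>"
    and *: "\<And>\<epsilon> t u. \<lbrakk>0 < \<epsilon>; 0 < t; evolution D P u; u 0 \<in> L2_on \<Omega>; 0 < norm (u t); norm (u t) \<le> norm (u 0);
       \<epsilon> * (norm (u 0))\<^sup>2 < (norm (u t))\<^sup>2\<rbrakk> \<Longrightarrow>
       (norm (u t))\<^sup>2 \<le> exp (C3 * (1 + (1 / t) powr (\<sigma> / (1 - \<sigma>)))) *
          exp ((C3 / t * ln (exp 1 + 1 / \<epsilon>)) powr \<sigma>) * (norm_on \<omega> (u t))\<^sup>2"
  shows "approximate_observability \<Omega> \<omega> D P \<sigma> C3"
  unfolding approximate_observability_def
proof (intro ballI allI impI)
  fix \<epsilon> t :: real and u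
  assume pos: "0 < \<epsilon>" "0 < t" and u: "evolution D P u \<and> u 0 \<in> L2_on \<Omega>"
  let ?R = "exp (C3 * (1 + (1 / t) powr (\<sigma> / (1 - \<sigma>)))) *
          exp ((C3 / t * ln (exp 1 + 1 / \<epsilon>)) powr \<sigma>) * (norm_on \<omega> (u t))\<^sup>2"
  have R: "0 \<le> ?R" by simp
  show "(norm (u t))\<^sup>2 \<le> ?R + \<epsilon> * (norm (u 0))\<^sup>2"
  proof (cases "(norm (u t))\<^sup>2 \<le> \<epsilon> * (norm (u 0))\<^sup>2")
    case True
    then show ?thesis using R by linarith
  next
    case False
    have "0 \<le> \<epsilon> * (norm (u 0))\<^sup>2" using pos by simp
    then have "0 < norm (u t)"
      using False by (cases "u t = 0") auto
    moreover have "norm (u t) \<le> norm (u 0)"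
      using eigen_system.evolution_norm_le[OF assms(1)] u pos by blast
    ultimately have "(norm (u t))\<^sup>2 \<le> ?R"
      using *[of \<epsilon> t u] pos u False by simp
    then show ?thesis
      using \<open>0 \<le> \<epsilon> * (norm (u 0))\<^sup>2\<close> by linarith
  qed
qed

text \<open>Squaring (iv) doubles both exponents. In the second one the 2 has to be absorbed under
  the power \<sigma> and becomes \<open>2 powr (1 / \<sigma>)\<close>; as this is at least 2, it
  also serves the first exponent.\<close>

lemma approximate_observability_if_frequency:
  assumes es: "eigen_system (L2_on \<Omega>) D P lam \<Phi>" and \<sigma>: "0 < \<sigma>" "\<sigma> < 1" and "0 < C4"
    and freq: "frequency_observability \<Omega> \<omega> D P \<sigma> C4"
  shows "approximate_observability \<Omega> \<omega> D P \<sigma> (2 powr (1 / \<sigma>) * C4)"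
proof (rule approximate_observabilityI[OF es])
  fix \<epsilon> t :: real and u
  assume pos: "0 < \<epsilon>" "0 < t" and u: "evolution D P u" "u 0 \<in> L2_on \<Omega>"
    and v: "0 < norm (u t)" "norm (u t) \<le> norm (u 0)" "\<epsilon> * (norm (u 0))\<^sup>2 < (norm (u t))\<^sup>2"
  define L where "L = ln (exp 1 + 1 / \<epsilon>)"
  define q where "q = (1 / t) powr (\<sigma> / (1 - \<sigma>))"
  define l where "l = ln (norm (u 0) / norm (u t))"
  define W where "W = norm_on \<omega> (u t)"
  have L: "1 \<le> L"
    unfolding L_def by (rule one_le_ln_exp_add[OF pos(1)])
  have l: "0 \<le> l" "l \<le> L"
    using ln_ratio_bound[OF v pos(1)] L by (simp_all add: l_def L_def)
  have "u 0 \<noteq> 0" using v by auto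
  then have "norm (u t) \<le> exp (C4 * (1 + q)) * exp ((C4 / t * l) powr \<sigma>) * W"
    using freq u pos unfolding frequency_observability_def q_def l_def W_def by blast
  then have "(norm (u t))\<^sup>2 \<le> (exp (C4 * (1 + q)) * exp ((C4 / t * l) powr \<sigma>) * W)\<^sup>2"
    by (intro power_mono) auto
  also have "\<dots> = exp (2 * C4 * (1 + q)) * exp (2 * (C4 / t * l) powr \<sigma>) * W\<^sup>2"
    by (simp add: power_mult_distrib mult.assoc flip: exp_double)
  also have "\<dots> \<le> exp (2 powr (1 / \<sigma>) * C4 * (1 + q)) * exp ((2 powr (1 / \<sigma>) * C4 / t * L) powr \<sigma>) * W\<^sup>2"
  proof -
    have "2 powr 1 \<le> 2 powr (1 / \<sigma>)"
      using \<sigma> by (intro powr_mono) auto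
    then have "2 * C4 * (1 + q) \<le> 2 powr (1 / \<sigma>) * C4 * (1 + q)"
      using \<open>0 < C4\<close> by (intro mult_right_mono) (auto simp: q_def)
    moreover have "2 * (C4 / t * l) powr \<sigma> \<le> (2 powr (1 / \<sigma>) * C4 / t * L) powr \<sigma>"
    proof -
      have "2 * (C4 / t * l) powr \<sigma> \<le> 2 * (C4 / t * L) powr \<sigma>"
        using l \<sigma> pos \<open>0 < C4\<close> by (intro mult_left_mono powr_mono2) auto
      also have "\<dots> = (2 powr (1 / \<sigma>) * (C4 / t * L)) powr \<sigma>"
        using L \<sigma> pos \<open>0 < C4\<close> by (intro mult_powr_absorb) auto
      finally show ?thesis by (simp add: mult.assoc)
    qed
    ultimately show ?thesis
      by (intro mult_mono) auto
  qed
  finally show "(norm (u t))\<^sup>2 \<le> exp (2 powr (1 / \<sigma>) * C4 * (1 + (1 / t) powr (\<sigma> / (1 - \<sigma>)))) *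
       exp ((2 powr (1 / \<sigma>) * C4 / t * ln (exp 1 + 1 / \<epsilon>)) powr \<sigma>) * (norm_on \<omega> (u t))\<^sup>2"
    by (simp add: q_def L_def W_def)
qed

text \<open>Taking logarithms in (ii) leaves two terms that depend on \<theta> in opposite ways: the
  exponent with \<open>1 / (\<theta> * t)\<close>, and \<theta> times the logarithm of the quotient
  of the norms. Balancing them gives the power \<sigma> of (iii).\<close>

lemma approximate_observability_if_interpolation:
  assumes es: "eigen_system (L2_on \<Omega>) D P lam \<Phi>" and \<sigma>: "0 < \<sigma>" "\<sigma> < 1" and "0 < C2"
    and int: "interpolation_inequality \<Omega> \<omega> D P \<sigma> C2" and W0: "\<And>f. 0 \<le> norm_on \<omega> f"
  shows "approximate_observability \<Omega> \<omega> D P \<sigma>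
    (max (4 * C2 * 2 powr (\<sigma> / (1 - \<sigma>))) ((4 * C2 + 2) powr (1 / \<sigma>)))"
proof (rule approximate_observabilityI[OF es])
  fix \<epsilon> t :: real and u
  assume pos: "0 < \<epsilon>" "0 < t" and u: "evolution D P u" "u 0 \<in> L2_on \<Omega>"
    and v: "0 < norm (u t)" "norm (u t) \<le> norm (u 0)" "\<epsilon> * (norm (u 0))\<^sup>2 < (norm (u t))\<^sup>2"
  define \<beta> where "\<beta> = \<sigma> / (1 - \<sigma>)"
  define C3 where "C3 = max (4 * C2 * 2 powr \<beta>) ((4 * C2 + 2) powr (1 / \<sigma>))"
  define L where "L = ln (exp 1 + 1 / \<epsilon>)"
  define q where "q = (1 / t) powr \<beta>"
  define l where "l = ln (norm (u 0) / norm (u t))"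
  define W where "W = norm_on \<omega> (u t)"
  define Y where "Y = (L / t) powr \<sigma>"
  \<comment> \<open>At \<open>\<theta>0\<close> both \<open>\<theta>0 * L\<close> and
    \<open>(1 / (\<theta>0 * t)) powr \<beta>\<close> equal \<open>Y\<close>, because \<beta> (1 -
    \<sigma>) = \<sigma>. The cap 1/2 keeps \<open>1 - \<theta>\<close> away from 0; where it is
    active, the exponent is \<open>2 powr \<beta> * q\<close>, a term that (iii) has room
    for.\<close>
  define \<theta>0 where "\<theta>0 = (L / t) powr (- (1 - \<sigma>)) / t"
  define \<theta> where "\<theta> = min \<theta>0 (1 / 2)"
  have \<beta>: "0 < \<beta>" using \<sigma> by (simp add: \<beta>_def)
  have L: "1 \<le> L"
    unfolding L_def by (rule one_le_ln_exp_add[OF pos(1)])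
  have l: "0 \<le> l" "2 * l \<le> L"
    using ln_ratio_bound[OF v pos(1)] by (simp_all add: l_def L_def)
  have Lt: "0 < L / t" using L pos by simp
  have \<theta>0: "0 < \<theta>0" using L pos by (simp add: \<theta>0_def)
  have \<theta>: "0 < \<theta>" "\<theta> \<le> 1 / 2" "\<theta> \<le> \<theta>0" "\<theta> < 1" using \<theta>0 by (auto simp: \<theta>_def)
  have "\<theta> * L \<le> \<theta>0 * L" using \<theta> L by (intro mult_right_mono) auto
  also have "\<theta>0 * L = (L / t) powr (- (1 - \<sigma>)) * (L / t) powr 1"
    using Lt L pos by (simp add: \<theta>0_def)
  also have "\<dots> = Y"
    unfolding Y_def powr_add[symmetric] by simp
  finally have \<theta>L: "\<theta> * L \<le> Y" .
  have "(1 / (\<theta>0 * t)) powr \<beta> = ((L / t) powr (1 - \<sigma>)) powr \<beta>"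
    using pos Lt by (simp add: \<theta>0_def powr_minus divide_simps flip: powr_minus_divide)
  also have "\<dots> = Y"
    unfolding Y_def powr_powr using \<sigma> by (simp add: \<beta>_def)
  finally have \<theta>0t: "(1 / (\<theta>0 * t)) powr \<beta> = Y" .
  have \<theta>t: "(1 / (\<theta> * t)) powr \<beta> \<le> Y + 2 powr \<beta> * q"
  proof (cases "\<theta> = \<theta>0")
    case True
    then show ?thesis using \<theta>0t by (simp add: q_def)
  next
    case False
    then have "\<theta> = 1 / 2" by (auto simp: \<theta>_def)
    then have "(1 / (\<theta> * t)) powr \<beta> = (2 * (1 / t)) powr \<beta>"
      by (simp only: \<open>\<theta> = 1 / 2\<close>) simp
    also have "\<dots> = 2 powr \<beta> * q"
      unfolding q_def by (rule powr_mult)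
    finally show ?thesis by (simp add: Y_def)
  qed
  have ineq: "norm (u t) \<le> exp (C2 * (1 + (1 / (\<theta> * t)) powr \<beta>)) * norm (u 0) powr \<theta> * W powr (1 - \<theta>)"
    using int u pos \<theta> unfolding interpolation_inequality_def \<beta>_def W_def by auto
  \<comment> \<open>For \<open>W = 0\<close> the right-hand side of \<open>ineq\<close> is 0, since
    \<open>0 powr (1 - \<theta>) = 0\<close>, whereas \<open>u t\<close> is nonzero.\<close>
  have "W \<noteq> 0"
    using ineq v by auto
  then have W: "0 < W"
    using W0[of "u t"] by (simp add: W_def)
  define E where "E = C2 * (1 + (1 / (\<theta> * t)) powr \<beta>)"
  have "E \<ge> 0" using \<open>0 < C2\<close> by (simp add: E_def)
  have N: "0 < norm (u 0)" using v by linarith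
  have "ln (norm (u t)) \<le> ln (exp E * norm (u 0) powr \<theta> * W powr (1 - \<theta>))"
    using ineq v W N unfolding E_def by (subst ln_le_cancel_iff) auto
  also have "\<dots> = E + \<theta> * ln (norm (u 0)) + (1 - \<theta>) * ln W"
    using W N by (simp add: ln_mult ln_powr)
  finally have "(1 - \<theta>) * (ln (norm (u t)) - ln W) \<le> E + \<theta> * l"
    unfolding l_def using v N by (simp add: ln_div algebra_simps)
  moreover have "(1 / 2) * (ln (norm (u t)) - ln W) \<le> (1 - \<theta>) * (ln (norm (u t)) - ln W)"
    if "0 \<le> ln (norm (u t)) - ln W"
    using \<theta> that by (intro mult_right_mono) auto
  moreover have "0 \<le> \<theta> * l" using \<theta> l by simp
  ultimately have "ln (norm (u t)) - ln W \<le> 2 * E + 2 * (\<theta> * l)"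
    using \<open>E \<ge> 0\<close> by (cases "0 \<le> ln (norm (u t)) - ln W") auto
  moreover have "2 * (\<theta> * l) \<le> Y"
  proof -
    have "\<theta> * (2 * l) \<le> \<theta> * L"
      using \<theta> l by (intro mult_left_mono) auto
    then show ?thesis
      using \<theta>L by simp
  qed
  moreover have "E \<le> C2 * (1 + (Y + 2 powr \<beta> * q))"
    unfolding E_def using \<theta>t \<open>0 < C2\<close> by (intro mult_left_mono) auto
  \<comment> \<open>The factor 4 has two sources: division by \<open>1 - \<theta>\<close>, which is
    at least 1/2, and the passage to squared norms.\<close>
  ultimately have "2 * (ln (norm (u t)) - ln W) \<le> 4 * (C2 * (1 + (Y + 2 powr \<beta> * q))) + 2 * Y"
    by simp
  also have "\<dots> = (4 * C2 + 4 * C2 * 2 powr \<beta> * q) + (4 * C2 + 2) * Y"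
    by (simp add: algebra_simps)
  also have "\<dots> \<le> C3 * (1 + q) + (C3 / t * L) powr \<sigma>"
  proof (rule add_mono)
    have "1 \<le> 2 powr \<beta>" using \<beta> by (intro ge_one_powr_ge_zero) auto
    then have "4 * C2 * 1 \<le> 4 * C2 * 2 powr \<beta>"
      using \<open>0 < C2\<close> by (intro mult_left_mono) auto
    then have "4 * C2 + 4 * C2 * 2 powr \<beta> * q \<le> 4 * C2 * 2 powr \<beta> * (1 + q)"
      by (simp add: algebra_simps)
    also have "\<dots> \<le> C3 * (1 + q)"
      by (intro mult_right_mono) (auto simp: C3_def q_def)
    finally show "4 * C2 + 4 * C2 * 2 powr \<beta> * q \<le> C3 * (1 + q)" .
    have "(4 * C2 + 2) * Y = ((4 * C2 + 2) powr (1 / \<sigma>) * (L / t)) powr \<sigma>"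
      unfolding Y_def using \<open>0 < C2\<close> \<sigma> Lt by (intro mult_powr_absorb) auto
    also have "\<dots> \<le> (C3 * (L / t)) powr \<sigma>"
      using \<sigma> L pos by (intro powr_mono2 mult_right_mono) (auto simp: C3_def)
    finally show "(4 * C2 + 2) * Y \<le> (C3 / t * L) powr \<sigma>"
      by simp
  qed
  finally have "2 * ln (norm (u t)) \<le> C3 * (1 + q) + (C3 / t * L) powr \<sigma> + 2 * ln W"
    by simp
  then have "exp (2 * ln (norm (u t))) \<le> exp (C3 * (1 + q) + (C3 / t * L) powr \<sigma> + 2 * ln W)"
    by simp
  then have "(norm (u t))\<^sup>2 \<le> exp (C3 * (1 + q)) * exp ((C3 / t * L) powr \<sigma>) * W\<^sup>2"
    using v W by (simp add: exp_add exp_double)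
  then show "(norm (u t))\<^sup>2
       \<le> exp (max (4 * C2 * 2 powr (\<sigma> / (1 - \<sigma>))) ((4 * C2 + 2) powr (1 / \<sigma>)) *
              (1 + (1 / t) powr (\<sigma> / (1 - \<sigma>)))) *
         exp ((max (4 * C2 * 2 powr (\<sigma> / (1 - \<sigma>))) ((4 * C2 + 2) powr (1 / \<sigma>)) / t *
               ln (exp 1 + 1 / \<epsilon>)) powr \<sigma>) * (norm_on \<omega> (u t))\<^sup>2"
    by (simp add: C3_def q_def L_def W_def \<beta>_def)
qed

text \<open>The low modes of \<open>u t\<close> are recovered from \<omega> by (i). The tail, of
  size \<open>\<delta> * N\<close>, enters twice: as part of \<open>u t\<close> and through the
  observation of \<open>w\<close>, where it is amplified by \<open>sqrt M\<close>. The cutoff has to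
  be so high that the decay of the tail beats this amplification and \<epsilon> as well.\<close>

lemma approximate_observability_if_spectral:
  assumes es: "eigen_system (L2_on \<Omega>) D P lam \<Phi>" and \<sigma>: "0 < \<sigma>" "\<sigma> < 1" and "0 < C1"
    and spec: "spectral_inequality \<omega> lam \<Phi> \<sigma> C1" and \<omega>: "\<omega> \<in> sets lebesgue"
  shows "approximate_observability \<Omega> \<omega> D P \<sigma>
    (2 + C1 + C1 * C1 powr (\<sigma> / (1 - \<sigma>)) + C1 powr (1 / \<sigma>) * (5 + C1))"
proof (rule approximate_observabilityI[OF es])
  interpret eigen_system "L2_on \<Omega>" D P lam \<Phi> by (rule es)
  fix \<epsilon> t :: real and u
  assume pos: "0 < \<epsilon>" "0 < t" and u: "evolution D P u" "u 0 \<in> L2_on \<Omega>"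
    and v: "0 < norm (u t)" "norm (u t) \<le> norm (u 0)" "\<epsilon> * (norm (u 0))\<^sup>2 < (norm (u t))\<^sup>2"
  define \<beta> where "\<beta> = \<sigma> / (1 - \<sigma>)"
  define C3 where "C3 = 2 + C1 + C1 * C1 powr \<beta> + C1 powr (1 / \<sigma>) * (5 + C1)"
  define L where "L = ln (exp 1 + 1 / \<epsilon>)"
  define q where "q = (1 / t) powr \<beta>"
  define W where "W = norm_on \<omega> (u t)"
  define N where "N = norm (u 0)"
  \<comment> \<open>The solution of \<open>C1 * \<Lambda>0 powr \<sigma> = t * \<Lambda>0\<close>.
    Above it half of the exponent \<open>2 * \<Lambda> * t\<close> of
    \<open>1 / \<delta>\<^sup>2\<close> pays for the growth of \<open>M\<close>.\<close>
  define \<Lambda>0 where "\<Lambda>0 = (C1 / t) powr (1 / (1 - \<sigma>))"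
  \<comment> \<open>The other half is at least \<open>(5 + C1) * L\<close>. As
    \<open>1 \<le> L\<close>, this covers the constants 4 and \<open>C1\<close> of the exponent and
    leaves \<open>L\<close>, which turns into \<epsilon>.\<close>
  define \<Lambda> where "\<Lambda> = \<Lambda>0 + (5 + C1) * L / t"
  define M where "M = exp (C1 * (1 + \<Lambda> powr \<sigma>))"
  define \<delta> where "\<delta> = exp (- \<Lambda> * t)"
  define w where "w = (\<Sum>j | lam j \<le> \<Lambda>. inner (u t) (\<Phi> j) *\<^sub>R \<Phi> j)"
  have L: "1 \<le> L"
    unfolding L_def by (rule one_le_ln_exp_add[OF pos(1)])
  have \<Lambda>0: "0 < \<Lambda>0" using pos \<open>0 < C1\<close> by (simp add: \<Lambda>0_def)
  have \<Lambda>1: "0 < (5 + C1) * L / t" using pos \<open>0 < C1\<close> L by simp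
  have \<Lambda>: "0 < \<Lambda>" using \<Lambda>0 \<Lambda>1 by (simp add: \<Lambda>_def)
  have M: "1 \<le> M" using \<open>0 < C1\<close> by (simp add: M_def)
  have W: "W = norm (ext_zero \<omega> (u t))"
    by (simp add: W_def norm_on_eq[OF \<omega>])
  have utH: "u t \<in> L2_on \<Omega>"
    by (rule evolution_in_H[OF u(1) pos(2)])
  have wH: "w \<in> L2_on \<Omega>"
    unfolding w_def by (intro H_sum H_scale Phi_H)
  have high: "norm (u t - w) \<le> \<delta> * N"
    unfolding N_def
  proof (rule norm_le_coeffs)
    fix j
    have "inner (u t - w) (\<Phi> j) = (if lam j \<le> \<Lambda> then 0 else exp (- lam j * t) * inner (u 0) (\<Phi> j))"
      using pos inner_evolution[OF u(1), of t] by (simp add: w_def inner_diff_left inner_sum_Phi[OF finite_low])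
    moreover have "exp (- lam j * t) \<le> \<delta>" if "\<not> lam j \<le> \<Lambda>"
      using that pos by (simp add: \<delta>_def)
    ultimately show "\<bar>inner (u t - w) (\<Phi> j)\<bar> \<le> \<delta> * \<bar>inner (u 0) (\<Phi> j)\<bar>"
      by (auto simp: abs_mult mult_right_mono \<delta>_def)
  qed (use utH wH H_diff in \<open>auto simp: \<delta>_def\<close>)
  have "(norm w)\<^sup>2 \<le> M * (norm_on \<omega> w)\<^sup>2"
    using spec \<Lambda> unfolding spectral_inequality_def M_def w_def
    by (simp add: norm_sum_Phi[OF finite_low])
  also have "\<dots> \<le> (sqrt M * (W + \<delta> * N))\<^sup>2"
  proof -
    have "norm (ext_zero \<omega> w) \<le> norm (ext_zero \<omega> (u t)) + norm (ext_zero \<omega> (u t - w))"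
      using norm_triangle_ineq4[of "ext_zero \<omega> (u t)" "ext_zero \<omega> (u t - w)"]
      by (simp add: linear_diff[OF linear_ext_zero])
    also have "\<dots> \<le> W + \<delta> * N"
      using high norm_ext_zero_le[of \<omega> "u t - w"] by (simp add: W)
    finally have "norm_on \<omega> w \<le> W + \<delta> * N"
      by (simp add: norm_on_eq[OF \<omega>])
    moreover have "0 \<le> norm_on \<omega> w"
      by (simp add: norm_on_eq[OF \<omega>])
    ultimately show ?thesis
      using M by (simp add: power_mult_distrib mult_left_mono power_mono)
  qed
  finally have low: "norm w \<le> sqrt M * (W + \<delta> * N)"
    by (rule power2_le_imp_le) (use M in \<open>auto simp: W N_def \<delta>_def\<close>)
  have "norm (u t) \<le> norm w + norm (u t - w)"
    using norm_triangle_ineq[of w "u t - w"] by simp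
  also have "\<dots> \<le> sqrt M * (W + \<delta> * N) + sqrt M * (\<delta> * N)"
  proof -
    have "1 * (\<delta> * N) \<le> sqrt M * (\<delta> * N)"
      using M by (intro mult_right_mono) (auto simp: \<delta>_def N_def)
    then show ?thesis using low high by linarith
  qed
  also have "\<dots> = sqrt M * W + sqrt M * (2 * \<delta> * N)"
    by (simp add: algebra_simps)
  finally have "(norm (u t))\<^sup>2 \<le> (sqrt M * W + sqrt M * (2 * \<delta> * N))\<^sup>2"
    by (intro power_mono) auto
  also have "\<dots> \<le> 2 * (sqrt M * W)\<^sup>2 + 2 * (sqrt M * (2 * \<delta> * N))\<^sup>2"
    using sum_squares_bound[of "sqrt M * W" "sqrt M * (2 * \<delta> * N)"] by (simp add: power2_sum)
  also have "\<dots> = 2 * M * W\<^sup>2 + 8 * M * \<delta>\<^sup>2 * N\<^sup>2"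
    using M by (simp add: power_mult_distrib)
  finally have main: "(norm (u t))\<^sup>2 \<le> 2 * M * W\<^sup>2 + 8 * M * \<delta>\<^sup>2 * N\<^sup>2" .
  show "(norm (u t))\<^sup>2
       \<le> exp ((2 + C1 + C1 * C1 powr (\<sigma> / (1 - \<sigma>)) + C1 powr (1 / \<sigma>) * (5 + C1)) *
              (1 + (1 / t) powr (\<sigma> / (1 - \<sigma>)))) *
         exp (((2 + C1 + C1 * C1 powr (\<sigma> / (1 - \<sigma>)) + C1 powr (1 / \<sigma>) * (5 + C1)) / t *
               ln (exp 1 + 1 / \<epsilon>)) powr \<sigma>) * (norm_on \<omega> (u t))\<^sup>2"
  proof -
    have "(C1 / t) powr 1 = \<Lambda>0 powr (1 - \<sigma>)"
      unfolding \<Lambda>0_def powr_powr using \<sigma> by simp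
    also have "\<dots> \<le> \<Lambda> powr (1 - \<sigma>)"
      using \<Lambda>0 \<Lambda>1 \<sigma> by (intro powr_mono2) (auto simp: \<Lambda>_def)
    finally have "C1 \<le> t * \<Lambda> powr (1 - \<sigma>)"
      using pos \<open>0 < C1\<close> by (simp add: field_simps)
    then have "C1 * \<Lambda> powr \<sigma> \<le> t * \<Lambda> powr (1 - \<sigma>) * \<Lambda> powr \<sigma>"
      by (intro mult_right_mono) auto
    also have "\<dots> = t * \<Lambda>"
      using \<Lambda> by (simp add: mult.assoc flip: powr_add)
    finally have C1\<Lambda>: "C1 * \<Lambda> powr \<sigma> \<le> t * \<Lambda>" .
    have "(5 + C1) * L \<le> t * \<Lambda>"
    proof -
      have "t * \<Lambda> = t * \<Lambda>0 + (5 + C1) * L"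
        using pos by (simp add: \<Lambda>_def distrib_left)
      then show ?thesis
        using \<Lambda>0 pos by simp
    qed
    moreover have "(4 + C1) * 1 + L \<le> (5 + C1) * L"
      using L \<open>0 < C1\<close> mult_left_mono[of 1 L "4 + C1"] by (simp add: algebra_simps)
    ultimately have exponent: "4 + (C1 * (1 + \<Lambda> powr \<sigma>) + 2 * (- \<Lambda> * t)) \<le> - L"
      using C1\<Lambda> by (simp add: algebra_simps)
    have two: "(2::real) \<le> exp 1"
      using exp_ge_add_one_self[of 1] by simp
    have "(16::real) \<le> exp 1 ^ 4"
      using power_mono[OF two, of 4] by simp
    also have "\<dots> = exp 4"
      by (simp flip: exp_of_nat_mult)
    finally have "16 * (M * \<delta>\<^sup>2) \<le> exp 4 * (M * \<delta>\<^sup>2)"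
      using M by (intro mult_right_mono) auto
    also have "\<dots> = exp (4 + (C1 * (1 + \<Lambda> powr \<sigma>) + 2 * (- \<Lambda> * t)))"
      unfolding M_def \<delta>_def by (simp only: exp_add exp_double)
    also have "\<dots> \<le> exp (- L)"
      using exponent by simp
    also have "\<dots> = 1 / (exp 1 + 1 / \<epsilon>)"
      using pos by (simp add: L_def exp_minus add_pos_pos inverse_eq_divide)
    also have "\<dots> \<le> 1 / (1 / \<epsilon>)"
      using pos by (intro divide_left_mono mult_pos_pos add_pos_pos) auto
    finally have "16 * (M * \<delta>\<^sup>2) * N\<^sup>2 \<le> \<epsilon> * N\<^sup>2"
      by (intro mult_right_mono) auto
    \<comment> \<open>The tail term \<open>8 * M * \<delta>\<^sup>2 * N\<^sup>2\<close> is at most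
      half of \<open>\<epsilon> * N\<^sup>2\<close>, hence less than half of the left-hand side, and
      is absorbed there.\<close>
    then have "(norm (u t))\<^sup>2 \<le> 4 * (M * W\<^sup>2)"
      using main v(3) by (simp add: N_def)
    also have "4 * (M * W\<^sup>2) \<le> exp 2 * (M * W\<^sup>2)"
    proof (rule mult_right_mono)
      show "(4::real) \<le> exp 2"
        using power_mono[OF two, of 2] by (simp flip: exp_double)
    qed (use M in simp)
    also have "\<dots> = exp (2 + C1 * (1 + \<Lambda> powr \<sigma>)) * W\<^sup>2"
      by (simp add: M_def exp_add)
    also have "\<dots> \<le> exp (C3 * (1 + q) + (C3 / t * L) powr \<sigma>) * W\<^sup>2"
    proof -
      have "\<Lambda> powr \<sigma> \<le> \<Lambda>0 powr \<sigma> + ((5 + C1) * L / t) powr \<sigma>"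
        unfolding \<Lambda>_def using \<Lambda>0 \<Lambda>1 \<sigma> by (intro powr_add_le) auto
      also have "\<Lambda>0 powr \<sigma> = C1 powr \<beta> * q"
        unfolding \<Lambda>0_def powr_powr \<beta>_def q_def using pos \<open>0 < C1\<close>
        by (simp flip: powr_mult)
      finally have "C1 * \<Lambda> powr \<sigma> \<le> C1 * (C1 powr \<beta> * q) + C1 * ((5 + C1) * L / t) powr \<sigma>"
        using \<open>0 < C1\<close> by (metis distrib_left less_imp_le mult_left_mono)
      moreover have "C1 * ((5 + C1) * L / t) powr \<sigma> = (C1 powr (1 / \<sigma>) * ((5 + C1) * L / t)) powr \<sigma>"
        using \<open>0 < C1\<close> \<Lambda>1 \<sigma> by (intro mult_powr_absorb) auto
      moreover have "\<dots> \<le> (C3 / t * L) powr \<sigma>"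
      proof (rule powr_mono2)
        have "C1 powr (1 / \<sigma>) * (5 + C1) \<le> C3"
          using \<open>0 < C1\<close> by (simp add: C3_def)
        then have "C1 powr (1 / \<sigma>) * (5 + C1) * (L / t) \<le> C3 * (L / t)"
          using L pos by (intro mult_right_mono) auto
        then show "C1 powr (1 / \<sigma>) * ((5 + C1) * L / t) \<le> C3 / t * L"
          by (simp add: mult.assoc)
        show "0 \<le> C1 powr (1 / \<sigma>) * ((5 + C1) * L / t)"
          by (rule mult_nonneg_nonneg) (use \<Lambda>1 in auto)
      qed (use \<sigma> in auto)
      moreover have "2 + C1 + C1 * (C1 powr \<beta> * q) \<le> C3 * (1 + q)"
      proof -
        have "C1 * C1 powr \<beta> * q \<le> C3 * q"
          using \<open>0 < C1\<close> by (intro mult_right_mono) (auto simp: C3_def q_def)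
        moreover have "2 + C1 \<le> C3"
          using \<open>0 < C1\<close> by (simp add: C3_def)
        ultimately show ?thesis
          by (simp add: algebra_simps)
      qed
      ultimately have "2 + C1 * (1 + \<Lambda> powr \<sigma>) \<le> C3 * (1 + q) + (C3 / t * L) powr \<sigma>"
        by (simp add: algebra_simps)
      then show ?thesis
        by (intro mult_right_mono) auto
    qed
    finally show ?thesis
      by (simp add: C3_def q_def L_def W_def \<beta>_def exp_add)
  qed
qed

section \<open>Decay of the controlled solution\<close>

lemma eventually_sublinear:
  fixes A B E \<sigma> k :: real
  assumes "\<sigma> < 1" "0 < k"
  shows "eventually (\<lambda>x. A + B * ln x + E * x powr \<sigma> \<le> k * x) at_top"
proof -
  have "((\<lambda>x. A * inverse x + B * (ln x / x) + E * x powr (\<sigma> - 1)) \<longlongrightarrow> A * 0 + B * 0 + E * 0) at_top"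
    using assms(1) by (intro tendsto_add tendsto_mult tendsto_const tendsto_neg_powr
        filterlim_ident tendsto_inverse_0_at_top ln_x_over_x_tendsto_0) auto
  then have "eventually (\<lambda>x. A * inverse x + B * (ln x / x) + E * x powr (\<sigma> - 1) < k) at_top"
    using assms(2) by (intro order_tendstoD(2)) auto
  moreover have "eventually (\<lambda>x::real. x > 0) at_top"
    by (rule eventually_gt_at_top)
  ultimately show ?thesis
  proof eventually_elim
    case (elim x)
    have "A + B * ln x + E * x powr \<sigma> = (A * inverse x + B * (ln x / x) + E * x powr (\<sigma> - 1)) * x"
      using elim(2) by (simp add: distrib_right powr_diff inverse_eq_divide)
    also have "\<dots> \<le> k * x"
      using elim by (intro mult_right_mono) auto
    finally show ?case .
  qed
qed

text \<open>With \<open>X = 2 powr (\<beta> * real m)\<close> and \<open>Y = 2 ^ m\<close> one has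
  \<open>(X * Y) powr \<sigma> = X\<close>, so every term in the exponent is at most
  \<open>X\<close> times a coefficient free of \<open>m\<close>. These coefficients grow sublinearly
  in \<eta>, and therefore one \<eta> serves all \<open>m\<close>. \<open>N\<close> stands for the
  eigenvalue count below the cutoff.\<close>

lemma cost_bound:
  fixes \<sigma> T C3 c \<rho> l0 \<beta> :: real
  assumes \<sigma>: "0 < \<sigma>" "\<sigma> < 1" and \<beta>: "\<beta> = \<sigma> / (1 - \<sigma>)"
    and pos: "0 < T" "0 < C3" "0 < c" "0 < \<rho>" "0 < l0"
  obtains \<eta> where "4 \<le> \<eta>"
    "\<And>(m::nat) N. \<lbrakk>1 \<le> N; N \<le> c * (l0 + 2 * \<eta> / T * 2 powr ((\<beta> + 1) * real m)) powr (1 / \<rho>)\<rbrakk> \<Longrightarrow>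
       N * (exp (C3 * (1 + (4 * 2 ^ m / T) powr \<beta>)) *
         exp ((4 * C3 * 2 ^ m / T * ln (exp 1 + exp (\<eta> * 2 powr (\<beta> * real m)) * N)) powr \<sigma>))
       \<le> exp (\<eta> / 4 * 2 powr (- \<beta>) * 2 powr (\<beta> * real m))"
proof -
  have \<beta>0: "0 < \<beta>" using \<sigma> by (simp add: \<beta>)
  \<comment> \<open>\<open>A\<close> collects the part of \<open>ln N\<close> that does not involve
    \<eta>; the term \<open>1 + 1 / \<beta>\<close> comes from \<open>ln (X * Y)\<close>. The final
    2 is reserved for the estimate of the logarithm in the cost by
    \<open>2 + \<eta> * X + ln N\<close>.\<close>
  define A where "A = \<bar>ln c\<bar> + (\<bar>ln (l0 + 2 / T)\<bar> + 1 + 1 / \<beta>) / \<rho> + 2"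
  define B where "B = 1 / \<rho>"
  define E where "E = (4 * C3 / T * (1 + A + B)) powr \<sigma>"
  define k where "k = 2 powr (- \<beta>) / 4"
  have A: "0 \<le> A" using pos \<beta>0 by (simp add: A_def)
  have B: "0 \<le> B" using pos by (simp add: B_def)
  have "eventually (\<lambda>x. A + C3 * (1 + (4 / T) powr \<beta>) + B * ln x + E * x powr \<sigma> \<le> k * x \<and> 4 \<le> x) at_top"
    using \<sigma> by (intro eventually_conj eventually_sublinear eventually_ge_at_top) (auto simp: k_def)
  then obtain \<eta> where \<eta>: "4 \<le> \<eta>"
      "A + C3 * (1 + (4 / T) powr \<beta>) + B * ln \<eta> + E * \<eta> powr \<sigma> \<le> k * \<eta>"
    by (auto simp: eventually_at_top_linorder)
  show thesis
  proof (rule that[OF \<eta>(1)])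
    fix m :: nat and N :: real
    assume N: "1 \<le> N" "N \<le> c * (l0 + 2 * \<eta> / T * 2 powr ((\<beta> + 1) * real m)) powr (1 / \<rho>)"
    define X where "X = 2 powr (\<beta> * real m)"
    define Y where "Y = (2::real) ^ m"
    have Y: "1 \<le> Y" by (simp add: Y_def)
    have Yp: "Y = 2 powr real m" by (simp add: Y_def powr_realpow)
    have X: "1 \<le> X" using \<beta>0 by (simp add: X_def ge_one_powr_ge_zero)
    have XY: "2 powr ((\<beta> + 1) * real m) = X * Y"
      by (simp add: X_def Yp distrib_right powr_add)
    have Y\<beta>: "Y powr \<beta> = X"
      by (simp add: X_def Yp powr_powr mult.commute)
    have XY\<sigma>: "(X * Y) powr \<sigma> = X"
    proof -
      have "(\<beta> + 1) * \<sigma> = \<beta>"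
        using \<sigma> by (simp add: \<beta> field_simps)
      then have "(\<beta> + 1) * real m * \<sigma> = \<beta> * real m"
        by (metis mult.assoc mult.commute)
      then show ?thesis
        unfolding XY[symmetric] powr_powr by (simp only: X_def)
    qed
    have lnX: "0 \<le> ln X" "ln X \<le> X"
      using X ln_le_minus_one[of X] by auto
    have lnY: "ln Y = ln X / \<beta>"
      using \<beta>0 by (simp add: X_def Yp ln_powr)
    have ln\<eta>: "0 \<le> ln \<eta>" "ln \<eta> \<le> \<eta>"
      using \<eta> ln_le_minus_one[of \<eta>] by auto
    have ll: "0 < l0 + 2 / T" using pos by (simp add: add_pos_pos)
    have "l0 + 2 * \<eta> / T * (X * Y) \<le> (l0 + 2 / T) * \<eta> * (X * Y)"
    proof -
      have "1 * 1 \<le> \<eta> * (X * Y)"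
        using \<eta> X Y mult_mono[OF X Y] by (intro mult_mono) auto
      then have "l0 * 1 \<le> l0 * (\<eta> * (X * Y))"
        using pos by (intro mult_left_mono) auto
      then show ?thesis by (simp add: algebra_simps)
    qed
    then have "(l0 + 2 * \<eta> / T * (X * Y)) powr (1 / \<rho>) \<le> ((l0 + 2 / T) * \<eta> * (X * Y)) powr (1 / \<rho>)"
      using pos \<eta> X Y by (intro powr_mono2) auto
    then have "N \<le> c * ((l0 + 2 / T) * \<eta> * (X * Y)) powr (1 / \<rho>)"
      using N(2) pos unfolding XY by (meson less_imp_le mult_left_mono order_trans)
    then have "ln N \<le> ln (c * ((l0 + 2 / T) * \<eta> * (X * Y)) powr (1 / \<rho>))"
      using N(1) by (intro ln_mono) auto
    also have "\<dots> = ln c + (ln (l0 + 2 / T) + ln \<eta> + ln X + ln Y) / \<rho>"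
      using pos ll \<eta> X Y by (simp add: ln_mult ln_powr)
    also have "\<dots> = ln c + (ln (l0 + 2 / T) + (1 + 1 / \<beta>) * ln X) / \<rho> + B * ln \<eta>"
      by (simp add: lnY B_def algebra_simps add_divide_distrib)
    also have "\<dots> \<le> \<bar>ln c\<bar> * X + (\<bar>ln (l0 + 2 / T)\<bar> * X + (1 + 1 / \<beta>) * X) / \<rho> + B * ln \<eta> * X"
    proof -
      have 1: "x \<le> \<bar>x\<bar> * X" for x
        using mult_left_mono[OF X, of "\<bar>x\<bar>"] by simp
      have "(1 + 1 / \<beta>) * ln X \<le> (1 + 1 / \<beta>) * X"
        using lnX \<beta>0 by (intro mult_left_mono) auto
      moreover have "B * ln \<eta> \<le> B * ln \<eta> * X"
        using 1[of "B * ln \<eta>"] B ln\<eta> by simp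
      ultimately show ?thesis
        using pos by (intro add_mono divide_right_mono 1) auto
    qed
    also have "\<dots> = (A - 2 + B * ln \<eta>) * X"
      by (simp add: A_def algebra_simps add_divide_distrib)
    finally have lnN: "ln N \<le> (A - 2 + B * ln \<eta>) * X" .
    have "ln (exp 1 + exp (\<eta> * X) * N) \<le> ln (exp 2 * (exp (\<eta> * X) * N))"
    proof (rule ln_mono)
      have "1 * 1 \<le> exp (\<eta> * X) * N"
        using N \<eta> X by (intro mult_mono) auto
      moreover have "(2::real) \<le> exp 1"
        using exp_ge_add_one_self[of 1] by simp
      then have "exp 1 + 1 \<le> exp (2::real)"
        using mult_mono[of 2 "exp 1" "exp 1" "exp (1::real)"] by (simp flip: exp_add)
      ultimately have "(exp 1 + 1) * (exp (\<eta> * X) * N) \<le> exp 2 * (exp (\<eta> * X) * N)"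
        "exp 1 * 1 \<le> exp 1 * (exp (\<eta> * X) * N)"
        by (intro mult_right_mono mult_left_mono; simp)+
      then show "exp 1 + exp (\<eta> * X) * N \<le> exp 2 * (exp (\<eta> * X) * N)"
        unfolding distrib_right by linarith
      show "0 < exp 1 + exp (\<eta> * X) * N"
        using N by (intro add_pos_pos mult_pos_pos) auto
    qed
    also have "\<dots> = 2 + \<eta> * X + ln N"
      using N by (simp add: ln_mult)
    also have "\<dots> \<le> 2 * X + \<eta> * X + (A - 2 + B * ln \<eta>) * X"
      using lnN X by simp
    also have "\<dots> = (\<eta> + A + B * ln \<eta>) * X"
      by (simp add: algebra_simps)
    also have "\<dots> \<le> ((1 + A + B) * \<eta>) * X"
    proof (rule mult_right_mono)
      have "A * 1 \<le> A * \<eta>" "B * ln \<eta> \<le> B * \<eta>"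
        using A B \<eta> ln\<eta> by (intro mult_left_mono; simp)+
      then show "\<eta> + A + B * ln \<eta> \<le> (1 + A + B) * \<eta>"
        by (simp add: algebra_simps)
    qed (use X in simp)
    finally have lnle: "ln (exp 1 + exp (\<eta> * X) * N) \<le> (1 + A + B) * \<eta> * X" .
    have ln0: "0 \<le> ln (exp 1 + exp (\<eta> * X) * N)"
    proof -
      have "0 \<le> exp (\<eta> * X) * N" "(1::real) \<le> exp 1" using N by auto
      then have "1 \<le> exp 1 + exp (\<eta> * X) * N" by linarith
      then show ?thesis by simp
    qed
    have "(4 * C3 * Y / T * ln (exp 1 + exp (\<eta> * X) * N)) powr \<sigma>
        \<le> (4 * C3 * Y / T * ((1 + A + B) * \<eta> * X)) powr \<sigma>"
      using ln0 lnle pos Y \<sigma> by (intro powr_mono2 mult_left_mono mult_nonneg_nonneg) auto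
    also have "4 * C3 * Y / T * ((1 + A + B) * \<eta> * X) = (4 * C3 / T * (1 + A + B)) * \<eta> * (X * Y)"
      by simp
    also have "\<dots> powr \<sigma> = E * \<eta> powr \<sigma> * X"
      unfolding E_def by (subst powr_mult, subst powr_mult) (simp only: XY\<sigma>)
    finally have e2: "(4 * C3 * Y / T * ln (exp 1 + exp (\<eta> * X) * N)) powr \<sigma> \<le> E * \<eta> powr \<sigma> * X" .
    have e1: "C3 * (1 + (4 * Y / T) powr \<beta>) \<le> C3 * (1 + (4 / T) powr \<beta>) * X"
    proof -
      have "(4 * Y / T) powr \<beta> = (4 / T * Y) powr \<beta>" by simp
      also have "\<dots> = (4 / T) powr \<beta> * X"
        by (simp only: powr_mult Y\<beta>)
      finally have "1 + (4 * Y / T) powr \<beta> \<le> (1 + (4 / T) powr \<beta>) * X"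
        using X by (simp add: distrib_right)
      then show ?thesis
        using pos by (simp add: mult.assoc)
    qed
    have "ln N + (C3 * (1 + (4 * Y / T) powr \<beta>) + (4 * C3 * Y / T * ln (exp 1 + exp (\<eta> * X) * N)) powr \<sigma>)
       \<le> (A + C3 * (1 + (4 / T) powr \<beta>) + B * ln \<eta> + E * \<eta> powr \<sigma>) * X"
      using lnN e1 e2 X by (simp add: algebra_simps)
    also have "\<dots> \<le> k * \<eta> * X"
      using \<eta>(2) X by (intro mult_right_mono) auto
    also have "\<dots> = \<eta> / 4 * 2 powr (- \<beta>) * X"
      by (simp add: k_def)
    finally have "exp (ln N + (C3 * (1 + (4 * Y / T) powr \<beta>) +
        (4 * C3 * Y / T * ln (exp 1 + exp (\<eta> * X) * N)) powr \<sigma>)) \<le> exp (\<eta> / 4 * 2 powr (- \<beta>) * X)"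
      by simp
    then show "N * (exp (C3 * (1 + (4 * 2 ^ m / T) powr \<beta>)) *
         exp ((4 * C3 * 2 ^ m / T * ln (exp 1 + exp (\<eta> * 2 powr (\<beta> * real m)) * N)) powr \<sigma>))
       \<le> exp (\<eta> / 4 * 2 powr (- \<beta>) * 2 powr (\<beta> * real m))"
      using N by (simp add: exp_add flip: X_def Y_def)
  qed
qed

section \<open>The geometric time grid\<close>

lemma grid_time_Suc_diff: "grid_time T b (Suc m) - grid_time T b m = T * (1 - inverse b) / b ^ m"
  by (simp add: grid_time_def divide_inverse algebra_simps)

lemma
  assumes "0 < T" "1 < b"
  shows grid_time_less_impulse_time: "grid_time T b m < impulse_time T b m"
    and impulse_time_less_grid_time: "impulse_time T b m < grid_time T b (Suc m)"
proof -
  have "0 < T * (1 - inverse b) / b ^ m"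
    using assms by (simp add: inverse_less_1_iff)
  then have "grid_time T b m < grid_time T b (Suc m)"
    by (simp flip: grid_time_Suc_diff)
  then show "grid_time T b m < impulse_time T b m" "impulse_time T b m < grid_time T b (Suc m)"
    by (simp_all add: impulse_time_def)
qed

lemma grid_time_mono:
  assumes "0 < T" "1 < b" "m \<le> n"
  shows "grid_time T b m \<le> grid_time T b n"
  using assms by (simp add: grid_time_def inverse_le_iff_le power_increasing)

lemma impulse_time_in_grid:
  assumes "0 < T" "1 < b" "impulse_time T b k \<in> {grid_time T b m..grid_time T b (Suc m)}"
  shows "k = m"
proof (rule ccontr)
  assume "k \<noteq> m"
  then consider "Suc k \<le> m" | "Suc m \<le> k" by linarith
  then show False
    using assms grid_time_mono[OF assms(1,2)] grid_time_less_impulse_time[OF assms(1,2), of k]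
      impulse_time_less_grid_time[OF assms(1,2), of k]
    by cases (fastforce dest: grid_time_mono[OF assms(1,2)])+
qed

lemma grid_time_interval:
  assumes "0 < T" "1 < b" "0 \<le> t" "t < T"
  obtains m where "grid_time T b m \<le> t" "t < grid_time T b (Suc m)"
proof -
  \<comment> \<open>For \<open>t\<close> below \<open>T\<close> this inequality is a rearrangement
    of \<open>t < grid_time T b n\<close>.\<close>
  obtain n where "T / (T - t) < b ^ n"
    using real_arch_pow[OF \<open>1 < b\<close>] by blast
  moreover have "0 < b ^ n" using assms by simp
  ultimately have "t < grid_time T b n"
    using assms by (simp add: grid_time_def field_simps)
  moreover have "\<not> t < grid_time T b 0"
    using assms by (simp add: grid_time_def)
  ultimately obtain m where "\<not> t < grid_time T b m" "t < grid_time T b (Suc m)"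
    using ex_least_nat_less[of "\<lambda>n. t < grid_time T b n" n] by auto
  then show ?thesis
    by (intro that) simp_all
qed

text \<open>The impulse sits at the midpoint, so both legs have the same length \<tau> and
  \<open>approximate_control\<close> applies with (iii) at time \<tau>. Its parameters \<kappa> and
  \<epsilon> are the two bounds required of the control.\<close>

lemma impulse_control_exists:
  assumes ces: "compact_eigen_system (L2_on \<Omega>) D P lam \<Phi>"
    and obs: "approximate_observability \<Omega> \<omega> D P \<sigma> C3"
    and \<omega>: "\<omega> \<in> sets lebesgue" "\<omega> \<subseteq> \<Omega>" and T: "0 < T" and b: "1 < b" and "0 < \<eta>"
  shows "\<exists>g. impulse_control \<omega> D P lam \<Phi> \<sigma> C3 T b \<eta> m j g"
proof -
  interpret compact_eigen_system "L2_on \<Omega>" D P lam \<Phi> by (rule ces)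
  define \<beta> where "\<beta> = \<sigma> / (1 - \<sigma>)"
  define N where "N = real (eigen_count lam (cutoff lam \<sigma> T b \<eta> m))"
  define t0 where "t0 = grid_time T b m"
  define t1 where "t1 = grid_time T b (Suc m)"
  define s where "s = impulse_time T b m"
  define \<tau> where "\<tau> = (t1 - t0) / 2"
  define \<epsilon> where "\<epsilon> = exp (- \<eta> * b powr (\<beta> * real m)) / N"
  define \<kappa> where "\<kappa> = exp (C3 * (1 + (1 / \<tau>) powr \<beta>)) * exp ((C3 / \<tau> * ln (exp 1 + 1 / \<epsilon>)) powr \<sigma>)"
  have s: "t0 < s" "s < t1"
    unfolding t0_def t1_def s_def
    using T b by (rule grid_time_less_impulse_time impulse_time_less_grid_time)+
  have st: "s - t0 = \<tau>" "t1 - s = \<tau>"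
    by (simp_all add: s_def t0_def t1_def \<tau>_def impulse_time_def field_simps)
  have "0 < \<tau>" using s st by simp
  \<comment> \<open>The summand \<open>lam 0\<close> of the cutoff makes the count \<open>N\<close>
    positive. For \<open>N = 0\<close> the quotient \<epsilon> would be 0.\<close>
  have "lam 0 \<le> cutoff lam \<sigma> T b \<eta> m"
    using T b \<open>0 < \<eta>\<close> by (simp add: cutoff_def)
  then have "0 < N"
    using finite_low by (auto simp: N_def eigen_count_def card_gt_0_iff)
  then have "0 < \<epsilon>" by (simp add: \<epsilon>_def)
  have \<epsilon>inv: "1 / \<epsilon> = exp (\<eta> * b powr (\<beta> * real m)) * N"
    by (simp add: \<epsilon>_def exp_minus divide_inverse)
  have "\<exists>g\<in>L2_on \<Omega>. (norm (ext_zero \<omega> g))\<^sup>2 \<le> \<kappa> \<and>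
      (norm (semigroup \<tau> (semigroup \<tau> (\<Phi> j) + ext_zero \<omega> g)))\<^sup>2 \<le> \<epsilon>"
  proof (rule approximate_control)
    show "linear (ext_zero \<omega>)" by (rule linear_ext_zero)
    show "inner (ext_zero \<omega> x) y = inner x (ext_zero \<omega> y)" for x y by (rule inner_ext_zero)
    show "ext_zero \<omega> (ext_zero \<omega> x) = ext_zero \<omega> x" for x by (rule ext_zero_idem)
    show "ext_zero \<omega> x \<in> L2_on \<Omega>" for x using \<omega>(2) by (rule ext_zero_in_L2_on)
    show "0 < \<kappa>" by (simp add: \<kappa>_def)
    show "(norm (semigroup \<tau> x))\<^sup>2 \<le> \<kappa> * (norm (ext_zero \<omega> (semigroup \<tau> x)))\<^sup>2 + \<epsilon> * (norm x)\<^sup>2"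
      if "x \<in> L2_on \<Omega>" for x
    proof -
      have "evolution D P (\<lambda>t. semigroup t x) \<and> semigroup 0 x \<in> L2_on \<Omega>"
        using that evolution_semigroup by simp
      from obs[unfolded approximate_observability_def, rule_format, OF \<open>0 < \<epsilon>\<close> \<open>0 < \<tau>\<close> this]
      show ?thesis
        by (simp add: \<kappa>_def \<beta>_def norm_on_eq[OF \<omega>(1)])
    qed
  qed fact+
  then obtain g where g: "g \<in> L2_on \<Omega>" "(norm (ext_zero \<omega> g))\<^sup>2 \<le> \<kappa>"
      "(norm (semigroup \<tau> (semigroup \<tau> (\<Phi> j) + ext_zero \<omega> g)))\<^sup>2 \<le> \<epsilon>"
    by blast
  \<comment> \<open>\<open>g\<close> itself need not vanish outside \<omega>; only its restriction
    enters both estimates.\<close>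
  define f where "f = ext_zero \<omega> g"
  have ef: "ext_zero \<omega> f = f"
    by (simp add: f_def ext_zero_idem)
  have "f \<in> L2_on \<Omega>" "f \<in> L2_on \<omega>"
    unfolding f_def using \<omega>(2) by (auto intro: ext_zero_in_L2_on)
  obtain y where y: "impulsive_solution D P {t0..t1} {m} (impulse_time T b) (\<lambda>_. f) y" "y t0 = \<Phi> j"
      "y t1 = semigroup \<tau> (semigroup \<tau> (\<Phi> j) + f)"
    using impulsive_step_exists[OF Phi_H[of j] \<open>f \<in> L2_on \<Omega>\<close>, of t0 "impulse_time T b" m t1] s st
    unfolding s_def by auto
  have "(norm (y t1))\<^sup>2 \<le> \<epsilon>"
    using g(3) by (simp add: y(3) f_def)
  moreover have "(norm_on \<omega> f)\<^sup>2 \<le> exp (C3 * (1 + (2 / (t1 - t0)) powr \<beta>)) *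
      exp ((2 * C3 / (t1 - t0) * ln (exp 1 + exp (\<eta> * b powr (\<beta> * real m)) * N)) powr \<sigma>)"
  proof -
    have "2 / (t1 - t0) = 1 / \<tau>" "2 * C3 / (t1 - t0) = C3 / \<tau>"
      by (simp_all add: \<tau>_def)
    then show ?thesis
      using g(2) by (simp add: norm_on_eq[OF \<omega>(1)] ef \<kappa>_def flip: f_def \<epsilon>inv)
  qed
  ultimately show ?thesis
    unfolding impulse_control_def Let_def
    using \<open>f \<in> L2_on \<omega>\<close> y(1,2) ef
    by (intro exI[of _ f]) (auto simp: \<epsilon>_def N_def \<beta>_def t0_def t1_def)
qed

section \<open>Damping on one interval and its iteration\<close>

context eigen_system
begin

text \<open>The cutoff is made so that its product with the length of the interval is at least
  \<open>\<eta> * X\<close>. The low and the high modes then contribute at most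
  \<open>exp (- (\<eta> * X) / 2)\<close> each. A further \<open>exp (\<eta> / 4 * X)\<close> is
  given away to absorb the factor 2; this is where \<open>4 \<le> \<eta>\<close> is used and where
  the quarter comes from.\<close>

lemma feedback_damping:
  fixes T \<eta> \<sigma> :: real
  defines "\<beta> \<equiv> \<sigma> / (1 - \<sigma>)"
  assumes \<sigma>: "0 < \<sigma>" "\<sigma> < 1" and T: "0 < T" and \<eta>: "4 \<le> \<eta>"
    and z: "impulsive_solution D P {t0..t1} {m} s J z" and s: "t0 < s m" "s m < t1"
    and t01: "t1 - t0 = T / (2 * 2 ^ m)"
    and y: "\<And>j. lam j \<le> cutoff lam \<sigma> T 2 \<eta> m \<Longrightarrow>
        \<exists>y. impulsive_solution D P {t0..t1} {m} s (\<lambda>_. g j) y \<and> y t0 = \<Phi> j \<and>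
          (norm (y t1))\<^sup>2 \<le> exp (- \<eta> * 2 powr (\<beta> * real m))
             / real (eigen_count lam (cutoff lam \<sigma> T 2 \<eta> m))"
    and J: "J m = (\<Sum>j | lam j \<le> cutoff lam \<sigma> T 2 \<eta> m. inner (z t0) (\<Phi> j) *\<^sub>R g j)"
  shows "norm (z t1) \<le> exp (- (\<eta> / 4) * 2 powr (\<beta> * real m)) * norm (z t0)"
proof -
  define X where "X = 2 powr (\<beta> * real m)"
  define \<Lambda> where "\<Lambda> = cutoff lam \<sigma> T 2 \<eta> m"
  have "0 < \<beta>" using \<sigma> by (simp add: \<beta>_def)
  then have X: "1 \<le> X" by (simp add: X_def ge_one_powr_ge_zero)
  have "\<forall>j. \<exists>y. lam j \<le> \<Lambda> \<longrightarrow> impulsive_solution D P {t0..t1} {m} s (\<lambda>_. g j) y \<and> y t0 = \<Phi> j \<and>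
          (norm (y t1))\<^sup>2 \<le> exp (- \<eta> * X) / real (card {i. lam i \<le> \<Lambda>})"
    using y unfolding \<Lambda>_def X_def eigen_count_def by blast
  then obtain yy where yy: "\<And>j. lam j \<le> \<Lambda> \<Longrightarrow> impulsive_solution D P {t0..t1} {m} s (\<lambda>_. g j) (yy j)"
      "\<And>j. lam j \<le> \<Lambda> \<Longrightarrow> yy j t0 = \<Phi> j"
      "\<And>j. lam j \<le> \<Lambda> \<Longrightarrow> (norm (yy j t1))\<^sup>2 \<le> exp (- \<eta> * X) / real (card {i. lam i \<le> \<Lambda>})"
    by metis
  have "norm (z t1) \<le> (sqrt (exp (- \<eta> * X)) + exp (- \<Lambda> * (t1 - t0))) * norm (z t0)"
    by (rule feedback_step[OF z s yy]) (use J in \<open>simp_all add: \<Lambda>_def\<close>)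
  also have "\<dots> \<le> exp (- (\<eta> / 4) * X) * norm (z t0)"
  proof (rule mult_right_mono)
    have "\<Lambda> = lam 0 + 2 * \<eta> / T * (X * 2 ^ m)"
      by (simp add: \<Lambda>_def cutoff_def X_def \<beta>_def distrib_right powr_add powr_realpow)
    then have "\<Lambda> * (t1 - t0) = lam 0 * (T / (2 * 2 ^ m)) + \<eta> * X"
      using T unfolding t01 by (simp add: field_simps)
    moreover have "0 \<le> lam 0 * (T / (2 * 2 ^ m))"
      using T lam_pos[of 0] by simp
    moreover have "0 \<le> \<eta> * X"
      using \<eta> X by (intro mult_nonneg_nonneg) auto
    ultimately have "- \<Lambda> * (t1 - t0) \<le> - (\<eta> * X) / 2"
      unfolding mult_minus_left by linarith
    then have "exp (- \<Lambda> * (t1 - t0)) \<le> exp (- (\<eta> * X) / 2)"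
      by simp
    moreover have "sqrt (exp (- \<eta> * X)) = exp (- (\<eta> * X) / 2)"
      by (rule real_sqrt_unique) (simp_all flip: exp_double)
    ultimately have "sqrt (exp (- \<eta> * X)) + exp (- \<Lambda> * (t1 - t0)) \<le> 2 * exp (- (\<eta> * X) / 2)"
      by simp
    also have "\<dots> \<le> exp (\<eta> / 4 * X) * exp (- (\<eta> * X) / 2)"
    proof (rule mult_right_mono)
      have "1 * 1 \<le> \<eta> / 4 * X"
        using \<eta> X by (intro mult_mono) auto
      then show "2 \<le> exp (\<eta> / 4 * X)"
        using exp_ge_add_one_self[of "\<eta> / 4 * X"] by linarith
    qed simp
    also have "\<dots> = exp (- (\<eta> / 4) * X)"
      by (simp flip: exp_add)
    finally show "sqrt (exp (- \<eta> * X)) + exp (- \<Lambda> * (t1 - t0)) \<le> exp (- (\<eta> / 4) * X)" .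
  qed simp
  finally show ?thesis
    by (simp add: X_def)
qed

end

text \<open>The rate \<gamma> shifts the index:
  \<open>\<gamma> * X (Suc m) = \<eta> / 4 * X m\<close>, so the damping of step \<open>m\<close>
  alone reproduces the bound at the next grid time. At \<open>m = 0\<close> no damping has occurred
  yet, and the factor \<open>exp (\<eta> / 4)\<close> makes up for it since
  \<open>\<gamma> \<le> \<eta> / 4\<close>.\<close>

lemma feedback_decay:
  fixes z :: "real \<Rightarrow> 'a::euclidean_space l2" and T \<eta> \<sigma> :: real
  defines "\<beta> \<equiv> \<sigma> / (1 - \<sigma>)" and "\<gamma> \<equiv> \<eta> / 4 * 2 powr (- (\<sigma> / (1 - \<sigma>)))"
  assumes es: "eigen_system (L2_on \<Omega>) D P lam \<Phi>"
    and \<sigma>: "0 < \<sigma>" "\<sigma> < 1" and T: "0 < T" and \<eta>: "4 \<le> \<eta>" and \<omega>: "\<omega> \<in> sets lebesgue"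
    and cost: "\<And>m. let N = real (eigen_count lam (cutoff lam \<sigma> T 2 \<eta> m)) in
       N * (exp (C3 * (1 + (4 * 2 ^ m / T) powr \<beta>)) *
         exp ((4 * C3 * 2 ^ m / T * ln (exp 1 + exp (\<eta> * 2 powr (\<beta> * real m)) * N)) powr \<sigma>))
       \<le> exp (\<gamma> * 2 powr (\<beta> * real m))"
    and fam: "impulse_control_family \<omega> D P lam \<Phi> \<sigma> C3 T 2 \<eta> f"
    and z: "impulsive_solution D P {0..<T} UNIV (impulse_time T 2)
       (\<lambda>m. ext_zero \<omega> (feedback lam \<Phi> \<sigma> T 2 \<eta> f m (z (grid_time T 2 m)))) z"
  shows "norm (z (grid_time T 2 m)) \<le> exp (\<eta> / 4 - \<gamma> * 2 powr (\<beta> * real m)) * norm (z 0)"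
    and "norm (ext_zero \<omega> (feedback lam \<Phi> \<sigma> T 2 \<eta> f m (z (grid_time T 2 m))))
       \<le> exp (\<eta> / 4 - \<gamma> / 2 * 2 powr (\<beta> * real m)) * norm (z 0)"
    and "\<lbrakk>grid_time T 2 m \<le> t; t \<le> grid_time T 2 (Suc m)\<rbrakk> \<Longrightarrow>
       norm (z t) \<le> 2 * exp (\<eta> / 4 - \<gamma> / 2 * 2 powr (\<beta> * real m)) * norm (z 0)"
proof -
  interpret eigen_system "L2_on \<Omega>" D P lam \<Phi> by (rule es)
  define X where "X m = 2 powr (\<beta> * real m)" for m
  define F where "F m = feedback lam \<Phi> \<sigma> T 2 \<eta> f m (z (grid_time T 2 m))" for m
  have "0 < \<beta>" using \<sigma> by (simp add: \<beta>_def)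
  then have X: "1 \<le> X m" for m by (simp add: X_def ge_one_powr_ge_zero)
  have \<gamma>: "0 < \<gamma>" "\<gamma> \<le> \<eta> / 4"
    using \<eta> \<open>0 < \<beta>\<close> powr_mono[of "- \<beta>" 0 2] by (auto simp: \<gamma>_def \<beta>_def intro!: mult_left_le)
  have X_Suc: "\<gamma> * X (Suc m) = \<eta> / 4 * X m" for m
  proof -
    have "2 powr (- \<beta>) * X (Suc m) = X m"
      by (simp add: X_def distrib_left flip: powr_add)
    then show ?thesis
      by (simp add: \<gamma>_def mult.assoc flip: \<beta>_def)
  qed
  have gd: "grid_time T 2 (Suc m) - grid_time T 2 m = T / (2 * 2 ^ m)" for m
    by (simp add: grid_time_Suc_diff)
  note s = grid_time_less_impulse_time[OF T, of 2] impulse_time_less_grid_time[OF T, of 2]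
  have zm: "impulsive_solution D P {grid_time T 2 m..grid_time T 2 (Suc m)} {m} (impulse_time T 2)
       (\<lambda>m. ext_zero \<omega> (F m)) z" for m
  proof (rule impulsive_solution_subinterval)
    show "impulsive_solution D P {0..<T} UNIV (impulse_time T 2) (\<lambda>m. ext_zero \<omega> (F m)) z"
      using z by (simp add: F_def)
    have "0 \<le> grid_time T 2 m"
      using grid_time_mono[OF T, of 2 0 m] by (simp add: grid_time_def)
    moreover have "grid_time T 2 (Suc m) < T"
      using T by (simp add: grid_time_def)
    ultimately show "{grid_time T 2 m..grid_time T 2 (Suc m)} \<subseteq> {0..<T}"
      by auto
    show "k = m" if "impulse_time T 2 k \<in> {grid_time T 2 m..grid_time T 2 (Suc m)}" for k
      using impulse_time_in_grid[OF T _ that] by simp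
  qed simp
  have ctrl: "impulse_control \<omega> D P lam \<Phi> \<sigma> C3 T 2 \<eta> m j (f m j)"
    if "lam j \<le> cutoff lam \<sigma> T 2 \<eta> m" for m j
    using fam that by (simp add: impulse_control_family_def)
  have step: "norm (z (grid_time T 2 (Suc m))) \<le> exp (- (\<eta> / 4) * X m) * norm (z (grid_time T 2 m))" for m
    unfolding X_def \<beta>_def
  proof (rule feedback_damping[OF \<sigma> T \<eta> zm s gd])
    show "ext_zero \<omega> (F m) = (\<Sum>j | lam j \<le> cutoff lam \<sigma> T 2 \<eta> m.
        inner (z (grid_time T 2 m)) (\<Phi> j) *\<^sub>R ext_zero \<omega> (f m j))"
      by (simp add: F_def feedback_def linear_sum[OF linear_ext_zero] linear_scale[OF linear_ext_zero])
  qed (use ctrl in \<open>auto simp: impulse_control_def Let_def\<close>)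
  show grid: "norm (z (grid_time T 2 m)) \<le> exp (\<eta> / 4 - \<gamma> * 2 powr (\<beta> * real m)) * norm (z 0)" for m
    unfolding X_def[symmetric]
  proof (induction m)
    case 0
    have "1 * norm (z 0) \<le> exp (\<eta> / 4 - \<gamma> * X 0) * norm (z 0)"
      using \<gamma> by (intro mult_right_mono) (auto simp: X_def)
    then show ?case by (simp add: grid_time_def)
  next
    case (Suc m)
    have "norm (z (grid_time T 2 (Suc m))) \<le> exp (- (\<eta> / 4) * X m) * (exp (\<eta> / 4 - \<gamma> * X m) * norm (z 0))"
      using step[of m] Suc by (meson exp_ge_zero mult_left_mono order_trans)
    also have "\<dots> = exp (\<eta> / 4 - \<gamma> * X m - \<eta> / 4 * X m) * norm (z 0)"
      by (simp flip: exp_add mult.assoc)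
    also have "\<dots> \<le> exp (\<eta> / 4 - \<gamma> * X (Suc m)) * norm (z 0)"
      using \<gamma> X[of m] by (intro mult_right_mono) (auto simp: X_Suc)
    finally show ?case .
  qed
  have F_le: "norm (ext_zero \<omega> (F m)) \<le> exp (\<eta> / 4 - \<gamma> / 2 * X m) * norm (z 0)" for m
  proof -
    define A where "A = {j. lam j \<le> cutoff lam \<sigma> T 2 \<eta> m}"
    define N where "N = real (eigen_count lam (cutoff lam \<sigma> T 2 \<eta> m))"
    define G where "G = exp (C3 * (1 + (4 * 2 ^ m / T) powr \<beta>)) *
         exp ((4 * C3 * 2 ^ m / T * ln (exp 1 + exp (\<eta> * X m) * N)) powr \<sigma>)"
    have N: "N = real (card A)"
      by (simp add: N_def A_def eigen_count_def)
    have "0 \<le> G" by (simp add: G_def)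
    have fG: "(norm (ext_zero \<omega> (f m j)))\<^sup>2 \<le> G" if "j \<in> A" for j
    proof -
      have "2 / (T / (2 * 2 ^ m)) = 4 * 2 ^ m / T" "2 * C3 / (T / (2 * 2 ^ m)) = 4 * C3 * 2 ^ m / T"
        by simp_all
      then show ?thesis
        using ctrl[of j m] that
        by (simp only: A_def mem_Collect_eq impulse_control_def Let_def gd norm_on_eq[OF \<omega>]
            G_def N_def X_def \<beta>_def)
    qed
    have "(norm (ext_zero \<omega> (F m)))\<^sup>2
        = (norm (\<Sum>j\<in>A. inner (z (grid_time T 2 m)) (\<Phi> j) *\<^sub>R ext_zero \<omega> (f m j)))\<^sup>2"
      by (simp add: F_def A_def feedback_def linear_sum[OF linear_ext_zero] linear_scale[OF linear_ext_zero])
    also have "\<dots> \<le> (\<Sum>j\<in>A. (inner (z (grid_time T 2 m)) (\<Phi> j))\<^sup>2) * (N * G)"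
      unfolding N by (rule norm_sum_scaleR_le[OF fG \<open>0 \<le> G\<close>])
    also have "\<dots> \<le> (norm (z (grid_time T 2 m)))\<^sup>2 * exp (\<gamma> * X m)"
    proof (rule mult_mono)
      show "(\<Sum>j\<in>A. (inner (z (grid_time T 2 m)) (\<Phi> j))\<^sup>2) \<le> (norm (z (grid_time T 2 m)))\<^sup>2"
        unfolding A_def by (rule bessel[OF finite_low])
      show "N * G \<le> exp (\<gamma> * X m)"
        using cost[of m] by (simp only: Let_def N_def G_def X_def)
    qed (use \<open>0 \<le> G\<close> N in auto)
    \<comment> \<open>The squared state decays like \<open>exp (- 2 * \<gamma> * X m)\<close> and
      the cost takes \<open>exp (\<gamma> * X m)\<close> of this, so the control keeps half of the
      rate.\<close>
    also have "\<dots> \<le> (exp (\<eta> / 4 - \<gamma> * X m) * norm (z 0))\<^sup>2 * exp (\<gamma> * X m)"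
      using grid[of m] by (intro mult_right_mono power_mono) (auto simp: X_def)
    also have "\<dots> = (exp (\<eta> / 4 - \<gamma> / 2 * X m) * norm (z 0))\<^sup>2"
    proof -
      have "(exp (\<eta> / 4 - \<gamma> * X m))\<^sup>2 * exp (\<gamma> * X m) = (exp (\<eta> / 4 - \<gamma> / 2 * X m))\<^sup>2"
        by (simp add: algebra_simps flip: exp_double exp_add)
      then show ?thesis
        by (simp add: power_mult_distrib)
    qed
    finally show ?thesis
      by (rule power2_le_imp_le) simp
  qed
  then show "norm (ext_zero \<omega> (feedback lam \<Phi> \<sigma> T 2 \<eta> f m (z (grid_time T 2 m))))
       \<le> exp (\<eta> / 4 - \<gamma> / 2 * 2 powr (\<beta> * real m)) * norm (z 0)"
    by (simp add: F_def X_def)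
  show "norm (z t) \<le> 2 * exp (\<eta> / 4 - \<gamma> / 2 * 2 powr (\<beta> * real m)) * norm (z 0)"
    if "grid_time T 2 m \<le> t" "t \<le> grid_time T 2 (Suc m)"
  proof -
    have "norm (z t) \<le> norm (z (grid_time T 2 m)) + norm (ext_zero \<omega> (F m))"
      using that by (intro impulsive_step_norm_le[OF zm s]) auto
    moreover have "exp (\<eta> / 4 - \<gamma> * X m) * norm (z 0) \<le> exp (\<eta> / 4 - \<gamma> / 2 * X m) * norm (z 0)"
      using \<gamma> X[of m] by (intro mult_right_mono) auto
    ultimately show ?thesis
      using grid[of m] F_le[of m] by (simp add: X_def)
  qed
qed

text \<open>Admissible controls are not unique and the estimates use only their defining bounds;
  hence \<open>b\<close>, \<open>\<eta>\<close>, \<open>C\<close> and \<open>K\<close> are chosen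
  before the family \<open>f\<close>. The two existence claims keep the quantifications over
  \<open>C3\<close> and over \<open>f\<close> from being vacuous.\<close>

theorem theorem3p5:
  fixes \<Omega> \<omega> :: "'a::euclidean_space set"
    and D :: "'a l2 set" and P :: "'a l2 \<Rightarrow> 'a l2"
    and lam :: "nat \<Rightarrow> real" and \<Phi> :: "nat \<Rightarrow> 'a l2"
    and \<sigma> c \<rho> :: real
  assumes "bounded_C2_domain \<Omega>"
    and "self_adjoint_on (L2_on \<Omega>) D P"
    and "graph_isomorphism (L2_on \<Omega>) D P"
    and "compact_operator_on (L2_on \<Omega>) (inv_into D P)"
    and "\<And>\<theta>. \<theta> \<in> D \<Longrightarrow> \<theta> \<noteq> 0 \<Longrightarrow> inner (P \<theta>) \<theta> > 0"
    and "orthonormal_eigenbasis (L2_on \<Omega>) D P lam \<Phi>"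
    and "open \<omega>" and "\<omega> \<noteq> {}" and "\<omega> \<subseteq> \<Omega>"
    and "0 < \<sigma>" and "\<sigma> < 1"
    and "(\<exists>C1>0. spectral_inequality \<omega> lam \<Phi> \<sigma> C1) \<or>
         (\<exists>C2>0. interpolation_inequality \<Omega> \<omega> D P \<sigma> C2) \<or>
         (\<exists>C3>0. approximate_observability \<Omega> \<omega> D P \<sigma> C3) \<or>
         (\<exists>C4>0. frequency_observability \<Omega> \<omega> D P \<sigma> C4)"
    and "c > 0" and "\<rho> > 0"
    and "\<And>\<Lambda>. \<Lambda> > 0 \<Longrightarrow> real (eigen_count lam \<Lambda>) \<le> c * \<Lambda> powr (1 / \<rho>)"
  shows
    "(\<exists>C3>0. approximate_observability \<Omega> \<omega> D P \<sigma> C3) \<and>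
     (\<forall>C3>0. approximate_observability \<Omega> \<omega> D P \<sigma> C3 \<longrightarrow>
       (\<forall>T>0. \<exists>b>1. \<exists>\<eta>>1. \<exists>C>0. \<exists>K>0.
          (\<exists>f. impulse_control_family \<omega> D P lam \<Phi> \<sigma> C3 T b \<eta> f) \<and>
          (\<forall>f. impulse_control_family \<omega> D P lam \<Phi> \<sigma> C3 T b \<eta> f \<longrightarrow>
            (\<forall>z0 \<in> L2_on \<Omega>. \<forall>z.
               impulsive_solution D P {0..<T} UNIV (impulse_time T b)
                 (\<lambda>m. ext_zero \<omega> (feedback lam \<Phi> \<sigma> T b \<eta> f m (z (grid_time T b m)))) z \<and>
               z 0 = z0 \<longrightarrow>
               (\<forall>t. 0 \<le> t \<and> t < T \<longrightarrow>
                  norm (z t)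
                    \<le> C * exp (- (1 / K) * (T / (T - t)) powr (\<sigma> / (1 - \<sigma>))) * norm z0) \<and>
               (\<lambda>m. norm_on \<omega> (feedback lam \<Phi> \<sigma> T b \<eta> f m (z (grid_time T b m))))
                 \<longlonglongrightarrow> 0))))"
proof -
  note sa = assms(2) and iso = assms(3) and cpt = assms(4) and basis = assms(6)
    and \<omega>_open = assms(7) and \<omega>_sub = assms(9) and \<sigma> = assms(10,11) and equiv = assms(12)
    and c = assms(13) and \<rho> = assms(14) and count = assms(15)
  have es: "eigen_system (L2_on \<Omega>) D P lam \<Phi>"
    using sa basis by (rule eigen_system.intro)
  have ces: "compact_eigen_system (L2_on \<Omega>) D P lam \<Phi>"
    using es iso cpt by (simp add: compact_eigen_system_def compact_eigen_system_axioms_def graph_isomorphism_def)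
  interpret compact_eigen_system "L2_on \<Omega>" D P lam \<Phi> by (rule ces)
  have \<omega>: "\<omega> \<in> sets lebesgue"
    using \<omega>_open by (simp add: lmeasurable_iff_integrable borel_open)
  have W0: "0 \<le> norm_on \<omega> f" for f
    by (simp add: norm_on_eq[OF \<omega>])
  have "\<exists>C3>0. approximate_observability \<Omega> \<omega> D P \<sigma> C3"
    using equiv
  proof (elim disjE exE conjE)
    fix C1 :: real assume "0 < C1" "spectral_inequality \<omega> lam \<Phi> \<sigma> C1"
    from approximate_observability_if_spectral[OF es \<sigma> this \<omega>] \<open>0 < C1\<close> show ?thesis
      by (intro exI conjI) (auto intro!: add_pos_nonneg)
  next
    fix C2 :: real assume "0 < C2" "interpolation_inequality \<Omega> \<omega> D P \<sigma> C2"
    from approximate_observability_if_interpolation[OF es \<sigma> this W0] \<open>0 < C2\<close> show ?thesis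
      by (intro exI conjI) (auto simp: less_max_iff_disj)
  next
    fix C4 :: real assume "0 < C4" "frequency_observability \<Omega> \<omega> D P \<sigma> C4"
    from approximate_observability_if_frequency[OF es \<sigma> this] \<open>0 < C4\<close> show ?thesis
      by (intro exI conjI) auto
  qed blast
  moreover have "\<exists>b>1. \<exists>\<eta>>1. \<exists>C>0. \<exists>K>0.
          (\<exists>f. impulse_control_family \<omega> D P lam \<Phi> \<sigma> C3 T b \<eta> f) \<and>
          (\<forall>f. impulse_control_family \<omega> D P lam \<Phi> \<sigma> C3 T b \<eta> f \<longrightarrow>
            (\<forall>z0 \<in> L2_on \<Omega>. \<forall>z.
               impulsive_solution D P {0..<T} UNIV (impulse_time T b)
                 (\<lambda>m. ext_zero \<omega> (feedback lam \<Phi> \<sigma> T b \<eta> f m (z (grid_time T b m)))) z \<and>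
               z 0 = z0 \<longrightarrow>
               (\<forall>t. 0 \<le> t \<and> t < T \<longrightarrow>
                  norm (z t)
                    \<le> C * exp (- (1 / K) * (T / (T - t)) powr (\<sigma> / (1 - \<sigma>))) * norm z0) \<and>
               (\<lambda>m. norm_on \<omega> (feedback lam \<Phi> \<sigma> T b \<eta> f m (z (grid_time T b m))))
                 \<longlonglongrightarrow> 0))"
    if "0 < C3" and obs: "approximate_observability \<Omega> \<omega> D P \<sigma> C3" and T: "0 < T" for C3 T
  proof -
    define \<beta> where "\<beta> = \<sigma> / (1 - \<sigma>)"
    have "0 < \<beta>" using \<sigma> by (simp add: \<beta>_def)
    obtain \<eta> where \<eta>: "4 \<le> \<eta>" and cost:
      "\<And>(m::nat) N. \<lbrakk>1 \<le> N; N \<le> c * (lam 0 + 2 * \<eta> / T * 2 powr ((\<beta> + 1) * real m)) powr (1 / \<rho>)\<rbrakk> \<Longrightarrow>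
       N * (exp (C3 * (1 + (4 * 2 ^ m / T) powr \<beta>)) *
         exp ((4 * C3 * 2 ^ m / T * ln (exp 1 + exp (\<eta> * 2 powr (\<beta> * real m)) * N)) powr \<sigma>))
       \<le> exp (\<eta> / 4 * 2 powr (- \<beta>) * 2 powr (\<beta> * real m))"
      using cost_bound[OF \<sigma> \<beta>_def T \<open>0 < C3\<close> c \<rho> lam_pos[of 0]] by blast
    define \<gamma> where "\<gamma> = \<eta> / 4 * 2 powr (- \<beta>)"
    have \<gamma>: "0 < \<gamma>" using \<eta> by (simp add: \<gamma>_def)
    have cost': "let N = real (eigen_count lam (cutoff lam \<sigma> T 2 \<eta> m)) in
       N * (exp (C3 * (1 + (4 * 2 ^ m / T) powr (\<sigma> / (1 - \<sigma>)))) *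
         exp ((4 * C3 * 2 ^ m / T * ln (exp 1 + exp (\<eta> * 2 powr (\<sigma> / (1 - \<sigma>) * real m)) * N)) powr \<sigma>))
       \<le> exp (\<eta> / 4 * 2 powr (- (\<sigma> / (1 - \<sigma>))) * 2 powr (\<sigma> / (1 - \<sigma>) * real m))" for m
      unfolding Let_def \<beta>_def[symmetric]
    proof (rule cost)
      have low: "lam 0 \<le> cutoff lam \<sigma> T 2 \<eta> m"
        using T \<eta> by (simp add: cutoff_def)
      then have "0 < eigen_count lam (cutoff lam \<sigma> T 2 \<eta> m)"
        using finite_low by (auto simp: eigen_count_def card_gt_0_iff)
      then show "1 \<le> real (eigen_count lam (cutoff lam \<sigma> T 2 \<eta> m))"
        by simp
      have "cutoff lam \<sigma> T 2 \<eta> m = lam 0 + 2 * \<eta> / T * 2 powr ((\<beta> + 1) * real m)"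
        by (simp add: cutoff_def \<beta>_def)
      then show "real (eigen_count lam (cutoff lam \<sigma> T 2 \<eta> m))
          \<le> c * (lam 0 + 2 * \<eta> / T * 2 powr ((\<beta> + 1) * real m)) powr (1 / \<rho>)"
        using count[of "cutoff lam \<sigma> T 2 \<eta> m"] lam_pos[of 0] low by simp
    qed
    \<comment> \<open>The 2 in \<open>C\<close> adds the state at the last grid time and the jump.
      On the \<open>m\<close>-th interval \<open>T / (T - t)\<close> is at most
      \<open>2 ^ Suc m\<close>, one power more than in \<open>2 powr (\<beta> * real m)\<close>;
      this costs the \<open>2 powr \<beta>\<close> in \<open>K\<close>, and the 2 there reflects the
      halved rate.\<close>
    define C where "C = 2 * exp (\<eta> / 4)"
    define K where "K = 2 * 2 powr \<beta> / \<gamma>"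
    have "\<exists>f. impulse_control_family \<omega> D P lam \<Phi> \<sigma> C3 T 2 \<eta> f"
    proof -
      have "\<forall>m j. \<exists>g. impulse_control \<omega> D P lam \<Phi> \<sigma> C3 T 2 \<eta> m j g"
        using impulse_control_exists[OF ces obs \<omega> \<omega>_sub T] \<eta> by simp
      then show ?thesis
        unfolding impulse_control_family_def by metis
    qed
    moreover have "norm (z t) \<le> C * exp (- (1 / K) * (T / (T - t)) powr (\<sigma> / (1 - \<sigma>))) * norm (z 0)"
      if fam: "impulse_control_family \<omega> D P lam \<Phi> \<sigma> C3 T 2 \<eta> f"
        and z: "impulsive_solution D P {0..<T} UNIV (impulse_time T 2)
          (\<lambda>m. ext_zero \<omega> (feedback lam \<Phi> \<sigma> T 2 \<eta> f m (z (grid_time T 2 m)))) z"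
        and t: "0 \<le> t" "t < T" for f z t
    proof -
      obtain m where m: "grid_time T 2 m \<le> t" "t < grid_time T 2 (Suc m)"
        using grid_time_interval[OF T _ t, of 2] by auto
      have "norm (z t) \<le> 2 * exp (\<eta> / 4 - \<gamma> / 2 * 2 powr (\<beta> * real m)) * norm (z 0)"
        using feedback_decay(3)[OF es \<sigma> T \<eta> \<omega> cost' fam z m(1) less_imp_le[OF m(2)]]
        by (simp add: \<gamma>_def \<beta>_def)
      also have "\<dots> = C * exp (- (\<gamma> / 2 * 2 powr (\<beta> * real m))) * norm (z 0)"
        by (simp add: C_def flip: exp_add)
      also have "\<dots> \<le> C * exp (- (1 / K) * (T / (T - t)) powr \<beta>) * norm (z 0)"
      proof -
        have "T / (T - t) \<le> 2 ^ Suc m"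
          using m(2) t by (simp add: grid_time_def field_simps)
        then have "(T / (T - t)) powr \<beta> \<le> (2 ^ Suc m) powr \<beta>"
          using T t \<open>0 < \<beta>\<close> by (intro powr_mono2) auto
        also have "\<dots> = 2 powr \<beta> * 2 powr (\<beta> * real m)"
        proof -
          have "(2::real) ^ Suc m = 2 powr real (Suc m)"
            by (rule powr_realpow[symmetric]) simp
          then show ?thesis
            by (simp add: powr_powr distrib_left mult.commute flip: powr_add)
        qed
        finally have "1 / K * (T / (T - t)) powr \<beta> \<le> 1 / K * (2 powr \<beta> * 2 powr (\<beta> * real m))"
          using \<gamma> by (intro mult_left_mono) (auto simp: K_def)
        also have "\<dots> = \<gamma> / 2 * 2 powr (\<beta> * real m)"
          by (simp add: K_def)
        finally show ?thesis
          by (intro mult_right_mono mult_left_mono) (auto simp: C_def)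
      qed
      finally show ?thesis
        by (simp add: \<beta>_def)
    qed
    moreover have "(\<lambda>m. norm_on \<omega> (feedback lam \<Phi> \<sigma> T 2 \<eta> f m (z (grid_time T 2 m)))) \<longlonglongrightarrow> 0"
      if fam: "impulse_control_family \<omega> D P lam \<Phi> \<sigma> C3 T 2 \<eta> f"
        and z: "impulsive_solution D P {0..<T} UNIV (impulse_time T 2)
          (\<lambda>m. ext_zero \<omega> (feedback lam \<Phi> \<sigma> T 2 \<eta> f m (z (grid_time T 2 m)))) z" for f z
    proof (rule Lim_null_comparison)
      have "1 < 2 powr \<beta>" using \<open>0 < \<beta>\<close> by simp
      then have "(\<lambda>m. inverse ((2 powr \<beta>) ^ m)) \<longlonglongrightarrow> 0"
        by (rule LIMSEQ_inverse_realpow_zero)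
      then show "(\<lambda>m. exp (\<eta> / 4) * (2 / \<gamma>) * norm (z 0) * inverse ((2 powr \<beta>) ^ m)) \<longlonglongrightarrow> 0"
        by (rule tendsto_mult_right_zero)
      have "norm (norm_on \<omega> (feedback lam \<Phi> \<sigma> T 2 \<eta> f m (z (grid_time T 2 m))))
          \<le> exp (\<eta> / 4) * (2 / \<gamma>) * norm (z 0) * inverse ((2 powr \<beta>) ^ m)" for m
      proof -
        define X where "X = 2 powr (\<beta> * real m)"
        have X: "0 < X" "X = (2 powr \<beta>) ^ m"
          by (simp_all add: X_def powr_powr flip: powr_realpow)
        \<comment> \<open>A geometric majorant is enough for the limit, so the exponential is
          weakened to the reciprocal of its argument.\<close>
        have "exp (- (\<gamma> / 2 * X)) \<le> 2 / \<gamma> * inverse X"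
          using mult_exp_bound[of "\<gamma> / 2 * X"] X \<gamma> by (simp add: field_simps)
        then have "exp (\<eta> / 4) * exp (- (\<gamma> / 2 * X)) * norm (z 0) \<le> exp (\<eta> / 4) * (2 / \<gamma> * inverse X) * norm (z 0)"
          by (intro mult_right_mono mult_left_mono) auto
        moreover have "exp (\<eta> / 4) * exp (- (\<gamma> / 2 * X)) = exp (\<eta> / 4 - \<gamma> / 2 * X)"
          by (simp flip: exp_add)
        ultimately show ?thesis
          using feedback_decay(2)[OF es \<sigma> T \<eta> \<omega> cost' fam z, of m]
          by (simp add: norm_on_eq[OF \<omega>] mult_ac \<gamma>_def X_def[symmetric] X(2) flip: \<beta>_def)
      qed
      then show "eventually (\<lambda>m. norm (norm_on \<omega> (feedback lam \<Phi> \<sigma> T 2 \<eta> f m (z (grid_time T 2 m))))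
          \<le> exp (\<eta> / 4) * (2 / \<gamma>) * norm (z 0) * inverse ((2 powr \<beta>) ^ m)) sequentially"
        by simp
    qed
    moreover have "0 < C" "0 < K" "1 < \<eta>" "(1::real) < 2"
      using \<gamma> \<eta> by (simp_all add: C_def K_def)
    ultimately show ?thesis
      by blast
  qed
  ultimately show ?thesis
    by blast
qed

end
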